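(* Let $\mathbb X$ be a tangent category and let $(E,M,q,\zeta,\sigma,\lambda)$ and $(E',M',q',\zeta',\sigma',\lambda')$ be differential bundles in $\mathbb X$. Denote $\mathrm{Ind}(E)=(F_E,\hat\alpha)$ and $\mathrm{Ind}(E')=(F_{E'},\hat\alpha')$. (a) An additive morphism of differential bundles from $(E,M,q,\zeta,\sigma,\lambda)$ to $(E',M',q',\zeta',\sigma',\lambda')$ induces a natural transformation $\varphi:F_E\Rightarrow F_{E'}$ between the induced functors. (b) A linear morphism of differential bundles induces a linear natural transformation. (c) This defines two functors $$\mathrm{Ind}:\mathrm{DBun}_{\mathrm{add}}(\mathbb X)\to\mathrm{DiffFun}(\mathbb N^\bullet,\mathbb X)\qquad\text{and}\qquad\mathrm{Ind}:\mathrm{DBun}_{\mathrm{lin}}(\mathbb X)\to\mathrm{DiffFun}_{\mathrm{lin}}(\mathbb N^\bullet,\mathbb X).$$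
   Context: **Weil algebras and tangent actegories.** $\mathrm{Weil}$ is the category whose objects are the commutative $\mathbb N$-algebras (semirings) $\mathbb N[x_1,\dots,x_n]/\langle x_ix_j\mid i\sim j\rangle$ for an equivalence relation $\sim$ on $\{1,\dots,n\}$, with unital $\mathbb N$-linear semiring homomorphisms as morphisms. It is monoidal under the coproduct $\otimes$ with unit $\mathbb N$ (also terminal). $W=\mathbb N[x]/\langle x^2\rangle$; $W^n=\mathbb N[x_1,\dots,x_n]/\langle x_ix_j \mid \text{all } i,j\rangle$ is the $n$-fold product in $\mathrm{Weil}$; every object has the form $W^{n_1}\otimes\cdots\otimes W^{n_k}$. Distinguished morphisms: $p:W\to\mathbb N$, $ax+b\mapsto b$; $0:\mathbb N\to W$ the inclusion; $+:W\times W\to W$, $ax_1+bx_2+c\mapsto (a+b)x+c$; $\ell:W\to W\otimes W$, $ax+b\mapsto ax_1x_2+b$; $c:W\otimes W\to W\otimes W$ swapping $x_1,x_2$. A $\mathrm{Weil}$-actegory $(\mathbb X,T_\bullet)$ is a category with a functor $T_\bullet:\mathrm{Weil}\times\mathbb X\to\mathbb X$ and natural isomorphisms $X\cong T_\bullet(\mathbb N,X)$, $T_\bullet(A,T_\bullet(B,X))\cong T_\bullet(A\otimes B,X)$ satisfying the usual associativity and unit coherences. Write $T_A=T_\bullet(A,-)$ and $T_\theta$ for the natural transformation given by a morphism $\theta$ of $\mathrm{Weil}$. It is a tangent actegory if for each object $X$ the functor $T_{(-)}(X)$ sends to pullbacks: (i) the squares exhibiting $A\otimes(B\times C)$ as the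 pullback of $A\otimes B\to A\leftarrow A\otimes C$, whenever $B\times C$ exists in $\mathrm{Weil}$; (ii) the squares obtained by applying $W^{\otimes n}\otimes-$, $n\ge0$, to the pullback square with top $\nu:W\times W\to W\otimes W$, $\nu(ax_1+bx_2+c)=ax_1x_2+bx_2+c$, right side $1_W\otimes p:W\otimes W\to W$, left side the unique map $W\times W\to\mathbb N$ and bottom $0:\mathbb N\to W$. Tangent categories are identified with tangent actegories, with tangent functor $T:=T_W$ and structure maps $p:=T_p,\ 0:=T_0,\ +:=T_+,\ \ell:=T_\ell,\ c:=T_c$, under the identifications $T_{W\otimes W}=T\circ T$, $T_n:=T_{W^n}$. **Differential bundles.** An additive bundle $(X,A,p,+,0)$: a morphism $p:X\to A$ with pullback powers $X_n$ of $p$ over $A$ ($X_0=A$, $X_1=X$), and $+:X_2\to X$, $0:A\to X$ with $p\circ +=p\circ\pi_0=p\circ\pi_1$, $p\circ0=1_A$, and $+$ associative, commutative and with unit $0$. An additive bundle morphism $(f,g)$ is a pair $f:X\to Y$, $g:A\to B$ with $p'f=gp$, $f\circ+=+'\circ f_2$, $f\circ0=0'\circ g$ ($f_n$ is the map induced on $n$-fold pullback powers). A differential bundle $(E,M,q,\zeta,\sigma,\lambda)$ in $(\mathbb X,T)$ consists of $q:E\to M$ whose finite pullback powers $E_n$ exist and are preserved by all $T^k$; $\zeta:M\to E$, $\sigma:E_2\to E$ making $(E,M,q,\sigma,\zeta)$ an additive bundle; and $\lambda:E\to TE$ such that $(\lambda,0_M)$ is an additive bundle morphism to $(TE,TM,Tq,T\sigma,T\zeta)$,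 $(\lambda,\zeta)$ is an additive bundle morphism to $(TE,E,p_E,+_E,0_E)$, $\ell_E\circ\lambda=T(\lambda)\circ\lambda$, and the square with top $T(\sigma)\circ\langle\lambda\pi_0,0\pi_1\rangle:E_2\to TE$, left $q\pi_0:E_2\to M$, bottom $0_M:M\to TM$, right $T(q)$ is a pullback. A morphism of differential bundles $(f,g)$ is a pair $f:E\to E'$, $g:M\to M'$ with $q'f=gq$; it is additive if $f\sigma=\sigma'f_2$ and $f\zeta=\zeta'g$, and linear if $\lambda'f=T(f)\lambda$. (Linear morphisms are additive.) $\mathrm{DBun}_{\mathrm{add}}(\mathbb X)$ and $\mathrm{DBun}_{\mathrm{lin}}(\mathbb X)$ are the categories of differential bundles with additive, resp. linear, morphisms. **Differential functors.** An oplax $\mathrm{Weil}$-linear functor $(F,\hat\alpha):(\mathbb X,T_\bullet)\to(\mathbb X',T'_\bullet)$ is a functor $F$ with a natural transformation $\hat\alpha:F\circ T_\bullet\Rightarrow T'_\bullet\circ(1\times F)$, components $\hat\alpha_{A,X}:F(T_AX)\to T'_A(FX)$, satisfying (modulo the structure isomorphisms) $\hat\alpha_{A\otimes B,X}=T'_A(\hat\alpha_{B,X})\circ\hat\alpha_{A,T_BX}$ and $\hat\alpha_{\mathbb N,X}=1_{FX}$. Suppose $\mathbb X$ has a terminal object $*$. $(F,\hat\alpha)$ is a lax differential functor if for all $A\in\mathrm{Weil}$: (a) $T'_A\circ F$ preserves pullbacks over $*$, and (b) all naturality squares of $\hat\alpha_{A,-}:F\circ T_A\Rightarrow T'_A\circ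 F$ are pullbacks. $\mathrm{DiffFun}(\mathbb X,\mathbb X')$ has lax differential functors as objects and all natural transformations $\varphi:F\Rightarrow F'$ of underlying functors as morphisms; $\mathrm{DiffFun}_{\mathrm{lin}}(\mathbb X,\mathbb X')$ has the same objects and only the linear ones, i.e. those $\varphi:(F,\hat\alpha)\Rightarrow(F',\hat\alpha')$ with $\hat\alpha'_{A,X}\circ\varphi_{T_AX}=T'_A(\varphi_X)\circ\hat\alpha_{A,X}$ for all $A,X$. **The tangent actegory $\mathbb N^\bullet$.** Objects $\mathbb N^k$ ($k\ge0$), morphisms $\mathbb N^m\to\mathbb N^n$ the $n\times m$ matrices over $\mathbb N$, composition matrix multiplication; $\mathbb N^0$ is terminal. Action: $D_\bullet(A,\mathbb N^k)=\underline A\otimes\mathbb N^k$ with $\underline A$ the underlying additive monoid of $A$; so $D_W(\mathbb N^k)=\mathbb N^k\times\mathbb N^k$ with $p=\pi_0$, $0=\langle1,0\rangle$, $+=\langle\pi_0,\pi_1+\pi_2\rangle$, $\ell=\langle\pi_0,0,0,\pi_1\rangle$, $c=\langle\pi_0,\pi_2,\pi_1,\pi_3\rangle$. **Ind on objects (the induced functors).** For a differential bundle $(E,M,q,\zeta,\sigma,\lambda)$ in $\mathbb X$, $\mathrm{Ind}(E)=(F_E,\hat\alpha)$ is the following lax differential functor $\mathbb N^\bullet\to\mathbb X$. $F_E(\mathbb N^k)=E_k$ ($E_0=M$), and a matrix $(a_{ij}):\mathbb N^m\to\mathbb N^n$ is sent to the map $E_m\to E_n$ over $M$ with $i$-th component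 $\sum_{j=1}^m a_{ij}\cdot\pi_j$, where $\pi_j:E_m\to E$ is the $j$-th projection and sums and $\mathbb N$-multiples are taken in the commutative monoid of maps $E_m\to E$ over $M$, with addition $f+g=\sigma\circ\langle f,g\rangle$ and zero the structure map $E_m\to M$ followed by $\zeta$. The components $\hat\alpha_{A,\mathbb N^l}:F_E(D_A(\mathbb N^l))\to T_A(E_l)$ are: $\hat\alpha_{\mathbb N,\mathbb N^l}=1$; $\hat\alpha_{W,\mathbb N^1}=T(\sigma)\circ\langle0\pi_0,\lambda\pi_1\rangle:E_2\to TE$; $\hat\alpha_{W^k,\mathbb N^0}:M\to T_{W^k}M$ the zero map induced by $\mathbb N\to W^k$ (in particular $\hat\alpha_{W,\mathbb N^0}=0_M$); $\hat\alpha_{W^k,\mathbb N^1}:E_{k+1}\to T_kE$ the $k$-fold fibre power of $\hat\alpha_{W,\mathbb N^1}$ over $E$ (via $\pi_0:E_2\to E$ and $p_E:TE\to E$); $\hat\alpha_{W^k,\mathbb N^l}$ the $l$-fold fibre power of $\hat\alpha_{W^k,\mathbb N^1}$ over $\hat\alpha_{W^k,\mathbb N^0}$, i.e. the unique map with $T_{W^k}(\pi_j)\circ\hat\alpha_{W^k,\mathbb N^l}=\hat\alpha_{W^k,\mathbb N^1}\circ F_E(D_{W^k}(\pi_j))$ for $1\le j\le l$; and $\hat\alpha_{A\otimes B,\mathbb N^l}=T_A(\hat\alpha_{B,\mathbb N^l})\circ\hat\alpha_{A,D_B(\mathbb N^l)}$. *)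

theory Defs
  imports "HOL-Algebra.Ring" "Jordan_Normal_Form.Matrix"
begin

section \<open>Categories\<close>

record ('o, 'a) cat =
  Obj :: "'o set"
  Arr :: "'a set"
  Dom :: "'a \<Rightarrow> 'o"
  Cod :: "'a \<Rightarrow> 'o"
  Id  :: "'o \<Rightarrow> 'a"
  Cmp :: "'a \<Rightarrow> 'a \<Rightarrow> 'a"  (infixl \<open>\<cdot>\<index>\<close> 70)

definition Hom :: "('o, 'a, 'z) cat_scheme \<Rightarrow> 'o \<Rightarrow> 'o \<Rightarrow> 'a set" where
  "Hom C x y = {f \<in> Arr C. Dom C f = x \<and> Cod C f = y}"

definition category :: "('o, 'a, 'z) cat_scheme \<Rightarrow> bool" where
  "category C \<longleftrightarrow>
     (\<forall>f\<in>Arr C. Dom C f \<in> Obj C \<and> Cod C f \<in> Obj C) \<and>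
     (\<forall>x\<in>Obj C. Id C x \<in> Hom C x x) \<and>
     (\<forall>f\<in>Arr C. \<forall>g\<in>Arr C. Dom C g = Cod C f \<longrightarrow> g \<cdot>\<^bsub>C\<^esub> f \<in> Hom C (Dom C f) (Cod C g)) \<and>
     (\<forall>f\<in>Arr C. f \<cdot>\<^bsub>C\<^esub> Id C (Dom C f) = f \<and> Id C (Cod C f) \<cdot>\<^bsub>C\<^esub> f = f) \<and>
     (\<forall>f\<in>Arr C. \<forall>g\<in>Arr C. \<forall>h\<in>Arr C. Dom C g = Cod C f \<longrightarrow> Dom C h = Cod C g \<longrightarrow>
        h \<cdot>\<^bsub>C\<^esub> (g \<cdot>\<^bsub>C\<^esub> f) = h \<cdot>\<^bsub>C\<^esub> g \<cdot>\<^bsub>C\<^esub> f)"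

definition is_inverse :: "('o, 'a, 'z) cat_scheme \<Rightarrow> 'a \<Rightarrow> 'a \<Rightarrow> bool" where
  "is_inverse C f g \<longleftrightarrow> g \<in> Hom C (Cod C f) (Dom C f) \<and>
     g \<cdot>\<^bsub>C\<^esub> f = Id C (Dom C f) \<and> f \<cdot>\<^bsub>C\<^esub> g = Id C (Cod C f)"

definition is_iso :: "('o, 'a, 'z) cat_scheme \<Rightarrow> 'a \<Rightarrow> bool" where
  "is_iso C f \<longleftrightarrow> f \<in> Arr C \<and> (\<exists>g. is_inverse C f g)"

definition inv_arr :: "('o, 'a, 'z) cat_scheme \<Rightarrow> 'a \<Rightarrow> 'a" where
  "inv_arr C f = (THE g. is_inverse C f g)"

definition is_functor ::
  "('o, 'a, 'z) cat_scheme \<Rightarrow> ('p, 'b, 'y) cat_scheme \<Rightarrow> ('o \<Rightarrow> 'p) \<Rightarrow> ('a \<Rightarrow> 'b) \<Rightarrow> bool" where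
  "is_functor C D Fo Fm \<longleftrightarrow> category C \<and> category D \<and>
     (\<forall>x\<in>Obj C. Fo x \<in> Obj D) \<and>
     (\<forall>f\<in>Arr C. Fm f \<in> Hom D (Fo (Dom C f)) (Fo (Cod C f))) \<and>
     (\<forall>x\<in>Obj C. Fm (Id C x) = Id D (Fo x)) \<and>
     (\<forall>f\<in>Arr C. \<forall>g\<in>Arr C. Dom C g = Cod C f \<longrightarrow> Fm (g \<cdot>\<^bsub>C\<^esub> f) = Fm g \<cdot>\<^bsub>D\<^esub> Fm f)"

definition natural_transformation ::
  "('o, 'a, 'z) cat_scheme \<Rightarrow> ('p, 'b, 'y) cat_scheme \<Rightarrow>
   ('o \<Rightarrow> 'p) \<Rightarrow> ('a \<Rightarrow> 'b) \<Rightarrow> ('o \<Rightarrow> 'p) \<Rightarrow> ('a \<Rightarrow> 'b) \<Rightarrow> ('o \<Rightarrow> 'b) \<Rightarrow> bool" where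
  "natural_transformation C D Fo Fm Go Gm \<phi> \<longleftrightarrow>
     is_functor C D Fo Fm \<and> is_functor C D Go Gm \<and>
     (\<forall>x\<in>Obj C. \<phi> x \<in> Hom D (Fo x) (Go x)) \<and>
     (\<forall>f\<in>Arr C. Gm f \<cdot>\<^bsub>D\<^esub> \<phi> (Dom C f) = \<phi> (Cod C f) \<cdot>\<^bsub>D\<^esub> Fm f)"

definition prod_cat ::
  "('o, 'a, 'z) cat_scheme \<Rightarrow> ('p, 'b, 'y) cat_scheme \<Rightarrow> ('o \<times> 'p, 'a \<times> 'b) cat" where
  "prod_cat C D = \<lparr>Obj = Obj C \<times> Obj D, Arr = Arr C \<times> Arr D,
     Dom = (\<lambda>(f, g). (Dom C f, Dom D g)), Cod = (\<lambda>(f, g). (Cod C f, Cod D g)),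
     Id = (\<lambda>(x, y). (Id C x, Id D y)),
     Cmp = (\<lambda>(f', g') (f, g). (f' \<cdot>\<^bsub>C\<^esub> f, g' \<cdot>\<^bsub>D\<^esub> g))\<rparr>"

definition is_terminal :: "('o, 'a, 'z) cat_scheme \<Rightarrow> 'o \<Rightarrow> bool" where
  "is_terminal C t \<longleftrightarrow> t \<in> Obj C \<and> (\<forall>x\<in>Obj C. \<exists>!f. f \<in> Hom C x t)"

definition is_product :: "('o, 'a, 'z) cat_scheme \<Rightarrow> 'o \<Rightarrow> 'o \<Rightarrow> 'o \<Rightarrow> 'a \<Rightarrow> 'a \<Rightarrow> bool" where
  "is_product C P y z \<pi> \<rho> \<longleftrightarrow> \<pi> \<in> Hom C P y \<and> \<rho> \<in> Hom C P z \<and>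
     (\<forall>x\<in>Obj C. \<forall>f\<in>Hom C x y. \<forall>g\<in>Hom C x z.
        \<exists>!h. h \<in> Hom C x P \<and> \<pi> \<cdot>\<^bsub>C\<^esub> h = f \<and> \<rho> \<cdot>\<^bsub>C\<^esub> h = g)"

text \<open>\<open>is_pullback C t l r b\<close>: the square with top \<open>t\<close>, left side \<open>l\<close>, right side \<open>r\<close>
  and bottom \<open>b\<close> is a pullback of \<open>r\<close> and \<open>b\<close>.\<close>

definition is_pullback :: "('o, 'a, 'z) cat_scheme \<Rightarrow> 'a \<Rightarrow> 'a \<Rightarrow> 'a \<Rightarrow> 'a \<Rightarrow> bool" where
  "is_pullback C t l r b \<longleftrightarrow>
     t \<in> Arr C \<and> l \<in> Arr C \<and> r \<in> Arr C \<and> b \<in> Arr C \<and>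
     Dom C t = Dom C l \<and> Cod C t = Dom C r \<and> Cod C l = Dom C b \<and> Cod C r = Cod C b \<and>
     r \<cdot>\<^bsub>C\<^esub> t = b \<cdot>\<^bsub>C\<^esub> l \<and>
     (\<forall>f\<in>Arr C. \<forall>g\<in>Arr C. Dom C f = Dom C g \<longrightarrow> Cod C f = Dom C r \<longrightarrow> Cod C g = Dom C b \<longrightarrow>
        r \<cdot>\<^bsub>C\<^esub> f = b \<cdot>\<^bsub>C\<^esub> g \<longrightarrow>
        (\<exists>!h. h \<in> Hom C (Dom C f) (Dom C t) \<and> t \<cdot>\<^bsub>C\<^esub> h = f \<and> l \<cdot>\<^bsub>C\<^esub> h = g))"

text \<open>\<open>P\<close>, with structure map \<open>s : P \<rightarrow> A\<close> and projections \<open>\<pi> 0, \<dots>, \<pi> (n - 1)\<close>, is an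
  \<open>n\<close>-fold pullback power over \<open>A\<close> of \<open>q : X \<rightarrow> A\<close>.  For \<open>n = 0\<close> this says that \<open>s\<close> is invertible.\<close>

definition fibre_power ::
  "('o, 'a, 'z) cat_scheme \<Rightarrow> 'a \<Rightarrow> nat \<Rightarrow> 'o \<Rightarrow> 'a \<Rightarrow> (nat \<Rightarrow> 'a) \<Rightarrow> bool" where
  "fibre_power C q n P s \<pi> \<longleftrightarrow>
     q \<in> Arr C \<and> s \<in> Hom C P (Cod C q) \<and>
     (\<forall>j<n. \<pi> j \<in> Hom C P (Dom C q) \<and> q \<cdot>\<^bsub>C\<^esub> \<pi> j = s) \<and>
     (\<forall>g\<in>Arr C. \<forall>f. Cod C g = Cod C q \<longrightarrow>
        (\<forall>j<n. f j \<in> Hom C (Dom C g) (Dom C q) \<and> q \<cdot>\<^bsub>C\<^esub> f j = g) \<longrightarrow>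
        (\<exists>!h. h \<in> Hom C (Dom C g) P \<and> s \<cdot>\<^bsub>C\<^esub> h = g \<and> (\<forall>j<n. \<pi> j \<cdot>\<^bsub>C\<^esub> h = f j)))"


section \<open>The category of Weil algebras\<close>

text \<open>The pair \<open>(n, R)\<close> stands for \<open>\<nat>[x\<^sub>1, \<dots>, x\<^sub>n] / \<langle>x\<^sub>i x\<^sub>j | (i, j) \<in> R\<rangle>\<close>.  As \<open>R\<close> is reflexive
  on \<open>{1..n}\<close>, this quotient is the free \<open>\<nat>\<close>-module on the monomials \<open>\<Prod>i\<in>S. x\<^sub>i\<close> where \<open>S\<close> contains
  no two distinct related indices; all other monomials vanish.  An element is represented by its
  coefficient function, indexed by the sets \<open>S\<close>.\<close>

type_synonym weil = "nat \<times> (nat \<times> nat) set"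
type_synonym welem = "nat set \<Rightarrow> nat"
type_synonym weil_arr = "weil \<times> weil \<times> (welem \<Rightarrow> welem)"

definition weil_basis :: "weil \<Rightarrow> nat set set" where
  "weil_basis A = {S. S \<subseteq> {1..fst A} \<and> (\<forall>i\<in>S. \<forall>j\<in>S. (i, j) \<in> snd A \<longrightarrow> i = j)}"

definition weil_dim :: "weil \<Rightarrow> nat" where
  "weil_dim A = card (weil_basis A)"

definition weil_mon :: "nat set \<Rightarrow> welem" where
  "weil_mon S = (\<lambda>U. if U = S then 1 else 0)"

definition weil_alg :: "weil \<Rightarrow> welem ring" where
  "weil_alg A = \<lparr>carrier = {a. \<forall>S. S \<notin> weil_basis A \<longrightarrow> a S = 0},
     mult = (\<lambda>a b S. if S \<in> weil_basis A then \<Sum>U\<in>Pow S. a U * b (S - U) else 0),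
     one = weil_mon {}, zero = (\<lambda>S. 0), add = (\<lambda>a b S. a S + b S)\<rparr>"

text \<open>\<open>ring_hom\<close> does not ask for preservation of zero, which has to be added for semirings.\<close>

definition Weil :: "(weil, weil_arr) cat" where
  "Weil = \<lparr>Obj = {(n, R). equiv {1..n} R},
     Arr = {(A, B, h). equiv {1..fst A} (snd A) \<and> equiv {1..fst B} (snd B) \<and>
              h \<in> ring_hom (weil_alg A) (weil_alg B) \<and> h \<zero>\<^bsub>weil_alg A\<^esub> = \<zero>\<^bsub>weil_alg B\<^esub> \<and>
              h \<in> extensional (carrier (weil_alg A))},
     Dom = (\<lambda>(A, B, h). A), Cod = (\<lambda>(A, B, h). B),
     Id = (\<lambda>A. (A, A, \<lambda>a\<in>carrier (weil_alg A). a)),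
     Cmp = (\<lambda>(B, C, k) (A, B', h). (A, C, compose (carrier (weil_alg A)) k h))\<rparr>"

text \<open>The linear map which sends the basis monomial \<open>U\<close> to \<open>g U\<close>.\<close>

definition weil_lin :: "weil \<Rightarrow> weil \<Rightarrow> (nat set \<Rightarrow> welem) \<Rightarrow> weil_arr" where
  "weil_lin A B g =
     (A, B, \<lambda>a\<in>carrier (weil_alg A). \<lambda>V. \<Sum>U\<in>weil_basis A. a U * g U V)"

text \<open>\<open>weil_pw n\<close> is \<open>W\<^sup>n\<close>.\<close>

definition weil_N :: weil where "weil_N = (0, {})"
definition weil_pw :: "nat \<Rightarrow> weil" where "weil_pw n = (n, {1..n} \<times> {1..n})"
definition weil_W :: weil where "weil_W = weil_pw 1"

text \<open>The coproduct: the variables of the second factor are shifted behind those of the first.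
  With this choice the monoidal structure is strict.\<close>

definition weil_tensor :: "weil \<Rightarrow> weil \<Rightarrow> weil" where
  "weil_tensor A B = (fst A + fst B, snd A \<union> (\<lambda>(i, j). (i + fst A, j + fst A)) ` snd B)"

definition low_part :: "nat \<Rightarrow> nat set \<Rightarrow> nat set" where
  "low_part n S = {i \<in> S. i \<le> n}"

definition high_part :: "nat \<Rightarrow> nat set \<Rightarrow> nat set" where
  "high_part n S = {i. 1 \<le> i \<and> i + n \<in> S}"

definition weil_tensor_arr :: "weil_arr \<Rightarrow> weil_arr \<Rightarrow> weil_arr" where
  "weil_tensor_arr \<theta> \<theta>' = (case (\<theta>, \<theta>') of ((A, B, h), (A', B', h')) \<Rightarrow>
     weil_lin (weil_tensor A A') (weil_tensor B B')
       (\<lambda>U V. h (weil_mon (low_part (fst A) U)) (low_part (fst B) V) *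
              h' (weil_mon (high_part (fst A) U)) (high_part (fst B) V)))"

definition weil_aug :: "weil \<Rightarrow> weil_arr" where
  "weil_aug A = weil_lin A weil_N (\<lambda>U. if U = {} then weil_mon {} else (\<lambda>V. 0))"

definition weil_unit :: "weil \<Rightarrow> weil_arr" where
  "weil_unit A = weil_lin weil_N A weil_mon"

definition weil_proj :: "nat \<Rightarrow> nat \<Rightarrow> weil_arr" where
  "weil_proj n i = weil_lin (weil_pw n) weil_W
     (\<lambda>U. if U = {} then weil_mon {} else if U = {i} then weil_mon {1} else (\<lambda>V. 0))"

definition weil_plus :: weil_arr where
  "weil_plus = weil_lin (weil_pw 2) weil_W (\<lambda>U. if U = {} then weil_mon {} else weil_mon {1})"

definition weil_ell :: weil_arr where
  "weil_ell = weil_lin weil_W (weil_tensor weil_W weil_W)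
     (\<lambda>U. if U = {} then weil_mon {} else weil_mon {1, 2})"

definition weil_nu :: weil_arr where
  "weil_nu = weil_lin (weil_pw 2) (weil_tensor weil_W weil_W)
     (\<lambda>U. if U = {1} then weil_mon {1, 2} else weil_mon U)"

definition weil_tensors :: "nat list \<Rightarrow> weil" where
  "weil_tensors ns = foldr (\<lambda>n. weil_tensor (weil_pw n)) ns weil_N"


section \<open>Tangent actegories\<close>

text \<open>\<open>aunit x : x \<rightarrow> T\<^sub>\<nat> x\<close> and \<open>amult A B x : T\<^sub>A (T\<^sub>B x) \<rightarrow> T\<^bsub>A\<otimes>B\<^esub> x\<close> are the structure isomorphisms.\<close>

record ('o, 'a) actegory = "('o, 'a) cat" +
  act   :: "weil \<Rightarrow> 'o \<Rightarrow> 'o"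
  actm  :: "weil_arr \<Rightarrow> 'a \<Rightarrow> 'a"
  aunit :: "'o \<Rightarrow> 'a"
  amult :: "weil \<Rightarrow> weil \<Rightarrow> 'o \<Rightarrow> 'a"

definition actA :: "('o, 'a, 'z) actegory_scheme \<Rightarrow> weil \<Rightarrow> 'a \<Rightarrow> 'a" where
  "actA X A f = actm X (Id Weil A) f"

definition actT :: "('o, 'a, 'z) actegory_scheme \<Rightarrow> weil_arr \<Rightarrow> 'o \<Rightarrow> 'a" where
  "actT X \<theta> x = actm X \<theta> (Id X x)"

definition weil_actegory :: "('o, 'a, 'z) actegory_scheme \<Rightarrow> bool" where
  "weil_actegory X \<longleftrightarrow>
     is_functor (prod_cat Weil X) X (\<lambda>(A, x). act X A x) (\<lambda>(\<theta>, f). actm X \<theta> f) \<and>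
     (\<forall>x\<in>Obj X. aunit X x \<in> Hom X x (act X weil_N x) \<and> is_iso X (aunit X x)) \<and>
     (\<forall>f\<in>Arr X. aunit X (Cod X f) \<cdot>\<^bsub>X\<^esub> f = actA X weil_N f \<cdot>\<^bsub>X\<^esub> aunit X (Dom X f)) \<and>
     (\<forall>A\<in>Obj Weil. \<forall>B\<in>Obj Weil. \<forall>x\<in>Obj X.
        amult X A B x \<in> Hom X (act X A (act X B x)) (act X (weil_tensor A B) x) \<and>
        is_iso X (amult X A B x)) \<and>
     (\<forall>\<theta>\<in>Arr Weil. \<forall>\<theta>'\<in>Arr Weil. \<forall>f\<in>Arr X.
        amult X (Cod Weil \<theta>) (Cod Weil \<theta>') (Cod X f) \<cdot>\<^bsub>X\<^esub> actm X \<theta> (actm X \<theta>' f) =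
        actm X (weil_tensor_arr \<theta> \<theta>') f \<cdot>\<^bsub>X\<^esub> amult X (Dom Weil \<theta>) (Dom Weil \<theta>') (Dom X f)) \<and>
     (\<forall>A\<in>Obj Weil. \<forall>B\<in>Obj Weil. \<forall>C\<in>Obj Weil. \<forall>x\<in>Obj X.
        amult X (weil_tensor A B) C x \<cdot>\<^bsub>X\<^esub> amult X A B (act X C x) =
        amult X A (weil_tensor B C) x \<cdot>\<^bsub>X\<^esub> actA X A (amult X B C x)) \<and>
     (\<forall>A\<in>Obj Weil. \<forall>x\<in>Obj X.
        amult X weil_N A x \<cdot>\<^bsub>X\<^esub> aunit X (act X A x) = Id X (act X A x) \<and>
        amult X A weil_N x \<cdot>\<^bsub>X\<^esub> actA X A (aunit X x) = Id X (act X A x))"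

definition tangent_actegory :: "('o, 'a, 'z) actegory_scheme \<Rightarrow> bool" where
  "tangent_actegory X \<longleftrightarrow> weil_actegory X \<and>
     (\<forall>x\<in>Obj X.
        (\<forall>A\<in>Obj Weil. \<forall>B\<in>Obj Weil. \<forall>C\<in>Obj Weil. \<forall>P \<pi> \<rho>. is_product Weil P B C \<pi> \<rho> \<longrightarrow>
           is_pullback X
             (actT X (weil_tensor_arr (Id Weil A) \<pi>) x)
             (actT X (weil_tensor_arr (Id Weil A) \<rho>) x)
             (actT X (weil_tensor_arr (Id Weil A) (weil_aug B)) x)
             (actT X (weil_tensor_arr (Id Weil A) (weil_aug C)) x)) \<and>
        (\<forall>n. let I = Id Weil (weil_tensors (replicate n 1)) in
           is_pullback X
             (actT X (weil_tensor_arr I weil_nu) x)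
             (actT X (weil_tensor_arr I (weil_aug (weil_pw 2))) x)
             (actT X (weil_tensor_arr I (weil_tensor_arr (Id Weil weil_W) (weil_aug weil_W))) x)
             (actT X (weil_tensor_arr I (weil_unit weil_W)) x)))"

definition tan_obj :: "('o, 'a, 'z) actegory_scheme \<Rightarrow> 'o \<Rightarrow> 'o" where
  "tan_obj X x = act X weil_W x"

definition tan_arr :: "('o, 'a, 'z) actegory_scheme \<Rightarrow> 'a \<Rightarrow> 'a" where
  "tan_arr X f = actA X weil_W f"

definition tan_p :: "('o, 'a, 'z) actegory_scheme \<Rightarrow> 'o \<Rightarrow> 'a" where
  "tan_p X x = inv_arr X (aunit X x) \<cdot>\<^bsub>X\<^esub> actT X (weil_aug weil_W) x"

definition tan_zero :: "('o, 'a, 'z) actegory_scheme \<Rightarrow> 'o \<Rightarrow> 'a" where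
  "tan_zero X x = actT X (weil_unit weil_W) x \<cdot>\<^bsub>X\<^esub> aunit X x"

definition tan_plus :: "('o, 'a, 'z) actegory_scheme \<Rightarrow> 'o \<Rightarrow> 'a" where
  "tan_plus X x = actT X weil_plus x"

definition tan_ell :: "('o, 'a, 'z) actegory_scheme \<Rightarrow> 'o \<Rightarrow> 'a" where
  "tan_ell X x = inv_arr X (amult X weil_W weil_W x) \<cdot>\<^bsub>X\<^esub> actT X weil_ell x"


section \<open>Differential bundles\<close>

text \<open>A bundle carries chosen pullback powers \<open>pw n\<close> of \<open>prj : tot \<rightarrow> bas\<close> with projections
  \<open>pj n j\<close> for \<open>j < n\<close>.\<close>

record ('o, 'a) add_bundle =
  tot :: 'o
  bas :: 'o
  prj :: 'a
  pw  :: "nat \<Rightarrow> 'o"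
  pj  :: "nat \<Rightarrow> nat \<Rightarrow> 'a"
  pls :: 'a
  zer :: 'a

definition st :: "('o, 'a, 'z) cat_scheme \<Rightarrow> ('o, 'a, 'y) add_bundle_scheme \<Rightarrow> nat \<Rightarrow> 'a" where
  "st C B n = (if n = 0 then Id C (bas B) else prj B \<cdot>\<^bsub>C\<^esub> pj B n 0)"

text \<open>The map \<open>\<langle>f 0, \<dots>, f (n - 1)\<rangle>\<close> into \<open>pw B n\<close> over \<open>s : Z \<rightarrow> bas B\<close>.\<close>

definition ftuple ::
  "('o, 'a, 'z) cat_scheme \<Rightarrow> ('o, 'a, 'y) add_bundle_scheme \<Rightarrow> nat \<Rightarrow> 'a \<Rightarrow> (nat \<Rightarrow> 'a) \<Rightarrow> 'a" where
  "ftuple C B n s f = (THE h. h \<in> Hom C (Dom C s) (pw B n) \<and> st C B n \<cdot>\<^bsub>C\<^esub> h = s \<and>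
     (\<forall>j<n. pj B n j \<cdot>\<^bsub>C\<^esub> h = f j))"

definition fpair ::
  "('o, 'a, 'z) cat_scheme \<Rightarrow> ('o, 'a, 'y) add_bundle_scheme \<Rightarrow> 'a \<Rightarrow> 'a \<Rightarrow> 'a" where
  "fpair C B f g = ftuple C B 2 (prj B \<cdot>\<^bsub>C\<^esub> f) (\<lambda>j. if j = 0 then f else g)"

definition fsum ::
  "('o, 'a, 'z) cat_scheme \<Rightarrow> ('o, 'a, 'y) add_bundle_scheme \<Rightarrow> 'a \<Rightarrow> 'a \<Rightarrow> 'a" where
  "fsum C B f g = pls B \<cdot>\<^bsub>C\<^esub> fpair C B f g"

definition additive_bundle ::
  "('o, 'a, 'z) cat_scheme \<Rightarrow> ('o, 'a, 'y) add_bundle_scheme \<Rightarrow> bool" where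
  "additive_bundle C B \<longleftrightarrow>
     prj B \<in> Hom C (tot B) (bas B) \<and>
     (\<forall>n. fibre_power C (prj B) n (pw B n) (st C B n) (pj B n)) \<and>
     pw B 0 = bas B \<and> pw B 1 = tot B \<and> pj B 1 0 = Id C (tot B) \<and>
     pls B \<in> Hom C (pw B 2) (tot B) \<and> zer B \<in> Hom C (bas B) (tot B) \<and>
     prj B \<cdot>\<^bsub>C\<^esub> pls B = prj B \<cdot>\<^bsub>C\<^esub> pj B 2 0 \<and> prj B \<cdot>\<^bsub>C\<^esub> pls B = prj B \<cdot>\<^bsub>C\<^esub> pj B 2 1 \<and>
     prj B \<cdot>\<^bsub>C\<^esub> zer B = Id C (bas B) \<and>
     fsum C B (fsum C B (pj B 3 0) (pj B 3 1)) (pj B 3 2) =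
       fsum C B (pj B 3 0) (fsum C B (pj B 3 1) (pj B 3 2)) \<and>
     fsum C B (pj B 2 1) (pj B 2 0) = pls B \<and>
     fsum C B (Id C (tot B)) (zer B \<cdot>\<^bsub>C\<^esub> prj B) = Id C (tot B)"

text \<open>The map \<open>f\<^sub>n\<close> induced by \<open>(f, g)\<close> on \<open>n\<close>-fold pullback powers; in particular \<open>f\<^sub>0 = g\<close>.\<close>

definition pow_map ::
  "('o, 'a, 'z) cat_scheme \<Rightarrow> ('o, 'a, 'y) add_bundle_scheme \<Rightarrow> ('o, 'a, 'x) add_bundle_scheme \<Rightarrow>
   'a \<Rightarrow> 'a \<Rightarrow> nat \<Rightarrow> 'a" where
  "pow_map C B B' f g n = ftuple C B' n (g \<cdot>\<^bsub>C\<^esub> st C B n) (\<lambda>j. f \<cdot>\<^bsub>C\<^esub> pj B n j)"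

definition bundle_morphism ::
  "('o, 'a, 'z) cat_scheme \<Rightarrow> ('o, 'a, 'y) add_bundle_scheme \<Rightarrow> ('o, 'a, 'x) add_bundle_scheme \<Rightarrow>
   'a \<Rightarrow> 'a \<Rightarrow> bool" where
  "bundle_morphism C B B' f g \<longleftrightarrow>
     f \<in> Hom C (tot B) (tot B') \<and> g \<in> Hom C (bas B) (bas B') \<and>
     prj B' \<cdot>\<^bsub>C\<^esub> f = g \<cdot>\<^bsub>C\<^esub> prj B"

definition additive_morphism ::
  "('o, 'a, 'z) cat_scheme \<Rightarrow> ('o, 'a, 'y) add_bundle_scheme \<Rightarrow> ('o, 'a, 'x) add_bundle_scheme \<Rightarrow>
   'a \<Rightarrow> 'a \<Rightarrow> bool" where
  "additive_morphism C B B' f g \<longleftrightarrow> bundle_morphism C B B' f g \<and>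
     f \<cdot>\<^bsub>C\<^esub> pls B = pls B' \<cdot>\<^bsub>C\<^esub> pow_map C B B' f g 2 \<and>
     f \<cdot>\<^bsub>C\<^esub> zer B = zer B' \<cdot>\<^bsub>C\<^esub> g"

text \<open>\<open>(T E, E, p, +, 0)\<close>, with pullback powers \<open>T\<^sub>n E\<close>, and \<open>(T E, T M, T q, T \<sigma>, T \<zeta>)\<close>.\<close>

definition tan_bundle :: "('o, 'a, 'z) actegory_scheme \<Rightarrow> 'o \<Rightarrow> ('o, 'a) add_bundle" where
  "tan_bundle X x = \<lparr>tot = tan_obj X x, bas = x, prj = tan_p X x,
     pw = (\<lambda>n. if n = 0 then x else act X (weil_pw n) x),
     pj = (\<lambda>n j. actT X (weil_proj n (Suc j)) x),
     pls = tan_plus X x, zer = tan_zero X x\<rparr>"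

definition tan_of_bundle ::
  "('o, 'a, 'z) actegory_scheme \<Rightarrow> ('o, 'a, 'y) add_bundle_scheme \<Rightarrow> ('o, 'a) add_bundle" where
  "tan_of_bundle X B = \<lparr>tot = tan_obj X (tot B), bas = tan_obj X (bas B), prj = tan_arr X (prj B),
     pw = (\<lambda>n. tan_obj X (pw B n)), pj = (\<lambda>n j. tan_arr X (pj B n j)),
     pls = tan_arr X (pls B), zer = tan_arr X (zer B)\<rparr>"

record ('o, 'a) diff_bundle = "('o, 'a) add_bundle" +
  lft :: 'a

definition differential_bundle ::
  "('o, 'a, 'z) actegory_scheme \<Rightarrow> ('o, 'a) diff_bundle \<Rightarrow> bool" where
  "differential_bundle X B \<longleftrightarrow>
     additive_bundle X B \<and>
     (\<forall>n k. fibre_power X ((tan_arr X ^^ k) (prj B)) n ((tan_obj X ^^ k) (pw B n))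
        ((tan_arr X ^^ k) (st X B n)) (\<lambda>j. (tan_arr X ^^ k) (pj B n j))) \<and>
     lft B \<in> Hom X (tot B) (tan_obj X (tot B)) \<and>
     additive_morphism X B (tan_of_bundle X B) (lft B) (tan_zero X (bas B)) \<and>
     additive_morphism X B (tan_bundle X (tot B)) (lft B) (zer B) \<and>
     tan_ell X (tot B) \<cdot>\<^bsub>X\<^esub> lft B = tan_arr X (lft B) \<cdot>\<^bsub>X\<^esub> lft B \<and>
     is_pullback X
       (tan_arr X (pls B) \<cdot>\<^bsub>X\<^esub> fpair X (tan_of_bundle X B)
          (lft B \<cdot>\<^bsub>X\<^esub> pj B 2 0) (tan_zero X (tot B) \<cdot>\<^bsub>X\<^esub> pj B 2 1))
       (prj B \<cdot>\<^bsub>X\<^esub> pj B 2 0)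
       (tan_arr X (prj B))
       (tan_zero X (bas B))"

definition linear_morphism ::
  "('o, 'a, 'z) actegory_scheme \<Rightarrow> ('o, 'a) diff_bundle \<Rightarrow> ('o, 'a) diff_bundle \<Rightarrow> 'a \<Rightarrow> 'a \<Rightarrow> bool" where
  "linear_morphism X B B' f g \<longleftrightarrow> bundle_morphism X B B' f g \<and>
     lft B' \<cdot>\<^bsub>X\<^esub> f = tan_arr X f \<cdot>\<^bsub>X\<^esub> lft B"

type_synonym ('o, 'a) dbun_arr = "('o, 'a) diff_bundle \<times> ('o, 'a) diff_bundle \<times> 'a \<times> 'a"

definition DBun ::
  "('o, 'a, 'z) actegory_scheme \<Rightarrow>
   (('o, 'a) diff_bundle \<Rightarrow> ('o, 'a) diff_bundle \<Rightarrow> 'a \<Rightarrow> 'a \<Rightarrow> bool) \<Rightarrow>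
   (('o, 'a) diff_bundle, ('o, 'a) dbun_arr) cat" where
  "DBun X mor = \<lparr>Obj = {B. differential_bundle X B},
     Arr = {(B, B', f, g). differential_bundle X B \<and> differential_bundle X B' \<and> mor B B' f g},
     Dom = (\<lambda>(B, B', f, g). B), Cod = (\<lambda>(B, B', f, g). B'),
     Id = (\<lambda>B. (B, B, Id X (tot B), Id X (bas B))),
     Cmp = (\<lambda>(B', B'', f', g') (B, _, f, g). (B, B'', f' \<cdot>\<^bsub>X\<^esub> f, g' \<cdot>\<^bsub>X\<^esub> g))\<rparr>"

definition DBun_add ::
  "('o, 'a, 'z) actegory_scheme \<Rightarrow> (('o, 'a) diff_bundle, ('o, 'a) dbun_arr) cat" where
  "DBun_add X = DBun X (additive_morphism X)"

definition DBun_lin ::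
  "('o, 'a, 'z) actegory_scheme \<Rightarrow> (('o, 'a) diff_bundle, ('o, 'a) dbun_arr) cat" where
  "DBun_lin X = DBun X (linear_morphism X)"


section \<open>Differential functors\<close>

record ('o, 'a, 'p, 'b) wfun =
  fo :: "'o \<Rightarrow> 'p"
  fm :: "'a \<Rightarrow> 'b"
  al :: "weil \<Rightarrow> 'o \<Rightarrow> 'b"

definition oplax_weil_linear ::
  "('o, 'a, 'z) actegory_scheme \<Rightarrow> ('p, 'b, 'y) actegory_scheme \<Rightarrow> ('o, 'a, 'p, 'b) wfun \<Rightarrow> bool" where
  "oplax_weil_linear X X' F \<longleftrightarrow>
     is_functor X X' (fo F) (fm F) \<and>
     natural_transformation (prod_cat Weil X) X'
       (\<lambda>(A, x). fo F (act X A x)) (\<lambda>(\<theta>, f). fm F (actm X \<theta> f))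
       (\<lambda>(A, x). act X' A (fo F x)) (\<lambda>(\<theta>, f). actm X' \<theta> (fm F f))
       (\<lambda>(A, x). al F A x) \<and>
     (\<forall>A\<in>Obj Weil. \<forall>B\<in>Obj Weil. \<forall>x\<in>Obj X.
        al F (weil_tensor A B) x \<cdot>\<^bsub>X'\<^esub> fm F (amult X A B x) =
        amult X' A B (fo F x) \<cdot>\<^bsub>X'\<^esub> (actA X' A (al F B x) \<cdot>\<^bsub>X'\<^esub> al F A (act X B x))) \<and>
     (\<forall>x\<in>Obj X. al F weil_N x \<cdot>\<^bsub>X'\<^esub> fm F (aunit X x) = aunit X' (fo F x))"

definition lax_differential_functor ::
  "('o, 'a, 'z) actegory_scheme \<Rightarrow> ('p, 'b, 'y) actegory_scheme \<Rightarrow> ('o, 'a, 'p, 'b) wfun \<Rightarrow> bool" where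
  "lax_differential_functor X X' F \<longleftrightarrow>
     oplax_weil_linear X X' F \<and>
     (\<forall>A\<in>Obj Weil.
        (\<forall>t l r b. is_pullback X t l r b \<and> is_terminal X (Cod X r) \<longrightarrow>
           is_pullback X' (actA X' A (fm F t)) (actA X' A (fm F l))
             (actA X' A (fm F r)) (actA X' A (fm F b))) \<and>
        (\<forall>f\<in>Arr X. is_pullback X' (fm F (actA X A f)) (al F A (Dom X f))
             (al F A (Cod X f)) (actA X' A (fm F f))))"

definition nat_trans ::
  "('o, 'a, 'z) actegory_scheme \<Rightarrow> ('p, 'b, 'y) actegory_scheme \<Rightarrow>
   ('o, 'a, 'p, 'b) wfun \<Rightarrow> ('o, 'a, 'p, 'b) wfun \<Rightarrow> ('o \<Rightarrow> 'b) \<Rightarrow> bool" where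
  "nat_trans X X' F G \<phi> \<longleftrightarrow> natural_transformation X X' (fo F) (fm F) (fo G) (fm G) \<phi>"

definition linear_nat_trans ::
  "('o, 'a, 'z) actegory_scheme \<Rightarrow> ('p, 'b, 'y) actegory_scheme \<Rightarrow>
   ('o, 'a, 'p, 'b) wfun \<Rightarrow> ('o, 'a, 'p, 'b) wfun \<Rightarrow> ('o \<Rightarrow> 'b) \<Rightarrow> bool" where
  "linear_nat_trans X X' F G \<phi> \<longleftrightarrow> nat_trans X X' F G \<phi> \<and>
     (\<forall>A\<in>Obj Weil. \<forall>x\<in>Obj X.
        al G A x \<cdot>\<^bsub>X'\<^esub> \<phi> (act X A x) = actA X' A (\<phi> x) \<cdot>\<^bsub>X'\<^esub> al F A x)"

type_synonym ('o, 'a, 'p, 'b) wfun_arr =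
  "('o, 'a, 'p, 'b) wfun \<times> ('o, 'a, 'p, 'b) wfun \<times> ('o \<Rightarrow> 'b)"

definition DiffFun_of ::
  "('o, 'a, 'z) actegory_scheme \<Rightarrow> ('p, 'b, 'y) actegory_scheme \<Rightarrow>
   (('o, 'a, 'p, 'b) wfun \<Rightarrow> ('o, 'a, 'p, 'b) wfun \<Rightarrow> ('o \<Rightarrow> 'b) \<Rightarrow> bool) \<Rightarrow>
   (('o, 'a, 'p, 'b) wfun, ('o, 'a, 'p, 'b) wfun_arr) cat" where
  "DiffFun_of X X' tr = \<lparr>Obj = {F. lax_differential_functor X X' F},
     Arr = {(F, G, \<phi>). lax_differential_functor X X' F \<and> lax_differential_functor X X' G \<and>
              tr F G \<phi> \<and> \<phi> \<in> extensional (Obj X)},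
     Dom = (\<lambda>(F, G, \<phi>). F), Cod = (\<lambda>(F, G, \<phi>). G),
     Id = (\<lambda>F. (F, F, \<lambda>x\<in>Obj X. Id X' (fo F x))),
     Cmp = (\<lambda>(G, H, \<psi>) (F, _, \<phi>). (F, H, \<lambda>x\<in>Obj X. \<psi> x \<cdot>\<^bsub>X'\<^esub> \<phi> x))\<rparr>"

definition DiffFun ::
  "('o, 'a, 'z) actegory_scheme \<Rightarrow> ('p, 'b, 'y) actegory_scheme \<Rightarrow>
   (('o, 'a, 'p, 'b) wfun, ('o, 'a, 'p, 'b) wfun_arr) cat" where
  "DiffFun X X' = DiffFun_of X X' (nat_trans X X')"

definition DiffFun_lin ::
  "('o, 'a, 'z) actegory_scheme \<Rightarrow> ('p, 'b, 'y) actegory_scheme \<Rightarrow>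
   (('o, 'a, 'p, 'b) wfun, ('o, 'a, 'p, 'b) wfun_arr) cat" where
  "DiffFun_lin X X' = DiffFun_of X X' (linear_nat_trans X X')"


section \<open>The tangent actegory of natural-number matrices\<close>

text \<open>To write \<open>A \<otimes> \<nat>\<^sup>k\<close> as \<open>\<nat>\<^bsup>dim A * k\<^esup>\<close> the basis monomials of \<open>A\<close> have to be enumerated.  The
  \<open>i\<close>-th digit of \<open>S\<close> is the element of \<open>S\<close> related to \<open>i\<close>, or 0 if there is none, and monomials
  are ordered lexicographically by their digits.  This gives \<open>1, x\<^sub>1, \<dots>, x\<^sub>n\<close> for \<open>W\<^sup>n\<close>, and the
  lexicographic product order for \<open>A \<otimes> B\<close>; hence the action on \<open>\<nat>\<^sup>\<bullet>\<close> is strict.  The basis vector of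
  \<open>A \<otimes> \<nat>\<^sup>k\<close> given by the \<open>a\<close>-th monomial and the \<open>j\<close>-th unit vector has index \<open>a * k + j\<close>.\<close>

definition weil_digits :: "weil \<Rightarrow> nat set \<Rightarrow> nat list" where
  "weil_digits A S = map (\<lambda>i. Max (insert 0 (S \<inter> snd A `` {i}))) [1..<Suc (fst A)]"

definition weil_rank :: "weil \<Rightarrow> nat set \<Rightarrow> nat" where
  "weil_rank A S =
     card {U \<in> weil_basis A. (weil_digits A U, weil_digits A S) \<in> lexord {(a, b). a < b}}"

definition weil_enum :: "weil \<Rightarrow> nat \<Rightarrow> nat set" where
  "weil_enum A i = (THE S. S \<in> weil_basis A \<and> weil_rank A S = i)"

definition Nmat_act :: "weil_arr \<Rightarrow> nat mat \<Rightarrow> nat mat" where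
  "Nmat_act \<theta> M = (case \<theta> of (A, B, h) \<Rightarrow>
     mat (weil_dim B * dim_row M) (weil_dim A * dim_col M)
       (\<lambda>(i, j). h (weil_mon (weil_enum A (j div dim_col M))) (weil_enum B (i div dim_row M)) *
                 M $$ (i mod dim_row M, j mod dim_col M)))"

definition Nmat :: "(nat, nat mat) actegory" where
  "Nmat = \<lparr>Obj = UNIV, Arr = UNIV, Dom = dim_col, Cod = dim_row, Id = 1\<^sub>m, Cmp = (*),
     act = (\<lambda>A k. weil_dim A * k), actm = Nmat_act,
     aunit = 1\<^sub>m, amult = (\<lambda>A B k. 1\<^sub>m (weil_dim A * (weil_dim B * k)))\<rparr>"


section \<open>The functor Ind\<close>

primrec fmultiple ::
  "('o, 'a, 'z) cat_scheme \<Rightarrow> ('o, 'a, 'y) add_bundle_scheme \<Rightarrow> 'a \<Rightarrow> nat \<Rightarrow> 'a \<Rightarrow> 'a" where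
  "fmultiple C B s 0 f = zer B \<cdot>\<^bsub>C\<^esub> s"
| "fmultiple C B s (Suc n) f = fsum C B (fmultiple C B s n f) f"

text \<open>\<open>\<Sum>j<m. a j \<cdot> f j\<close> in the monoid of maps over \<open>s : Z \<rightarrow> bas B\<close>.\<close>

primrec flincomb ::
  "('o, 'a, 'z) cat_scheme \<Rightarrow> ('o, 'a, 'y) add_bundle_scheme \<Rightarrow> 'a \<Rightarrow>
   (nat \<Rightarrow> nat) \<Rightarrow> (nat \<Rightarrow> 'a) \<Rightarrow> nat \<Rightarrow> 'a" where
  "flincomb C B s a f 0 = zer B \<cdot>\<^bsub>C\<^esub> s"
| "flincomb C B s a f (Suc m) = fsum C B (flincomb C B s a f m) (fmultiple C B s (a m) (f m))"

definition Ind_fm ::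
  "('o, 'a, 'z) cat_scheme \<Rightarrow> ('o, 'a, 'y) add_bundle_scheme \<Rightarrow> nat mat \<Rightarrow> 'a" where
  "Ind_fm C B M = (let m = dim_col M; s = st C B m in
     ftuple C B (dim_row M) s (\<lambda>i. flincomb C B s (\<lambda>j. M $$ (i, j)) (pj B m) m))"

text \<open>The component at \<open>W\<close> and \<open>\<nat>\<^sup>1\<close>.\<close>

definition Ind_al_W :: "('o, 'a, 'z) actegory_scheme \<Rightarrow> ('o, 'a) diff_bundle \<Rightarrow> 'a" where
  "Ind_al_W X B = tan_arr X (pls B) \<cdot>\<^bsub>X\<^esub> fpair X (tan_of_bundle X B)
     (tan_zero X (tot B) \<cdot>\<^bsub>X\<^esub> pj B 2 0) (lft B \<cdot>\<^bsub>X\<^esub> pj B 2 1)"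

text \<open>The components at \<open>W\<^sup>k\<close> and \<open>\<nat>\<^sup>0\<close>, \<open>\<nat>\<^sup>1\<close>, \<open>\<nat>\<^sup>l\<close>.  For \<open>\<nat>\<^sup>1\<close>, the \<open>k\<close>-fold fibre power over \<open>E\<close> of
  \<open>\<pi>\<^sub>0 : E\<^sub>2 \<rightarrow> E\<close> is \<open>E\<^sub>k\<^sub>+\<^sub>1\<close> with projections \<open>\<langle>\<pi>\<^sub>0, \<pi>\<^sub>i\<rangle>\<close>, and that of \<open>p : T E \<rightarrow> E\<close> is \<open>T\<^sub>k E\<close>.\<close>

definition Ind_al_pw0 :: "('o, 'a, 'z) actegory_scheme \<Rightarrow> ('o, 'a) diff_bundle \<Rightarrow> nat \<Rightarrow> 'a" where
  "Ind_al_pw0 X B k = actT X (weil_unit (weil_pw k)) (bas B) \<cdot>\<^bsub>X\<^esub> aunit X (bas B)"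

definition Ind_al_pw1 :: "('o, 'a, 'z) actegory_scheme \<Rightarrow> ('o, 'a) diff_bundle \<Rightarrow> nat \<Rightarrow> 'a" where
  "Ind_al_pw1 X B k = (THE h. h \<in> Hom X (pw B (Suc k)) (act X (weil_pw k) (tot B)) \<and>
     actT X (weil_aug (weil_pw k)) (tot B) \<cdot>\<^bsub>X\<^esub> h = aunit X (tot B) \<cdot>\<^bsub>X\<^esub> pj B (Suc k) 0 \<and>
     (\<forall>i\<in>{1..k}. actT X (weil_proj k i) (tot B) \<cdot>\<^bsub>X\<^esub> h =
        Ind_al_W X B \<cdot>\<^bsub>X\<^esub> fpair X B (pj B (Suc k) 0) (pj B (Suc k) i)))"

definition Ind_al_pw ::
  "('o, 'a, 'z) actegory_scheme \<Rightarrow> ('o, 'a) diff_bundle \<Rightarrow> nat \<Rightarrow> nat \<Rightarrow> 'a" where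
  "Ind_al_pw X B k l =
     (THE h. h \<in> Hom X (pw B (act Nmat (weil_pw k) l)) (act X (weil_pw k) (pw B l)) \<and>
       actA X (weil_pw k) (st X B l) \<cdot>\<^bsub>X\<^esub> h =
         Ind_al_pw0 X B k \<cdot>\<^bsub>X\<^esub> Ind_fm X B (actA Nmat (weil_pw k) (0\<^sub>m 0 l)) \<and>
       (\<forall>j<l. actA X (weil_pw k) (pj B l j) \<cdot>\<^bsub>X\<^esub> h =
         Ind_al_pw1 X B k \<cdot>\<^bsub>X\<^esub>
         Ind_fm X B (actA Nmat (weil_pw k) (mat 1 l (\<lambda>(_, i). if i = j then 1 else 0)))))"

text \<open>The component at \<open>W\<^bsup>k\<^sub>1\<^esup> \<otimes> \<dots> \<otimes> W\<^bsup>k\<^sub>r\<^esup>\<close>.\<close>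

primrec Ind_al_tensors ::
  "('o, 'a, 'z) actegory_scheme \<Rightarrow> ('o, 'a) diff_bundle \<Rightarrow> nat list \<Rightarrow> nat \<Rightarrow> 'a" where
  "Ind_al_tensors X B [] l = aunit X (pw B l)"
| "Ind_al_tensors X B (k # ks) l =
     amult X (weil_pw k) (weil_tensors ks) (pw B l) \<cdot>\<^bsub>X\<^esub>
     (actA X (weil_pw k) (Ind_al_tensors X B ks l) \<cdot>\<^bsub>X\<^esub>
      Ind_al_pw X B k (act Nmat (weil_tensors ks) l))"

text \<open>A general object \<open>A\<close> equals \<open>W\<^bsup>k\<^sub>1\<^esup> \<otimes> \<dots> \<otimes> W\<^bsup>k\<^sub>r\<^esup>\<close>, where the \<open>k\<^sub>i\<close> are the sizes of the classes
  of the relation, up to renaming variables so that classes become intervals; naturality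
  determines the component at \<open>A\<close>.  Classes are ordered by their least elements, so nothing is
  renamed if \<open>A\<close> already is of this form.  The \<open>i\<close>-th variable of the tensor product is variable
  \<open>weil_vars A ! (i - 1)\<close> of \<open>A\<close>.\<close>

definition weil_blocks :: "weil \<Rightarrow> nat list list" where
  "weil_blocks A = map (\<lambda>i. sorted_list_of_set (snd A `` {i}))
     (filter (\<lambda>i. \<forall>j. (i, j) \<in> snd A \<longrightarrow> i \<le> j) [1..<Suc (fst A)])"

definition weil_vars :: "weil \<Rightarrow> nat list" where
  "weil_vars A = concat (weil_blocks A)"

definition weil_sizes :: "weil \<Rightarrow> nat list" where
  "weil_sizes A = map length (weil_blocks A)"

definition weil_to_tensors :: "weil \<Rightarrow> weil_arr" where
  "weil_to_tensors A = weil_lin A (weil_tensors (weil_sizes A))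
     (\<lambda>U. weil_mon {i \<in> {1..fst A}. weil_vars A ! (i - 1) \<in> U})"

definition weil_from_tensors :: "weil \<Rightarrow> weil_arr" where
  "weil_from_tensors A = weil_lin (weil_tensors (weil_sizes A)) A
     (\<lambda>U. weil_mon ((\<lambda>i. weil_vars A ! (i - 1)) ` U))"

definition Ind_al ::
  "('o, 'a, 'z) actegory_scheme \<Rightarrow> ('o, 'a) diff_bundle \<Rightarrow> weil \<Rightarrow> nat \<Rightarrow> 'a" where
  "Ind_al X B A l =
     actT X (weil_from_tensors A) (pw B l) \<cdot>\<^bsub>X\<^esub>
     (Ind_al_tensors X B (weil_sizes A) l \<cdot>\<^bsub>X\<^esub> Ind_fm X B (actT Nmat (weil_to_tensors A) l))"

definition Ind ::
  "('o, 'a, 'z) actegory_scheme \<Rightarrow> ('o, 'a) diff_bundle \<Rightarrow> (nat, nat mat, 'o, 'a) wfun" where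
  "Ind X B = \<lparr>fo = pw B, fm = Ind_fm X B, al = Ind_al X B\<rparr>"

definition Ind_arr ::
  "('o, 'a, 'z) actegory_scheme \<Rightarrow> ('o, 'a) dbun_arr \<Rightarrow> (nat, nat mat, 'o, 'a) wfun_arr" where
  "Ind_arr X = (\<lambda>(B, B', f, g). (Ind X B, Ind X B', pow_map X B B' f g))"

end

theory Submission imports Defs begin

text \<open>
  The arrows into the total space of an additive bundle that lie over a fixed \<open>s : Z \<rightarrow> M\<close> form a
  commutative monoid under fibrewise addition, and precomposition is a homomorphism of these
  monoids.  Hence linear combinations of linear combinations multiply like matrices
  (\<open>flincomb_flincomb\<close>), and \<open>\<nat>\<^sup>k \<mapsto> E\<^sub>k\<close> is a functor.  Postcomposition with an additive morphism is
  a homomorphism too, so the powers \<open>f\<^sub>n : E\<^sub>n \<rightarrow> E'\<^sub>n\<close> commute with the action of every matrix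
  (\<open>pow_map_natural\<close>).  This is the natural transformation of part (a).

  For part (b), the comparison maps are built by universal properties from
  \<open>\<alpha>\<^sub>W = 0\<pi>\<^sub>0 + \<lambda>\<pi>\<^sub>1\<close>, the sum being taken in the bundle \<open>T E \<rightarrow> T M\<close>.  All its
  ingredients commute with a linear \<open>f\<close>: the zero map is natural, \<open>\<lambda>\<close> is respected by linearity,
  and \<open>T f\<close> preserves the sum because \<open>f\<close> is additive.  Naturality then propagates to
  \<open>W\<^sup>k\<close>, to tensor products and to arbitrary Weil algebras, each time by comparing projections;
  matrices that occur on the way are moved past \<open>f\<^sub>n\<close> by part (a).

  Three facts make this work.  The universal properties have to hold: \<open>W\<^bsup>k+1\<^esup>\<close> is the
  product \<open>W\<^sup>k \<times> W\<close> of Weil algebras (\<open>is_product_pw\<close>), so the tangent actegory axioms make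
  \<open>T\<^bsub>W\<^sup>k\<^esub> x\<close> a pullback power of \<open>p : T x \<rightarrow> x\<close> (\<open>fibre_power_T\<close>), and therefore \<open>T\<^bsub>W\<^sup>k\<^esub>\<close>
  preserves the pullback powers of \<open>q\<close> since \<open>T\<close> does (\<open>actA_fibre_power\<close>).  A linear morphism
  has to be additive: the lift is monic because the universality square is a pullback
  (\<open>lft_monic\<close>), and it turns the fibrewise sum into the natural sum of tangent vectors.
  Finally, a Weil algebra is a tensor product of algebras \<open>W\<^sup>k\<close> after a renaming of its variables,
  which is a morphism of Weil algebras (\<open>weil_from_tensors_Arr\<close>), so that the action on it is
  natural.

  Part (c) holds because a map into a pullback power is determined by its projections:
  \<open>(f, g) \<mapsto> f\<^sub>n\<close> then respects identities and composition.
\<close>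

section \<open>Categories and pullback powers\<close>

lemma Hom_iff [simp]: "f \<in> Hom C x y \<longleftrightarrow> f \<in> Arr C \<and> Dom C f = x \<and> Cod C f = y"
  by (auto simp: Hom_def)

locale cat_loc =
  fixes C :: "('o, 'a, 'z) cat_scheme" (structure)
  assumes category: "category C"
begin

lemma Dom_Obj [simp]: "f \<in> Arr C \<Longrightarrow> Dom C f \<in> Obj C"
  and Cod_Obj [simp]: "f \<in> Arr C \<Longrightarrow> Cod C f \<in> Obj C"
  using category by (auto simp: category_def)

lemma Id_Arr [simp]: "x \<in> Obj C \<Longrightarrow> Id C x \<in> Arr C"
  and Dom_Id [simp]: "x \<in> Obj C \<Longrightarrow> Dom C (Id C x) = x"
  and Cod_Id [simp]: "x \<in> Obj C \<Longrightarrow> Cod C (Id C x) = x"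
  using category by (auto simp: category_def)

lemma Cmp_Arr [simp]: "f \<in> Arr C \<Longrightarrow> g \<in> Arr C \<Longrightarrow> Dom C g = Cod C f \<Longrightarrow> g \<cdot> f \<in> Arr C"
  and Dom_Cmp [simp]: "f \<in> Arr C \<Longrightarrow> g \<in> Arr C \<Longrightarrow> Dom C g = Cod C f \<Longrightarrow> Dom C (g \<cdot> f) = Dom C f"
  and Cod_Cmp [simp]: "f \<in> Arr C \<Longrightarrow> g \<in> Arr C \<Longrightarrow> Dom C g = Cod C f \<Longrightarrow> Cod C (g \<cdot> f) = Cod C g"
  using category by (auto simp: category_def)

lemma Cmp_Id_right [simp]: "f \<in> Arr C \<Longrightarrow> Dom C f = x \<Longrightarrow> f \<cdot> Id C x = f"
  and Cmp_Id_left [simp]: "f \<in> Arr C \<Longrightarrow> Cod C f = x \<Longrightarrow> Id C x \<cdot> f = f"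
  using category by (auto simp: category_def)

lemma Cmp_assoc [simp]:
  "f \<in> Arr C \<Longrightarrow> g \<in> Arr C \<Longrightarrow> h \<in> Arr C \<Longrightarrow> Dom C g = Cod C f \<Longrightarrow> Dom C h = Cod C g \<Longrightarrow>
    (h \<cdot> g) \<cdot> f = h \<cdot> (g \<cdot> f)"
  using category by (auto simp: category_def)

text \<open>Composites are normalised by associating to the right.  An equation \<open>b \<cdot> a = d\<close> then no longer
  matches inside a longer composite; this is the form in which it still does.\<close>

lemma Cmp_reassoc:
  "b \<cdot> a = d \<Longrightarrow> a \<in> Arr C \<Longrightarrow> b \<in> Arr C \<Longrightarrow> Dom C b = Cod C a \<Longrightarrow>
    f \<in> Arr C \<Longrightarrow> Cod C f = Dom C a \<Longrightarrow> b \<cdot> (a \<cdot> f) = d \<cdot> f"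
  using Cmp_assoc[of f a b] by simp

lemma is_inverse_inv_arr: "is_iso C f \<Longrightarrow> is_inverse C f (inv_arr C f)"
  unfolding inv_arr_def is_iso_def
proof (elim conjE exE, rule theI')
  fix g assume f: "f \<in> Arr C" and g: "is_inverse C f g"
  show "\<exists>!g. is_inverse C f g"
  proof (rule ex1I[of "is_inverse C f", OF g])
    fix h assume h: "is_inverse C f h"
    have "h = h \<cdot> (f \<cdot> g)" using h g f by (auto simp: is_inverse_def)
    also have "\<dots> = (h \<cdot> f) \<cdot> g" using h g f Cmp_assoc[of g f h] by (simp add: is_inverse_def)
    also have "\<dots> = g" using h g f by (auto simp: is_inverse_def)
    finally show "h = g" .
  qed
qed

lemma inv_arr:
  assumes "is_iso C f"
  shows inv_arr_Arr: "inv_arr C f \<in> Arr C" and Dom_inv_arr: "Dom C (inv_arr C f) = Cod C f"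
    and Cod_inv_arr: "Cod C (inv_arr C f) = Dom C f"
    and inv_arr_left: "inv_arr C f \<cdot> f = Id C (Dom C f)"
    and inv_arr_right: "f \<cdot> inv_arr C f = Id C (Cod C f)"
  using is_inverse_inv_arr[OF assms] by (auto simp: is_inverse_def)

lemma fibre_power_lift:
  assumes "fibre_power C q n P s \<pi>" and "g \<in> Arr C" "Cod C g = Cod C q"
    and "\<And>j. j < n \<Longrightarrow> f j \<in> Hom C (Dom C g) (Dom C q)" "\<And>j. j < n \<Longrightarrow> q \<cdot> f j = g"
  shows "\<exists>h. h \<in> Hom C (Dom C g) P \<and> s \<cdot> h = g \<and> (\<forall>j<n. \<pi> j \<cdot> h = f j)"
proof -
  have "\<exists>!h. h \<in> Hom C (Dom C g) P \<and> s \<cdot> h = g \<and> (\<forall>j<n. \<pi> j \<cdot> h = f j)"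
    using assms unfolding fibre_power_def by blast
  then show ?thesis by blast
qed

lemma fibre_power_eqI:
  assumes fp: "fibre_power C q n P s \<pi>" and h: "h \<in> Hom C Z P" and k: "k \<in> Hom C Z P"
    and s: "s \<cdot> h = s \<cdot> k" and \<pi>: "\<And>j. j < n \<Longrightarrow> \<pi> j \<cdot> h = \<pi> j \<cdot> k"
  shows "h = k"
proof -
  have q: "q \<in> Arr C" "s \<in> Hom C P (Cod C q)"
    "\<And>j. j < n \<Longrightarrow> \<pi> j \<in> Hom C P (Dom C q) \<and> q \<cdot> \<pi> j = s"
    using fp by (auto simp: fibre_power_def)
  have u: "\<And>g f. g \<in> Arr C \<Longrightarrow> Cod C g = Cod C q \<Longrightarrow>
        (\<forall>j<n. f j \<in> Hom C (Dom C g) (Dom C q) \<and> q \<cdot> f j = g) \<Longrightarrow>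
        \<exists>!h. h \<in> Hom C (Dom C g) P \<and> s \<cdot> h = g \<and> (\<forall>j<n. \<pi> j \<cdot> h = f j)"
    using fp unfolding fibre_power_def by blast
  have c: "\<forall>j<n. \<pi> j \<cdot> h \<in> Hom C (Dom C (s \<cdot> h)) (Dom C q) \<and> q \<cdot> (\<pi> j \<cdot> h) = s \<cdot> h"
  proof (intro allI impI)
    fix j assume "j < n"
    then show "\<pi> j \<cdot> h \<in> Hom C (Dom C (s \<cdot> h)) (Dom C q) \<and> q \<cdot> (\<pi> j \<cdot> h) = s \<cdot> h"
      using q(1,2) q(3)[of j] h Cmp_reassoc[of q "\<pi> j" s h] by simp
  qed
  have "\<exists>!k. k \<in> Hom C (Dom C (s \<cdot> h)) P \<and> s \<cdot> k = s \<cdot> h \<and> (\<forall>j<n. \<pi> j \<cdot> k = \<pi> j \<cdot> h)"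
    by (rule u[OF _ _ c]) (use q h in auto)
  then obtain m where m: "\<And>k. k \<in> Hom C (Dom C (s \<cdot> h)) P \<and> s \<cdot> k = s \<cdot> h \<and> (\<forall>j<n. \<pi> j \<cdot> k = \<pi> j \<cdot> h) \<Longrightarrow> k = m"
    by blast
  have "h = m" by (rule m) (use q h in auto)
  moreover have "k = m" by (rule m) (use q h k s \<pi> in auto)
  ultimately show ?thesis by simp
qed

lemma fibre_powerI:
  assumes "q \<in> Arr C" "s \<in> Hom C P (Cod C q)"
    and "\<And>j. j < n \<Longrightarrow> \<pi> j \<in> Hom C P (Dom C q)" "\<And>j. j < n \<Longrightarrow> q \<cdot> \<pi> j = s"
    and ex: "\<And>g f. g \<in> Arr C \<Longrightarrow> Cod C g = Cod C q \<Longrightarrow>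
        (\<And>j. j < n \<Longrightarrow> f j \<in> Hom C (Dom C g) (Dom C q)) \<Longrightarrow> (\<And>j. j < n \<Longrightarrow> q \<cdot> f j = g) \<Longrightarrow>
        \<exists>h. h \<in> Hom C (Dom C g) P \<and> s \<cdot> h = g \<and> (\<forall>j<n. \<pi> j \<cdot> h = f j)"
    and eq: "\<And>Z h k. h \<in> Hom C Z P \<Longrightarrow> k \<in> Hom C Z P \<Longrightarrow> s \<cdot> h = s \<cdot> k \<Longrightarrow>
        (\<And>j. j < n \<Longrightarrow> \<pi> j \<cdot> h = \<pi> j \<cdot> k) \<Longrightarrow> h = k"
  shows "fibre_power C q n P s \<pi>"
  unfolding fibre_power_def
proof (intro conjI ballI allI impI)
  fix g f assume g: "g \<in> Arr C" "Cod C g = Cod C q"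
    and f: "\<forall>j<n. f j \<in> Hom C (Dom C g) (Dom C q) \<and> q \<cdot> f j = g"
  obtain h where h: "h \<in> Hom C (Dom C g) P \<and> s \<cdot> h = g \<and> (\<forall>j<n. \<pi> j \<cdot> h = f j)"
    using ex[OF g] f by blast
  show "\<exists>!h. h \<in> Hom C (Dom C g) P \<and> s \<cdot> h = g \<and> (\<forall>j<n. \<pi> j \<cdot> h = f j)"
  proof (rule ex1I[of _ h], rule h)
    fix k assume "k \<in> Hom C (Dom C g) P \<and> s \<cdot> k = g \<and> (\<forall>j<n. \<pi> j \<cdot> k = f j)"
    then show "k = h" using h by (intro eq[of k _ h]) auto
  qed
qed (use assms in auto)

lemma pullback_ex1:
  assumes "is_pullback C t l r b" "f \<in> Arr C" "g \<in> Arr C" "Dom C f = Dom C g" "Cod C f = Dom C r"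
    "Cod C g = Dom C b" "r \<cdot> f = b \<cdot> g"
  shows "\<exists>!h. h \<in> Hom C (Dom C f) (Dom C t) \<and> t \<cdot> h = f \<and> l \<cdot> h = g"
  using assms unfolding is_pullback_def by blast

lemma pullback_ex:
  assumes "is_pullback C t l r b" "f \<in> Hom C Z (Dom C r)" "g \<in> Hom C Z (Dom C b)" "r \<cdot> f = b \<cdot> g"
  shows "\<exists>h. h \<in> Hom C Z (Dom C t) \<and> t \<cdot> h = f \<and> l \<cdot> h = g"
proof -
  have "\<exists>!h. h \<in> Hom C (Dom C f) (Dom C t) \<and> t \<cdot> h = f \<and> l \<cdot> h = g"
    by (rule pullback_ex1[OF assms(1)]) (use assms in simp_all)
  then show ?thesis using assms(2) by auto
qed

lemma pullback_eqI:
  assumes pb: "is_pullback C t l r b" and h: "h \<in> Hom C Z (Dom C t)" and k: "k \<in> Hom C Z (Dom C t)"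
    and t: "t \<cdot> h = t \<cdot> k" and l: "l \<cdot> h = l \<cdot> k"
  shows "h = k"
proof -
  have a: "t \<in> Arr C" "l \<in> Arr C" "r \<in> Arr C" "b \<in> Arr C" "Dom C l = Dom C t" "Cod C t = Dom C r"
     "Cod C l = Dom C b" "r \<cdot> t = b \<cdot> l"
    using pb by (auto simp: is_pullback_def)
  have "r \<cdot> (t \<cdot> h) = b \<cdot> (l \<cdot> h)"
    using a h by (subst Cmp_reassoc[OF a(8)]) auto
  then have "\<exists>!m. m \<in> Hom C (Dom C (t \<cdot> h)) (Dom C t) \<and> t \<cdot> m = t \<cdot> h \<and> l \<cdot> m = l \<cdot> h"
    using a h by (intro pullback_ex1[OF pb]) simp_all
  then show ?thesis using a h k t l by auto
qed

end


section \<open>Bundles with pullback powers\<close>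

text \<open>Tuples come from pullback powers alone.  Keeping these apart from the addition makes them available
  for the tangent bundle and for \<open>T E \<rightarrow> T M\<close> before any monoid law has been established there.\<close>

locale power_bundle = cat_loc C for C :: "('o, 'a, 'z) cat_scheme" (structure) +
  fixes B :: "('o, 'a, 'y) add_bundle_scheme"
  assumes prj_Hom: "prj B \<in> Hom C (tot B) (bas B)"
    and fibre_power: "fibre_power C (prj B) n (pw B n) (st C B n) (pj B n)"
begin

lemmas prj [simp] = prj_Hom [unfolded Hom_iff]

lemma bas_Obj [simp]: "bas B \<in> Obj C" and tot_Obj [simp]: "tot B \<in> Obj C"
  using Cod_Obj[of "prj B"] Dom_Obj[of "prj B"] by simp_all

lemma st [unfolded Hom_iff, simp]: "st C B n \<in> Hom C (pw B n) (bas B)"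
  and pj [unfolded Hom_iff, simp]: "j < n \<Longrightarrow> pj B n j \<in> Hom C (pw B n) (tot B)"
  and prj_pj [simp]: "j < n \<Longrightarrow> prj B \<cdot> pj B n j = st C B n"
  using fibre_power[of n] by (auto simp: fibre_power_def)

lemma pw_Obj [simp]: "pw B n \<in> Obj C"
  using Dom_Obj[of "st C B n"] by simp

lemma st_0 [simp]: "st C B 0 = Id C (bas B)"
  by (simp add: st_def)

lemmas prj_pj_reassoc [simp] = Cmp_reassoc[OF prj_pj]

text \<open>The elements of the monoid attached to \<open>s : Z \<rightarrow> bas B\<close>.\<close>

definition over :: "'a \<Rightarrow> 'a \<Rightarrow> bool" where
  "over s f \<longleftrightarrow> s \<in> Arr C \<and> Cod C s = bas B \<and>
     f \<in> Arr C \<and> Dom C f = Dom C s \<and> Cod C f = tot B \<and> prj B \<cdot> f = s"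

lemma overD:
  assumes "over s f"
  shows "s \<in> Arr C" "Cod C s = bas B" "f \<in> Arr C" "Dom C f = Dom C s" "Cod C f = tot B"
    "prj B \<cdot> f = s"
  using assms by (auto simp: over_def)

lemma over_Cmp:
  assumes "over s f" "h \<in> Arr C" "Cod C h = Dom C s"
  shows "over (s \<cdot> h) (f \<cdot> h)"
proof -
  note [simp] = overD[OF assms(1)]
  show ?thesis
    using assms Cmp_reassoc[of "prj B" f s h] by (simp add: over_def)
qed

lemma over_pj [simp]: "j < n \<Longrightarrow> over (st C B n) (pj B n j)"
  by (simp add: over_def)

lemma ftuple:
  assumes "s \<in> Arr C" "Cod C s = bas B" "\<And>j. j < n \<Longrightarrow> over s (f j)"
  shows ftuple_Arr [simp]: "ftuple C B n s f \<in> Arr C"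
    and Dom_ftuple [simp]: "Dom C (ftuple C B n s f) = Dom C s"
    and Cod_ftuple [simp]: "Cod C (ftuple C B n s f) = pw B n"
    and st_ftuple [simp]: "st C B n \<cdot> ftuple C B n s f = s"
    and pj_ftuple [simp]: "j < n \<Longrightarrow> pj B n j \<cdot> ftuple C B n s f = f j"
proof -
  let ?P = "\<lambda>h. h \<in> Hom C (Dom C s) (pw B n) \<and> st C B n \<cdot> h = s \<and> (\<forall>j<n. pj B n j \<cdot> h = f j)"
  have "\<exists>h. ?P h"
    by (rule fibre_power_lift[OF fibre_power]) (use assms in \<open>auto simp: over_def\<close>)
  then obtain h where h: "?P h" by blast
  have "?P (ftuple C B n s f)"
    unfolding ftuple_def
  proof (rule theI[of ?P, OF h])
    fix k assume "?P k"
    then show "k = h" using h by (intro fibre_power_eqI[OF fibre_power, of k _ n h]) auto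
  qed
  then show "ftuple C B n s f \<in> Arr C" "Dom C (ftuple C B n s f) = Dom C s"
    "Cod C (ftuple C B n s f) = pw B n" "st C B n \<cdot> ftuple C B n s f = s"
    "j < n \<Longrightarrow> pj B n j \<cdot> ftuple C B n s f = f j" by auto
qed

lemma pw_eqI:
  assumes "h \<in> Hom C Z (pw B n)" "k \<in> Hom C Z (pw B n)" "st C B n \<cdot> h = st C B n \<cdot> k"
    "\<And>j. j < n \<Longrightarrow> pj B n j \<cdot> h = pj B n j \<cdot> k"
  shows "h = k"
  using fibre_power_eqI[OF fibre_power assms] .

lemma pw_eqI_pos:
  assumes "h \<in> Hom C Z (pw B n)" "k \<in> Hom C Z (pw B n)" "0 < n"
    "\<And>j. j < n \<Longrightarrow> pj B n j \<cdot> h = pj B n j \<cdot> k"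
  shows "h = k"
proof (rule pw_eqI[OF assms(1,2)])
  have "prj B \<cdot> (pj B n 0 \<cdot> h) = st C B n \<cdot> h" "prj B \<cdot> (pj B n 0 \<cdot> k) = st C B n \<cdot> k"
    using assms(1-3) by simp_all
  then show "st C B n \<cdot> h = st C B n \<cdot> k"
    using assms(3,4) by metis
qed (use assms in auto)

lemma fpair:
  assumes "over s f" "over s g"
  shows fpair_Arr: "fpair C B f g \<in> Arr C"
    and Dom_fpair: "Dom C (fpair C B f g) = Dom C s"
    and Cod_fpair: "Cod C (fpair C B f g) = pw B 2"
    and st_fpair: "st C B 2 \<cdot> fpair C B f g = s"
    and pj0_fpair: "pj B 2 0 \<cdot> fpair C B f g = f"
    and pj1_fpair: "pj B 2 1 \<cdot> fpair C B f g = g"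
proof -
  have s: "prj B \<cdot> f = s" "s \<in> Arr C" "Cod C s = bas B"
    using assms by (auto simp: over_def)
  note f = ftuple[OF s(2,3), of 2 "\<lambda>j. if j = 0 then f else g"]
  show "fpair C B f g \<in> Arr C" "Dom C (fpair C B f g) = Dom C s" "Cod C (fpair C B f g) = pw B 2"
   "st C B 2 \<cdot> fpair C B f g = s" "pj B 2 0 \<cdot> fpair C B f g = f" "pj B 2 1 \<cdot> fpair C B f g = g"
    unfolding fpair_def s(1) using f(1-4) f(5)[of 0] f(5)[of 1] assms by simp_all
qed

lemma fpair_eqI:
  assumes "over s f" "over s g" "h \<in> Hom C (Dom C s) (pw B 2)"
    "pj B 2 0 \<cdot> h = f" "pj B 2 1 \<cdot> h = g"
  shows "fpair C B f g = h"
proof (rule pw_eqI_pos[of _ "Dom C s" 2])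
  fix j :: nat assume "j < 2"
  then have "j = 0 \<or> j = 1" by auto
  then show "pj B 2 j \<cdot> fpair C B f g = pj B 2 j \<cdot> h"
    using fpair[OF assms(1,2)] assms by auto
qed (use fpair[OF assms(1,2)] assms in auto)

lemma fpair_Cmp:
  assumes "over s f" "over s g" "h \<in> Arr C" "Cod C h = Dom C s"
  shows "fpair C B f g \<cdot> h = fpair C B (f \<cdot> h) (g \<cdot> h)"
proof -
  note p = fpair[OF assms(1,2)] overD[OF assms(1)]
  have "pj B 2 0 \<cdot> (fpair C B f g \<cdot> h) = f \<cdot> h" "pj B 2 1 \<cdot> (fpair C B f g \<cdot> h) = g \<cdot> h"
    by (rule Cmp_reassoc[OF p(5)] Cmp_reassoc[OF p(6)]; use p assms in simp)+
  then show ?thesis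
    using p assms by (intro fpair_eqI[symmetric, OF over_Cmp over_Cmp]) auto
qed

end


section \<open>Additive bundles\<close>

locale abundle = power_bundle +
  assumes additive_bundle: "additive_bundle C B"
begin

lemma pls [unfolded Hom_iff, simp]: "pls B \<in> Hom C (pw B 2) (tot B)"
  and zer [unfolded Hom_iff, simp]: "zer B \<in> Hom C (bas B) (tot B)"
  and pw_0 [simp]: "pw B 0 = bas B" and pw_1 [simp]: "pw B (Suc 0) = tot B"
  and pj_1_0 [simp]: "pj B (Suc 0) 0 = Id C (tot B)"
  and prj_zer [simp]: "prj B \<cdot> zer B = Id C (bas B)"
  and prj_pls': "prj B \<cdot> pls B = prj B \<cdot> pj B 2 0"
  and pls_assoc: "fsum C B (fsum C B (pj B 3 0) (pj B 3 1)) (pj B 3 2) =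
       fsum C B (pj B 3 0) (fsum C B (pj B 3 1) (pj B 3 2))"
  and pls_comm: "fsum C B (pj B 2 1) (pj B 2 0) = pls B"
  and pls_unit: "fsum C B (Id C (tot B)) (zer B \<cdot> prj B) = Id C (tot B)"
  using additive_bundle unfolding additive_bundle_def One_nat_def by blast+

lemma prj_pls [simp]: "prj B \<cdot> pls B = st C B 2"
  by (simp add: prj_pls')

lemmas prj_reassoc [simp] = Cmp_reassoc[OF prj_pls] Cmp_reassoc[OF prj_zer]

lemma over_fsum [simp]: assumes "over s f" "over s g" shows "over s (fsum C B f g)"
  using assms fpair[OF assms] unfolding fsum_def
  by (auto simp: over_def)

lemma fsum_Cmp:
  assumes "over s f" "over s g" "h \<in> Arr C" "Cod C h = Dom C s"
  shows "fsum C B f g \<cdot> h = fsum C B (f \<cdot> h) (g \<cdot> h)"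
  unfolding fsum_def fpair_Cmp[OF assms, symmetric]
  using assms fpair[OF assms(1,2)] by simp

lemma over_zer [simp]: "s \<in> Arr C \<Longrightarrow> Cod C s = bas B \<Longrightarrow> over s (zer B \<cdot> s)"
  by (simp add: over_def)

text \<open>The monoid laws are given for the projections of \<open>E\<^sub>3\<close>, \<open>E\<^sub>2\<close> and \<open>E\<close>, the universal cases; they
  reach arbitrary summands by precomposition with the corresponding tuple.\<close>

lemma fsum_assoc:
  assumes "over s f" "over s g" "over s h"
  shows "fsum C B (fsum C B f g) h = fsum C B f (fsum C B g h)"
proof -
  define t where "t = ftuple C B 3 s (\<lambda>j. if j = 0 then f else if j = 1 then g else h)"
  have s: "s \<in> Arr C" "Cod C s = bas B" using overD[OF assms(1)] by simp_all
  note t = ftuple[OF s, of 3 "\<lambda>j. if j = 0 then f else if j = 1 then g else h", folded t_def]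
  have t': "t \<in> Arr C" "Cod C t = pw B 3" "st C B 3 \<cdot> t = s" "Dom C t = Dom C s"
    "pj B 3 0 \<cdot> t = f" "pj B 3 1 \<cdot> t = g" "pj B 3 2 \<cdot> t = h"
    using t(1-4) t(5)[of 0] t(5)[of 1] t(5)[of 2] assms by auto
  have o: "over (st C B 3) (pj B 3 0)" "over (st C B 3) (pj B 3 1)" "over (st C B 3) (pj B 3 2)"
    by simp_all
  have "fsum C B (fsum C B (pj B 3 0) (pj B 3 1)) (pj B 3 2) \<cdot> t = fsum C B (fsum C B f g) h"
    using o t' by (simp add: fsum_Cmp[where s="st C B 3"] del: One_nat_def)
  moreover have "fsum C B (pj B 3 0) (fsum C B (pj B 3 1) (pj B 3 2)) \<cdot> t = fsum C B f (fsum C B g h)"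
    using o t' by (simp add: fsum_Cmp[where s="st C B 3"] del: One_nat_def)
  ultimately show ?thesis by (metis pls_assoc)
qed

lemma fsum_comm:
  assumes "over s f" "over s g"
  shows "fsum C B f g = fsum C B g f"
proof -
  have "fsum C B g f = fsum C B (pj B 2 1) (pj B 2 0) \<cdot> fpair C B f g"
    using fpair[OF assms] by (subst fsum_Cmp[where s="st C B 2"]) auto
  then show ?thesis unfolding pls_comm by (simp add: fsum_def)
qed

lemma fsum_zer_right [simp]:
  assumes "over s f"
  shows "fsum C B f (zer B \<cdot> s) = f"
proof -
  note [simp] = overD[OF assms]
  have "f = fsum C B (Id C (tot B)) (zer B \<cdot> prj B) \<cdot> f"
    by (simp add: pls_unit)
  also have "\<dots> = fsum C B (Id C (tot B) \<cdot> f) ((zer B \<cdot> prj B) \<cdot> f)"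
    by (intro fsum_Cmp[where s="prj B"]) (auto simp: over_def)
  also have "\<dots> = fsum C B f (zer B \<cdot> s)"
    by simp
  finally show ?thesis by simp
qed

lemma fsum_zer_left [simp]: "over s f \<Longrightarrow> fsum C B (zer B \<cdot> s) f = f"
  using overD(1,2)[of s f] by (subst fsum_comm[where s=s]) auto

lemma fsum_lcomm:
  assumes "over s f" "over s g" "over s h"
  shows "fsum C B f (fsum C B g h) = fsum C B g (fsum C B f h)"
  using fsum_assoc[OF assms] fsum_assoc[OF assms(2,1,3)] fsum_comm[OF assms(1,2)] by simp

lemma over_fmultiple [simp]: "over s f \<Longrightarrow> over s (fmultiple C B s n f)"
  by (induction n) (use overD(1,2)[of s f] in auto)

lemma fmultiple_add: "over s f \<Longrightarrow>
  fmultiple C B s (m + n) f = fsum C B (fmultiple C B s m f) (fmultiple C B s n f)"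
  by (induction n) (auto simp: fsum_assoc[where s=s])

lemma fmultiple_fsum: "over s f \<Longrightarrow> over s g \<Longrightarrow>
  fmultiple C B s n (fsum C B f g) = fsum C B (fmultiple C B s n f) (fmultiple C B s n g)"
  by (induction n) (use overD(1,2)[of s f] in \<open>auto simp: fsum_assoc[where s=s] fsum_lcomm[where s=s]\<close>)

lemma fmultiple_zer: "s \<in> Arr C \<Longrightarrow> Cod C s = bas B \<Longrightarrow> fmultiple C B s n (zer B \<cdot> s) = zer B \<cdot> s"
  by (induction n) auto

lemma fmultiple_mult: "over s f \<Longrightarrow>
  fmultiple C B s (m * n) f = fmultiple C B s m (fmultiple C B s n f)"
  by (induction m) (auto simp: fmultiple_add intro: fsum_comm[where s=s])

lemma fmultiple_Cmp: "over s f \<Longrightarrow> h \<in> Arr C \<Longrightarrow> Cod C h = Dom C s \<Longrightarrow>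
  fmultiple C B s n f \<cdot> h = fmultiple C B (s \<cdot> h) n (f \<cdot> h)"
  by (induction n) (use overD(1,2)[of s f] in \<open>auto simp: fsum_Cmp[where s=s]\<close>)

lemma over_flincomb [simp]:
  "s \<in> Arr C \<Longrightarrow> Cod C s = bas B \<Longrightarrow> (\<And>j. j < m \<Longrightarrow> over s (f j)) \<Longrightarrow> over s (flincomb C B s a f m)"
  by (induction m) auto

lemma flincomb_Cmp:
  assumes "s \<in> Arr C" "Cod C s = bas B" "\<And>j. j < m \<Longrightarrow> over s (f j)" "h \<in> Arr C" "Cod C h = Dom C s"
  shows "flincomb C B s a f m \<cdot> h = flincomb C B (s \<cdot> h) a (\<lambda>j. f j \<cdot> h) m"
  using assms by (induction m) (auto simp: fsum_Cmp[where s=s] fmultiple_Cmp)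

lemma flincomb_cong [cong]:
  "s = s' \<Longrightarrow> m = m' \<Longrightarrow> (\<And>j. j < m' \<Longrightarrow> a j = a' j) \<Longrightarrow> (\<And>j. j < m' \<Longrightarrow> f j = f' j) \<Longrightarrow>
    flincomb C B s a f m = flincomb C B s' a' f' m'"
  by (induction m arbitrary: m') auto

lemma flincomb_0: 
  assumes "s \<in> Arr C" "Cod C s = bas B" "\<And>j. j < m \<Longrightarrow> a j = 0"
  shows "flincomb C B s a f m = zer B \<cdot> s"
  using assms by (induction m) auto

lemma flincomb_delta:
  assumes "s \<in> Arr C" "Cod C s = bas B" "\<And>j. j < m \<Longrightarrow> over s (f j)" "i < m"
  shows "flincomb C B s (\<lambda>j. if i = j then 1 else 0) f m = f i"
  using assms
proof (induction m)
  case (Suc m)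
  show ?case
  proof (cases "i = m")
    case True
    then show ?thesis using Suc.prems by (simp add: flincomb_0)
  next
    case False
    then show ?thesis using Suc by simp
  qed
qed simp

lemma flincomb_add:
  assumes "s \<in> Arr C" "Cod C s = bas B" "\<And>j. j < m \<Longrightarrow> over s (f j)"
  shows "flincomb C B s (\<lambda>j. a j + b j) f m = fsum C B (flincomb C B s a f m) (flincomb C B s b f m)"
  using assms
  by (induction m) (auto simp: fmultiple_add fsum_assoc[where s=s] fsum_lcomm[where s=s])

lemma flincomb_scale:
  assumes "s \<in> Arr C" "Cod C s = bas B" "\<And>j. j < m \<Longrightarrow> over s (f j)"
  shows "flincomb C B s (\<lambda>j. c * a j) f m = fmultiple C B s c (flincomb C B s a f m)"
  using assms
  by (induction m) (auto simp: fmultiple_mult fmultiple_fsum fmultiple_zer)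

text \<open>The identity behind functoriality: collecting the coefficients of a linear combination of
  linear combinations is matrix multiplication.\<close>

lemma flincomb_flincomb:
  assumes "s \<in> Arr C" "Cod C s = bas B" "\<And>k. k < p \<Longrightarrow> over s (f k)"
  shows "flincomb C B s a (\<lambda>j. flincomb C B s (b j) f p) m =
         flincomb C B s (\<lambda>k. \<Sum>j<m. a j * b j k) f p"
  using assms by (induction m) (auto simp: flincomb_0 flincomb_add flincomb_scale)

lemma Ind_fm:
  shows Ind_fm_Arr [simp]: "Ind_fm C B M \<in> Arr C"
    and Dom_Ind_fm [simp]: "Dom C (Ind_fm C B M) = pw B (dim_col M)"
    and Cod_Ind_fm [simp]: "Cod C (Ind_fm C B M) = pw B (dim_row M)"
    and st_Ind_fm [simp]: "st C B (dim_row M) \<cdot> Ind_fm C B M = st C B (dim_col M)"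
    and pj_Ind_fm [simp]: "i < dim_row M \<Longrightarrow> pj B (dim_row M) i \<cdot> Ind_fm C B M =
      flincomb C B (st C B (dim_col M)) (\<lambda>j. M $$ (i, j)) (pj B (dim_col M)) (dim_col M)"
  unfolding Ind_fm_def Let_def by simp_all

lemma Ind_fm_Id: "Ind_fm C B (1\<^sub>m n) = Id C (pw B n)"
proof (rule pw_eqI[of _ "pw B n" n])
  show "st C B n \<cdot> Ind_fm C B (1\<^sub>m n) = st C B n \<cdot> Id C (pw B n)"
    using st_Ind_fm[of "1\<^sub>m n"] by simp
  fix j assume j: "j < n"
  then show "pj B n j \<cdot> Ind_fm C B (1\<^sub>m n) = pj B n j \<cdot> Id C (pw B n)"
    using pj_Ind_fm[of j "1\<^sub>m n"] flincomb_delta[of "st C B n" n "pj B n" j] by simp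
qed auto

lemma Ind_fm_Cmp:
  assumes "dim_col N = dim_row M"
  shows "Ind_fm C B (N * M) = Ind_fm C B N \<cdot> Ind_fm C B M"
proof (rule pw_eqI[of _ "pw B (dim_col M)" "dim_row N"])
  have s: "st C B (dim_row N) \<cdot> (Ind_fm C B N \<cdot> Ind_fm C B M) = st C B (dim_col M)"
    using assms by (simp add: Cmp_reassoc[OF st_Ind_fm])
  then show "st C B (dim_row N) \<cdot> Ind_fm C B (N * M) = st C B (dim_row N) \<cdot> (Ind_fm C B N \<cdot> Ind_fm C B M)"
    using st_Ind_fm[of "N * M"] by simp
  fix i assume i: "i < dim_row N"
  let ?s = "st C B (dim_col M)"
  have st: "st C B (dim_col N) \<cdot> Ind_fm C B M = ?s" using assms by simp
  have "pj B (dim_row N) i \<cdot> (Ind_fm C B N \<cdot> Ind_fm C B M) =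
     flincomb C B (st C B (dim_col N)) (\<lambda>j. N $$ (i, j)) (pj B (dim_col N)) (dim_col N) \<cdot> Ind_fm C B M"
    using i assms by (intro Cmp_reassoc[OF pj_Ind_fm]) auto
  also have "\<dots> = flincomb C B ?s (\<lambda>j. N $$ (i, j))
       (\<lambda>j. flincomb C B ?s (\<lambda>k. M $$ (j, k)) (pj B (dim_col M)) (dim_col M)) (dim_col N)"
    using assms by (subst flincomb_Cmp) auto
  also have "\<dots> = flincomb C B ?s (\<lambda>k. \<Sum>j<dim_col N. N $$ (i, j) * M $$ (j, k)) (pj B (dim_col M)) (dim_col M)"
    by (rule flincomb_flincomb) auto
  also have "\<dots> = flincomb C B ?s (\<lambda>k. (N * M) $$ (i, k)) (pj B (dim_col M)) (dim_col M)"
    using i assms by (intro flincomb_cong) (auto simp: scalar_prod_def atLeast0LessThan)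
  finally show "pj B (dim_row N) i \<cdot> Ind_fm C B (N * M) = pj B (dim_row N) i \<cdot> (Ind_fm C B N \<cdot> Ind_fm C B M)"
    using pj_Ind_fm[of i "N * M"] i by simp
qed (use assms in auto)

end

lemma abundleI: "category C \<Longrightarrow> additive_bundle C B \<Longrightarrow> abundle C B"
  by unfold_locales (auto simp: additive_bundle_def)

lemma category_Nmat: "category Nmat"
  by (auto simp: category_def Nmat_def intro: assoc_mult_mat[symmetric])

lemma (in abundle) is_functor_Ind_fm: "is_functor Nmat C (pw B) (Ind_fm C B)"
  using Ind_fm_Cmp category category_Nmat
  by (auto simp: is_functor_def Nmat_def Ind_fm_Id)


section \<open>Additive morphisms\<close>

locale bundle_map = cat_loc C + B: power_bundle C B + B': power_bundle C B'
  for C :: "('o, 'a, 'z) cat_scheme" (structure)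
    and B :: "('o, 'a, 'y) add_bundle_scheme" and B' :: "('o, 'a, 'x) add_bundle_scheme" +
  fixes f g :: 'a
  assumes bundle_morphism: "bundle_morphism C B B' f g"
begin

lemma f_Hom [unfolded Hom_iff, simp]: "f \<in> Hom C (tot B) (tot B')"
  and g_Hom [unfolded Hom_iff, simp]: "g \<in> Hom C (bas B) (bas B')"
  and prj_f: "prj B' \<cdot> f = g \<cdot> prj B"
  using bundle_morphism by (auto simp: bundle_morphism_def)

lemma over_f [simp]:
  assumes "B.over s h"
  shows "B'.over (g \<cdot> s) (f \<cdot> h)"
proof -
  note [simp] = B.overD[OF assms]
  show ?thesis
    by (simp add: B'.over_def Cmp_reassoc[OF prj_f])
qed

lemma pow_map:
  shows pow_map_Arr [simp]: "pow_map C B B' f g n \<in> Arr C"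
    and Dom_pow_map [simp]: "Dom C (pow_map C B B' f g n) = pw B n"
    and Cod_pow_map [simp]: "Cod C (pow_map C B B' f g n) = pw B' n"
    and st_pow_map [simp]: "st C B' n \<cdot> pow_map C B B' f g n = g \<cdot> st C B n"
    and pj_pow_map [simp]: "j < n \<Longrightarrow> pj B' n j \<cdot> pow_map C B B' f g n = f \<cdot> pj B n j"
  unfolding pow_map_def by (simp_all add: B'.ftuple)

lemmas pow_map_reassoc [simp] = Cmp_reassoc[OF st_pow_map] Cmp_reassoc[OF pj_pow_map]

lemma pow_map_fpair:
  assumes "B.over s h" "B.over s k"
  shows "pow_map C B B' f g 2 \<cdot> fpair C B h k = fpair C B' (f \<cdot> h) (f \<cdot> k)"
proof -
  note p = B.fpair[OF assms] B.overD[OF assms(1)]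
  have "pj B' 2 i \<cdot> (pow_map C B B' f g 2 \<cdot> fpair C B h k) = f \<cdot> (pj B 2 i \<cdot> fpair C B h k)"
    if "i < 2" for i
    using p that by simp
  from this[of 0] this[of 1] show ?thesis
    using p assms by (intro B'.fpair_eqI[symmetric, OF over_f over_f]) auto
qed

end

locale additive_map = bundle_map C B B' f g + B: abundle C B + B': abundle C B'
  for C :: "('o, 'a, 'z) cat_scheme" (structure)
    and B :: "('o, 'a, 'y) add_bundle_scheme" and B' :: "('o, 'a, 'x) add_bundle_scheme"
    and f g :: 'a +
  assumes additive: "additive_morphism C B B' f g"
begin

lemma f_pls: "f \<cdot> pls B = pls B' \<cdot> pow_map C B B' f g 2"
  and f_zer: "f \<cdot> zer B = zer B' \<cdot> g"
  using additive by (auto simp: additive_morphism_def)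

lemma f_fsum:
  assumes "B.over s h" "B.over s k"
  shows "f \<cdot> fsum C B h k = fsum C B' (f \<cdot> h) (f \<cdot> k)"
  unfolding fsum_def pow_map_fpair[OF assms, symmetric]
  using B.fpair[OF assms] Cmp_reassoc[OF f_pls, of "fpair C B h k"] by simp

lemma f_fmultiple: "B.over s h \<Longrightarrow> f \<cdot> fmultiple C B s n h = fmultiple C B' (g \<cdot> s) n (f \<cdot> h)"
  by (induction n) (use B.overD(1,2)[of s h] in \<open>auto simp: Cmp_reassoc[OF f_zer] f_fsum[where s=s]\<close>)

lemma f_flincomb:
  assumes "s \<in> Arr C" "Cod C s = bas B" "\<And>j. j < m \<Longrightarrow> B.over s (h j)"
  shows "f \<cdot> flincomb C B s a h m = flincomb C B' (g \<cdot> s) a (\<lambda>j. f \<cdot> h j) m"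
  using assms by (induction m) (auto simp: Cmp_reassoc[OF f_zer] f_fsum[where s=s] f_fmultiple)

text \<open>Both sides are maps into \<open>E'\<^sub>n\<close>, so it is enough to compare projections.  There \<open>f\<close> passes
  through a linear combination as a homomorphism.\<close>

lemma pow_map_natural:
  "Ind_fm C B' M \<cdot> pow_map C B B' f g (dim_col M) = pow_map C B B' f g (dim_row M) \<cdot> Ind_fm C B M"
proof (rule B'.pw_eqI[of _ "pw B (dim_col M)" "dim_row M"])
  show "st C B' (dim_row M) \<cdot> (Ind_fm C B' M \<cdot> pow_map C B B' f g (dim_col M)) =
    st C B' (dim_row M) \<cdot> (pow_map C B B' f g (dim_row M) \<cdot> Ind_fm C B M)"
    by (simp add: Cmp_reassoc[OF B'.st_Ind_fm])
  fix i assume i: "i < dim_row M"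
  have "pj B' (dim_row M) i \<cdot> (Ind_fm C B' M \<cdot> pow_map C B B' f g (dim_col M)) =
    flincomb C B' (st C B' (dim_col M)) (\<lambda>j. M $$ (i, j)) (pj B' (dim_col M)) (dim_col M)
      \<cdot> pow_map C B B' f g (dim_col M)"
    using i by (intro Cmp_reassoc[OF B'.pj_Ind_fm]) auto
  also have "\<dots> = flincomb C B' (g \<cdot> st C B (dim_col M)) (\<lambda>j. M $$ (i, j))
      (\<lambda>j. f \<cdot> pj B (dim_col M) j) (dim_col M)"
    by (subst B'.flincomb_Cmp) (auto intro!: B'.flincomb_cong)
  also have "\<dots> = f \<cdot> (pj B (dim_row M) i \<cdot> Ind_fm C B M)"
    using i by (simp add: f_flincomb)
  also have "\<dots> = pj B' (dim_row M) i \<cdot> (pow_map C B B' f g (dim_row M) \<cdot> Ind_fm C B M)"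
    using i by simp
  finally show "pj B' (dim_row M) i \<cdot> (Ind_fm C B' M \<cdot> pow_map C B B' f g (dim_col M)) =
    pj B' (dim_row M) i \<cdot> (pow_map C B B' f g (dim_row M) \<cdot> Ind_fm C B M)" .
qed auto

lemma natural_pow_map: "natural_transformation Nmat C (pw B) (Ind_fm C B) (pw B') (Ind_fm C B')
    (pow_map C B B' f g)"
  using B.is_functor_Ind_fm B'.is_functor_Ind_fm pow_map_natural
  by (auto simp: natural_transformation_def Nmat_def)

end


section \<open>Homomorphisms of Weil algebras\<close>

lemma finite_weil_basis [simp]: "finite (weil_basis A)"
  by (rule finite_subset[of _ "Pow {1..fst A}"]) (auto simp: weil_basis_def)

lemma empty_weil_basis [simp]: "{} \<in> weil_basis A"
  by (simp add: weil_basis_def)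

lemma weil_basis_subset: "S \<in> weil_basis A \<Longrightarrow> U \<subseteq> S \<Longrightarrow> U \<in> weil_basis A"
  by (auto simp: weil_basis_def)

lemma weil_basis_finite: "S \<in> weil_basis A \<Longrightarrow> finite S"
  by (auto simp: weil_basis_def intro: finite_subset)

lemma weil_carrier: "a \<in> carrier (weil_alg A) \<longleftrightarrow> (\<forall>S. S \<notin> weil_basis A \<longrightarrow> a S = 0)"
  by (simp add: weil_alg_def)

lemma weil_mult: "(a \<otimes>\<^bsub>weil_alg A\<^esub> b) S =
    (if S \<in> weil_basis A then \<Sum>U\<in>Pow S. a U * b (S - U) else 0)"
  by (simp add: weil_alg_def)

lemma weil_one [simp]: "\<one>\<^bsub>weil_alg A\<^esub> = weil_mon {}"
  and weil_zero [simp]: "\<zero>\<^bsub>weil_alg A\<^esub> = (\<lambda>S. 0)"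
  and weil_add [simp]: "a \<oplus>\<^bsub>weil_alg A\<^esub> b = (\<lambda>S. a S + b S)"
  by (simp_all add: weil_alg_def)

lemma weil_zero_carrier [simp]: "(\<lambda>S. 0) \<in> carrier (weil_alg A)"
  and weil_add_carrier [simp]: "a \<in> carrier (weil_alg A) \<Longrightarrow> b \<in> carrier (weil_alg A) \<Longrightarrow>
    (\<lambda>S. a S + b S) \<in> carrier (weil_alg A)"
  and weil_mult_carrier [simp]: "a \<otimes>\<^bsub>weil_alg A\<^esub> b \<in> carrier (weil_alg A)"
  and weil_mon_carrier [simp]: "weil_mon U \<in> carrier (weil_alg A) \<longleftrightarrow> U \<in> weil_basis A"
  by (auto simp: weil_carrier weil_mult weil_mon_def split: if_splits)

lemma weil_mon_apply [simp]: "weil_mon U U = 1"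
  by (simp add: weil_mon_def)

lemma weil_mult_zero [simp]: "(\<lambda>S. 0) \<otimes>\<^bsub>weil_alg A\<^esub> b = (\<lambda>S. 0)"
    "b \<otimes>\<^bsub>weil_alg A\<^esub> (\<lambda>S. 0) = (\<lambda>S. 0)"
  by (auto simp: weil_mult fun_eq_iff)

lemma weil_mult_empty [simp]: "(a \<otimes>\<^bsub>weil_alg A\<^esub> b) {} = a {} * b {}"
  by (simp add: weil_mult)

lemma weil_mon_mult: "weil_mon U \<otimes>\<^bsub>weil_alg A\<^esub> weil_mon V =
   (if U \<inter> V = {} \<and> U \<union> V \<in> weil_basis A then weil_mon (U \<union> V) else (\<lambda>S. 0))"
proof
  fix S
  have "(\<Sum>P\<in>Pow S. weil_mon U P * weil_mon V (S - P)) =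
     (\<Sum>P\<in>Pow S. if P = U then (if S - U = V then 1 else 0) else 0)"
    by (intro sum.cong) (auto simp: weil_mon_def)
  also have "\<dots> = (if U \<subseteq> S \<and> S - U = V then 1 else 0)" if "finite S"
    using that by (subst sum.delta) auto
  also have "U \<subseteq> S \<and> S - U = V \<longleftrightarrow> U \<inter> V = {} \<and> S = U \<union> V" by auto
  finally show "(weil_mon U \<otimes>\<^bsub>weil_alg A\<^esub> weil_mon V) S =
     (if U \<inter> V = {} \<and> U \<union> V \<in> weil_basis A then weil_mon (U \<union> V) else (\<lambda>S. 0)) S"
    using weil_basis_finite[of S A] by (auto simp: weil_mult weil_mon_def)
qed

lemma Weil_Obj: "A \<in> Obj Weil \<longleftrightarrow> equiv {1..fst A} (snd A)"
  by (cases A) (simp add: Weil_def)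

lemma Weil_Arr: "(A, B, h) \<in> Arr Weil \<longleftrightarrow> A \<in> Obj Weil \<and> B \<in> Obj Weil \<and>
   h \<in> ring_hom (weil_alg A) (weil_alg B) \<and> h (\<lambda>S. 0) = (\<lambda>S. 0) \<and> h \<in> extensional (carrier (weil_alg A))"
  by (cases A; cases B) (simp add: Weil_def)

lemma Weil_sel [simp]: "Dom Weil (A, B, h) = A" "Cod Weil (A, B, h) = B"
  "Id Weil A = (A, A, \<lambda>a\<in>carrier (weil_alg A). a)"
  "(B', D, k) \<cdot>\<^bsub>Weil\<^esub> (A, B, h) = (A, D, compose (carrier (weil_alg A)) k h)"
  by (simp_all add: Weil_def)

lemma category_Weil: "category Weil"
  unfolding category_def
proof (intro conjI ballI impI)
  fix f assume f: "f \<in> Arr Weil"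
  obtain A B h where [simp]: "f = (A, B, h)" by (cases f)
  have h: "h \<in> ring_hom (weil_alg A) (weil_alg B)" using f by (simp add: Weil_Arr)
  show "Dom Weil f \<in> Obj Weil" "Cod Weil f \<in> Obj Weil" using f by (auto simp: Weil_Arr)
  show "f \<cdot>\<^bsub>Weil\<^esub> cat.Id Weil (Dom Weil f) = f" "cat.Id Weil (Cod Weil f) \<cdot>\<^bsub>Weil\<^esub> f = f"
    using f by (auto simp: Weil_Arr compose_def fun_eq_iff extensional_def ring_hom_closed[OF h])
  fix g assume g: "g \<in> Arr Weil" and d: "Dom Weil g = Cod Weil f"
  obtain D k where [simp]: "g = (B, D, k)" using d by (cases g) auto
  have k: "k \<in> ring_hom (weil_alg B) (weil_alg D)" using g by (simp add: Weil_Arr)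
  have "compose (carrier (weil_alg A)) k h \<in> ring_hom (weil_alg A) (weil_alg D)"
    using ring_hom_trans[OF h k] by (auto simp: ring_hom_def compose_def)
  then show "g \<cdot>\<^bsub>Weil\<^esub> f \<in> Hom Weil (Dom Weil f) (Cod Weil g)"
    using f g by (auto simp: Weil_Arr compose_def)
  fix l assume l: "l \<in> Arr Weil" and "Dom Weil l = Cod Weil g"
  then obtain D' m where [simp]: "l = (D, D', m)" by (cases l) auto
  show "l \<cdot>\<^bsub>Weil\<^esub> (g \<cdot>\<^bsub>Weil\<^esub> f) = l \<cdot>\<^bsub>Weil\<^esub> g \<cdot>\<^bsub>Weil\<^esub> f"
    by (auto simp: compose_def fun_eq_iff ring_hom_closed[OF h])
next
  fix A assume "A \<in> Obj Weil"
  then show "cat.Id Weil A \<in> Hom Weil A A"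
    by (auto simp: Weil_Arr intro!: ring_hom_memI)
qed

interpretation Weil: cat_loc Weil
  by unfold_locales (rule category_Weil)

text \<open>An element is a finite \<open>\<nat>\<close>-linear combination of monomials, and additivity together with
  preservation of zero yields \<open>\<nat>\<close>-linearity.  Hence morphisms can be compared on monomials.\<close>

lemma weil_hom_expand:
  assumes f: "(A, B, h) \<in> Arr Weil" and a: "a \<in> carrier (weil_alg A)"
  shows "h a V = (\<Sum>U\<in>weil_basis A. a U * h (weil_mon U) V)"
proof -
  have hom: "h \<in> ring_hom (weil_alg A) (weil_alg B)" and z: "h (\<lambda>S. 0) = (\<lambda>S. 0)"
    using f by (auto simp: Weil_Arr)
  have add: "h (\<lambda>S. x S + y S) = (\<lambda>S. h x S + h y S)"
    if "x \<in> carrier (weil_alg A)" "y \<in> carrier (weil_alg A)" for x y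
    using ring_hom_add[OF hom that] by simp
  have mul: "(\<lambda>S. n * weil_mon U S) \<in> carrier (weil_alg A) \<and>
      h (\<lambda>S. n * weil_mon U S) = (\<lambda>S. n * h (weil_mon U) S)" if "U \<in> weil_basis A" for n U
  proof (induction n)
    case (Suc n)
    have "weil_mon U \<in> carrier (weil_alg A)" using that by simp
    then show ?case using add[of "weil_mon U" "\<lambda>S. n * weil_mon U S"] Suc by simp
  qed (simp add: z)
  have *: "(\<lambda>S. \<Sum>U\<in>F. a U * weil_mon U S) \<in> carrier (weil_alg A) \<and>
     h (\<lambda>S. \<Sum>U\<in>F. a U * weil_mon U S) = (\<lambda>S. \<Sum>U\<in>F. a U * h (weil_mon U) S)"
    if "finite F" "F \<subseteq> weil_basis A" for F
    using that
  proof (induction F)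
    case (insert U F)
    then show ?case
      using add[of "\<lambda>S. a U * weil_mon U S" "\<lambda>S. \<Sum>U\<in>F. a U * weil_mon U S"] mul[of U "a U"] by simp
  qed (simp add: z)
  have "(\<lambda>S. \<Sum>U\<in>weil_basis A. a U * weil_mon U S) = a"
  proof
    fix S
    have "(\<Sum>U\<in>weil_basis A. a U * weil_mon U S) = (\<Sum>U\<in>weil_basis A. if U = S then a S else 0)"
      by (intro sum.cong) (auto simp: weil_mon_def)
    then show "(\<Sum>U\<in>weil_basis A. a U * weil_mon U S) = a S"
      using a by (auto simp: weil_carrier)
  qed
  then show ?thesis using *[of "weil_basis A"] by simp
qed

lemma weil_hom_mon_empty: "(A, B, h) \<in> Arr Weil \<Longrightarrow> h (weil_mon {}) = weil_mon {}"
  using ring_hom_one[of h "weil_alg A" "weil_alg B"] by (auto simp: Weil_Arr)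

lemma weil_hom_closed: "(A, B, h) \<in> Arr Weil \<Longrightarrow> a \<in> carrier (weil_alg A) \<Longrightarrow> h a \<in> carrier (weil_alg B)"
  using ring_hom_closed[of h "weil_alg A" "weil_alg B"] by (auto simp: Weil_Arr)

text \<open>A monomial other than 1 squares to zero, so the constant term of its image squares to zero in
  \<open>\<nat>\<close> and vanishes.\<close>

lemma weil_hom_empty:
  assumes f: "(A, B, h) \<in> Arr Weil" and a: "a \<in> carrier (weil_alg A)"
  shows "h a {} = a {}"
proof -
  have hom: "h \<in> ring_hom (weil_alg A) (weil_alg B)" and z: "h (\<lambda>S. 0) = (\<lambda>S. 0)"
    using f by (auto simp: Weil_Arr)
  have 0: "h (weil_mon U) {} = 0" if "U \<in> weil_basis A" "U \<noteq> {}" for U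
  proof -
    have U: "weil_mon U \<in> carrier (weil_alg A)" using that by simp
    have "h (weil_mon U) {} * h (weil_mon U) {} = h (weil_mon U \<otimes>\<^bsub>weil_alg A\<^esub> weil_mon U) {}"
      using ring_hom_mult[OF hom U U] by simp
    also have "\<dots> = 0" using that by (simp add: weil_mon_mult z)
    finally show ?thesis by simp
  qed
  have "h a {} = (\<Sum>U\<in>weil_basis A. a U * h (weil_mon U) {})" by (rule weil_hom_expand[OF f a])
  also have "\<dots> = (\<Sum>U\<in>weil_basis A. if U = {} then a {} else 0)"
    using weil_hom_mon_empty[OF f] by (intro sum.cong) (auto simp: 0)
  finally show ?thesis by simp
qed

lemma Weil_Arr_eqI:
  assumes "\<theta> \<in> Arr Weil" "Dom Weil \<theta> = A" "Cod Weil \<theta> = B"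
    and "\<And>U V. U \<in> weil_basis A \<Longrightarrow> g U V = snd (snd \<theta>) (weil_mon U) V"
  shows "weil_lin A B g = \<theta>"
proof -
  obtain h where \<theta>: "\<theta> = (A, B, h)" using assms by (cases \<theta>) auto
  have "h \<in> extensional (carrier (weil_alg A))" using assms(1) \<theta> by (simp add: Weil_Arr)
  moreover have "(\<Sum>U\<in>weil_basis A. a U * g U V) = h a V" if "a \<in> carrier (weil_alg A)" for a V
    using assms(1) that by (subst weil_hom_expand[of A B h]) (auto simp: \<theta> assms(4))
  ultimately show ?thesis
    by (auto simp: \<theta> weil_lin_def extensional_def fun_eq_iff)
qed

text \<open>The product is bilinear, so multiplicativity has to be checked on monomials only.\<close>

lemma weil_lin_Arr:
  assumes A: "A \<in> Obj Weil" and B: "B \<in> Obj Weil"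
    and g: "\<And>U. U \<in> weil_basis A \<Longrightarrow> g U \<in> carrier (weil_alg B)"
    and one: "g {} = weil_mon {}"
    and mult: "\<And>U V. U \<in> weil_basis A \<Longrightarrow> V \<in> weil_basis A \<Longrightarrow>
        g U \<otimes>\<^bsub>weil_alg B\<^esub> g V = (if U \<inter> V = {} \<and> U \<union> V \<in> weil_basis A then g (U \<union> V) else (\<lambda>S. 0))"
  shows "weil_lin A B g \<in> Arr Weil"
proof -
  define L where "L = (\<lambda>a V. \<Sum>U\<in>weil_basis A. a U * g U V :: nat)"
  let ?b = "weil_basis A"
  have Lc: "L a \<in> carrier (weil_alg B)" for a
    using g by (auto simp: L_def weil_carrier)
  have L1: "L (weil_mon {}) = weil_mon {}"
  proof
    fix V
    have "L (weil_mon {}) V = (\<Sum>U\<in>?b. if U = {} then g {} V else 0)"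
      unfolding L_def by (intro sum.cong) (auto simp: weil_mon_def)
    then show "L (weil_mon {}) V = weil_mon {} V" by (simp add: one)
  qed
  have Lm: "L (a \<otimes>\<^bsub>weil_alg A\<^esub> b) = L a \<otimes>\<^bsub>weil_alg B\<^esub> L b" for a b
  proof
    fix W
    let ?D = "{p \<in> ?b \<times> ?b. fst p \<inter> snd p = {} \<and> fst p \<union> snd p \<in> ?b}"
    have "L (a \<otimes>\<^bsub>weil_alg A\<^esub> b) W = (\<Sum>S\<in>?b. \<Sum>U\<in>Pow S. a U * b (S - U) * g S W)"
      unfolding L_def by (intro sum.cong) (auto simp: weil_mult sum_distrib_right)
    also have "\<dots> = (\<Sum>(S, U)\<in>Sigma ?b Pow. a U * b (S - U) * g S W)"
      by (subst sum.Sigma) (auto simp: weil_basis_finite)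
    (* A splitting of S into U and S - U is a pair of disjoint basis monomials with union S. *)
    also have "\<dots> = (\<Sum>(U, V)\<in>?D. a U * b V * g (U \<union> V) W)"
      by (rule sum.reindex_bij_witness[of _ "\<lambda>(U, V). (U \<union> V, U)" "\<lambda>(S, U). (U, S - U)"])
        (auto intro: weil_basis_subset simp: Un_absorb1 Un_Diff Int_commute Diff_triv)
    also have "\<dots> = (\<Sum>(U, V)\<in>?b \<times> ?b. a U * b V * (g U \<otimes>\<^bsub>weil_alg B\<^esub> g V) W)"
      by (rule sum.mono_neutral_cong_left) (auto simp: mult split: if_splits)
    finally have l: "L (a \<otimes>\<^bsub>weil_alg A\<^esub> b) W = (\<Sum>(U, V)\<in>?b \<times> ?b. a U * b V * (g U \<otimes>\<^bsub>weil_alg B\<^esub> g V) W)" .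
    show "L (a \<otimes>\<^bsub>weil_alg A\<^esub> b) W = (L a \<otimes>\<^bsub>weil_alg B\<^esub> L b) W"
    proof (cases "W \<in> weil_basis B")
      case True
      have "(L a \<otimes>\<^bsub>weil_alg B\<^esub> L b) W =
         (\<Sum>P\<in>Pow W. \<Sum>U\<in>?b. \<Sum>V\<in>?b. a U * b V * (g U P * g V (W - P)))"
        using True unfolding weil_mult L_def by (simp add: sum_product mult_ac)
      also have "\<dots> = (\<Sum>U\<in>?b. \<Sum>P\<in>Pow W. \<Sum>V\<in>?b. a U * b V * (g U P * g V (W - P)))"
        by (rule sum.swap)
      also have "\<dots> = (\<Sum>U\<in>?b. \<Sum>V\<in>?b. \<Sum>P\<in>Pow W. a U * b V * (g U P * g V (W - P)))"
        by (intro sum.cong refl sum.swap)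
      also have "\<dots> = (\<Sum>U\<in>?b. \<Sum>V\<in>?b. a U * b V * (g U \<otimes>\<^bsub>weil_alg B\<^esub> g V) W)"
        using True by (simp add: weil_mult sum_distrib_left)
      finally show ?thesis unfolding l by (simp add: sum.cartesian_product)
    next
      case False
      then show ?thesis unfolding l by (simp add: weil_mult case_prod_beta)
    qed
  qed
  have "(\<lambda>a\<in>carrier (weil_alg A). L a) \<in> ring_hom (weil_alg A) (weil_alg B)"
    by (rule ring_hom_memI)
      (auto simp: Lc L1 Lm, auto simp: L_def sum.distrib algebra_simps)
  then show ?thesis using A B
    by (auto simp: weil_lin_def Weil_Arr L_def)
qed

lemma weil_lin_sel [simp]: "Dom Weil (weil_lin A B g) = A" "Cod Weil (weil_lin A B g) = B"
  by (simp_all add: weil_lin_def)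


section \<open>The algebras \<open>W\<^sup>n\<close>\<close>

lemma weil_basis_N [simp]: "weil_basis weil_N = {{}}"
  by (auto simp: weil_basis_def weil_N_def)

lemma weil_basis_pw: "weil_basis (weil_pw n) = insert {} ((\<lambda>i. {i}) ` {1..n})"
proof (rule Set.set_eqI)
  fix S
  show "S \<in> weil_basis (weil_pw n) \<longleftrightarrow> S \<in> insert {} ((\<lambda>i. {i}) ` {1..n})"
  proof
    assume "S \<in> weil_basis (weil_pw n)"
    then have S: "S \<subseteq> {1..n}" "\<And>i j. i \<in> S \<Longrightarrow> j \<in> S \<Longrightarrow> i = j"
      by (auto simp: weil_basis_def weil_pw_def subset_iff)
    show "S \<in> insert {} ((\<lambda>i. {i}) ` {1..n})"
    proof (cases "S = {}")
      case False
      then obtain i where i: "i \<in> S" by blast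
      then have "S = {i}" using S(2) by blast
      then show ?thesis using i S(1) by blast
    qed simp
  qed (auto simp: weil_basis_def weil_pw_def)
qed

lemma weil_N_Obj [simp]: "weil_N \<in> Obj Weil"
  by (auto simp: weil_N_def Weil_Obj equiv_def refl_on_def sym_def trans_def)

lemma weil_pw_Obj [simp]: "weil_pw n \<in> Obj Weil"
  by (auto simp: weil_pw_def Weil_Obj equiv_def refl_on_def sym_def trans_def)

lemma weil_W_Obj [simp]: "weil_W \<in> Obj Weil"
  by (simp add: weil_W_def)

lemma weil_pw_0: "weil_pw 0 = weil_N"
  by (simp add: weil_pw_def weil_N_def)

lemma weil_mult_pw: "(a \<otimes>\<^bsub>weil_alg (weil_pw n)\<^esub> b) S =
   (if S = {} then a {} * b {} else if S \<in> weil_basis (weil_pw n) then a {} * b S + a S * b {} else 0)"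
  by (auto simp: weil_mult weil_basis_pw Pow_insert)

lemma weil_mult_one_pw:
  assumes "a \<in> carrier (weil_alg (weil_pw n))"
  shows "weil_mon {} \<otimes>\<^bsub>weil_alg (weil_pw n)\<^esub> a = a" "a \<otimes>\<^bsub>weil_alg (weil_pw n)\<^esub> weil_mon {} = a"
  using assms by (auto simp: fun_eq_iff weil_mult_pw weil_carrier weil_mon_def)

lemma weil_lin_pw_Arr:
  assumes one: "g {} = weil_mon {}"
    and g: "\<And>i. 1 \<le> i \<Longrightarrow> i \<le> n \<Longrightarrow> g {i} \<in> carrier (weil_alg (weil_pw m)) \<and> g {i} {} = 0"
  shows "weil_lin (weil_pw n) (weil_pw m) g \<in> Arr Weil"
proof (rule weil_lin_Arr)
  show gc: "g U \<in> carrier (weil_alg (weil_pw m))" if "U \<in> weil_basis (weil_pw n)" for U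
    using that g one by (auto simp: weil_basis_pw)
  fix U V assume U: "U \<in> weil_basis (weil_pw n)" and V: "V \<in> weil_basis (weil_pw n)"
  consider "U = {}" | "V = {}" | i j where "U = {i}" "V = {j}" "i \<in> {1..n}" "j \<in> {1..n}"
    using U V by (auto simp: weil_basis_pw)
  then show "g U \<otimes>\<^bsub>weil_alg (weil_pw m)\<^esub> g V =
     (if U \<inter> V = {} \<and> U \<union> V \<in> weil_basis (weil_pw n) then g (U \<union> V) else (\<lambda>S. 0))"
  proof cases
    case 3
    then have "g U {} = 0" "g V {} = 0" using g by auto
    moreover have "\<not> (U \<inter> V = {} \<and> U \<union> V \<in> weil_basis (weil_pw n))"
      using 3(1,2) by (auto simp: weil_basis_pw)
    ultimately show ?thesis by (auto simp: weil_mult_pw fun_eq_iff)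
  qed (use U V one gc in \<open>simp_all add: weil_mult_one_pw\<close>)
qed (use one in simp_all)

lemma weil_aug_Arr [simp]: "A \<in> Obj Weil \<Longrightarrow> weil_aug A \<in> Arr Weil"
  unfolding weil_aug_def
  by (rule weil_lin_Arr) (auto simp: weil_mon_mult)

lemma weil_unit_Arr [simp]: "A \<in> Obj Weil \<Longrightarrow> weil_unit A \<in> Arr Weil"
  unfolding weil_unit_def
  by (rule weil_lin_Arr) (auto simp: weil_mon_mult)

lemma weil_proj_Arr [simp]: "weil_proj n i \<in> Arr Weil"
  unfolding weil_proj_def weil_W_def
  by (rule weil_lin_pw_Arr) (auto simp: weil_basis_pw, auto simp: weil_mon_def)

lemma weil_plus_Arr [simp]: "weil_plus \<in> Arr Weil"
  unfolding weil_plus_def weil_W_def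
  by (rule weil_lin_pw_Arr) (auto simp: weil_basis_pw, auto simp: weil_mon_def)

lemma weil_arr_sel [simp]:
  "Dom Weil (weil_aug A) = A" "Cod Weil (weil_aug A) = weil_N"
  "Dom Weil (weil_unit A) = weil_N" "Cod Weil (weil_unit A) = A"
  "Dom Weil (weil_proj n i) = weil_pw n" "Cod Weil (weil_proj n i) = weil_W"
  "Dom Weil weil_plus = weil_pw 2" "Cod Weil weil_plus = weil_W"
  by (simp_all add: weil_aug_def weil_unit_def weil_proj_def weil_plus_def)

text \<open>\<open>\<nat>\<close> is terminal because homomorphisms preserve constant terms, and initial because it is spanned
  by 1.  This decides every equation between morphisms into or out of \<open>\<nat>\<close>.\<close>

lemma to_weil_N:
  assumes "\<theta> \<in> Arr Weil" "Cod Weil \<theta> = weil_N"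
  shows "\<theta> = weil_aug (Dom Weil \<theta>)"
proof -
  obtain A h where \<theta>: "\<theta> = (A, weil_N, h)" using assms by (cases \<theta>) auto
  have "weil_aug A = \<theta>"
    unfolding weil_aug_def
  proof (rule Weil_Arr_eqI)
    fix U V assume U: "U \<in> weil_basis A"
    then have "h (weil_mon U) \<in> carrier (weil_alg weil_N)" "h (weil_mon U) {} = weil_mon U {}"
      using assms weil_hom_closed[of A weil_N h] weil_hom_empty[of A weil_N h] by (auto simp: \<theta>)
    then show "(if U = {} then weil_mon {} else (\<lambda>V. 0)) V = snd (snd \<theta>) (weil_mon U) V"
      by (cases "V = {}") (auto simp: \<theta> weil_carrier weil_mon_def)
  qed (use assms \<theta> in auto)
  then show ?thesis by (simp add: \<theta>)
qed

lemma from_weil_N: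
  assumes "\<theta> \<in> Arr Weil" "Dom Weil \<theta> = weil_N"
  shows "\<theta> = weil_unit (Cod Weil \<theta>)"
proof -
  obtain B h where \<theta>: "\<theta> = (weil_N, B, h)" using assms by (cases \<theta>) auto
  have "weil_unit B = \<theta>"
    unfolding weil_unit_def
    by (rule Weil_Arr_eqI) (use assms weil_hom_mon_empty[of weil_N B h] in \<open>auto simp: \<theta>\<close>)
  then show ?thesis by (simp add: \<theta>)
qed

lemma weil_aug_Cmp: "\<theta> \<in> Arr Weil \<Longrightarrow> weil_aug (Cod Weil \<theta>) \<cdot>\<^bsub>Weil\<^esub> \<theta> = weil_aug (Dom Weil \<theta>)"
  by (subst to_weil_N) auto

lemma weil_Cmp_unit: "\<theta> \<in> Arr Weil \<Longrightarrow> \<theta> \<cdot>\<^bsub>Weil\<^esub> weil_unit (Dom Weil \<theta>) = weil_unit (Cod Weil \<theta>)"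
  by (subst from_weil_N) auto

lemma weil_aug_N: "weil_aug weil_N = Id Weil weil_N"
  using to_weil_N[of "Id Weil weil_N"] Weil.Id_Arr[of weil_N] by simp

text \<open>The projection \<open>W\<^bsup>n+1\<^esup> \<rightarrow> W\<^sup>n\<close> of the decomposition \<open>W\<^bsup>n+1\<^esup> = W\<^sup>n \<times> W\<close>.\<close>

definition weil_init :: "nat \<Rightarrow> weil_arr" where
  "weil_init n = weil_lin (weil_pw (Suc n)) (weil_pw n) (\<lambda>U. if U = {Suc n} then (\<lambda>V. 0) else weil_mon U)"

lemma weil_init_sel [simp]: "Dom Weil (weil_init n) = weil_pw (Suc n)" "Cod Weil (weil_init n) = weil_pw n"
  by (simp_all add: weil_init_def)

lemma weil_init_Arr [simp]: "weil_init n \<in> Arr Weil"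
  unfolding weil_init_def
  by (rule weil_lin_pw_Arr) (auto simp: weil_basis_pw, auto simp: weil_mon_def)

lemma weil_init_apply:
  assumes "a \<in> carrier (weil_alg (weil_pw (Suc n)))"
  shows "snd (snd (weil_init n)) a V = (if V = {Suc n} then 0 else a V)"
proof -
  let ?b = "weil_basis (weil_pw (Suc n))"
  have "snd (snd (weil_init n)) a V = (\<Sum>U\<in>?b. a U * (if U = {Suc n} then (\<lambda>V. 0) else weil_mon U) V)"
    using assms by (simp add: weil_init_def weil_lin_def)
  also have "\<dots> = (\<Sum>U\<in>?b. if U = V then (if V = {Suc n} then 0 else a V) else 0)"
    by (intro sum.cong refl) (simp add: weil_mon_def)
  finally show ?thesis using assms by (simp add: weil_carrier)
qed

lemma weil_proj_apply:
  assumes "a \<in> carrier (weil_alg (weil_pw n))" "1 \<le> i" "i \<le> n"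
  shows "snd (snd (weil_proj n i)) a V = (if V = {} then a {} else if V = {1} then a {i} else 0)"
proof -
  let ?g = "\<lambda>U. if U = {} then weil_mon {} else if U = {i} then weil_mon {1} else (\<lambda>V. 0)"
  have "snd (snd (weil_proj n i)) a V = (\<Sum>U\<in>weil_basis (weil_pw n). a U * ?g U V)"
    using assms(1) by (simp add: weil_proj_def weil_lin_def)
  also have "\<dots> = (\<Sum>U\<in>{{}, {i}}. a U * ?g U V)"
    by (rule sum.mono_neutral_right) (use assms(2,3) in \<open>auto simp: weil_basis_pw\<close>)
  finally show ?thesis by (simp add: weil_mon_def)
qed

lemma weil_init_proj:
  assumes "1 \<le> i" "i \<le> n"
  shows "weil_proj n i \<cdot>\<^bsub>Weil\<^esub> weil_init n = weil_proj (Suc n) i"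
proof -
  obtain h where h: "weil_init n = (weil_pw (Suc n), weil_pw n, h)"
    by (simp add: weil_init_def weil_lin_def)
  obtain k where k: "weil_proj n i = (weil_pw n, weil_W, k)"
    by (simp add: weil_proj_def weil_lin_def)
  obtain l where l: "weil_proj (Suc n) i = (weil_pw (Suc n), weil_W, l)"
    by (simp add: weil_proj_def weil_lin_def)
  have hc: "h a \<in> carrier (weil_alg (weil_pw n))" if "a \<in> carrier (weil_alg (weil_pw (Suc n)))" for a
    using weil_hom_closed weil_init_Arr[of n] that by (auto simp: h)
  have "compose (carrier (weil_alg (weil_pw (Suc n)))) k h = l"
  proof (rule extensionalityI[of _ "carrier (weil_alg (weil_pw (Suc n)))"])
    show "l \<in> extensional (carrier (weil_alg (weil_pw (Suc n))))"
      using weil_proj_Arr[of "Suc n" i] by (simp add: l Weil_Arr)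
    fix a assume a: "a \<in> carrier (weil_alg (weil_pw (Suc n)))"
    show "compose (carrier (weil_alg (weil_pw (Suc n)))) k h a = l a"
      using weil_init_apply[OF a] weil_proj_apply[OF hc[OF a] assms] weil_proj_apply[OF a, of i] assms a
      by (auto simp: h k l compose_def fun_eq_iff)
  qed simp
  then show ?thesis by (simp add: h k l)
qed

text \<open>Given \<open>f : A \<rightarrow> W\<^sup>n\<close> and \<open>g : A \<rightarrow> W\<close>, the coefficients of \<open>h a\<close> are forced: those of \<open>f a\<close>, and
  that of \<open>g a\<close> at the new variable.  This \<open>h\<close> is multiplicative since coefficients of a product
  in \<open>W\<^bsup>n+1\<^esup>\<close> involve only one variable and constant terms, and the constant terms of \<open>f a\<close> and
  \<open>g a\<close> agree, both being that of \<open>a\<close>.\<close>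

lemma is_product_pw:
  "is_product Weil (weil_pw (Suc n)) (weil_pw n) weil_W (weil_init n) (weil_proj (Suc n) (Suc n))"
  unfolding is_product_def
proof (intro conjI ballI)
  fix A f g
  assume "A \<in> Obj Weil" "f \<in> Hom Weil A (weil_pw n)" "g \<in> Hom Weil A weil_W"
  then obtain f' g' where f: "f = (A, weil_pw n, f')" "f \<in> Arr Weil"
    and g: "g = (A, weil_W, g')" "g \<in> Arr Weil" and A: "A \<in> Obj Weil"
    by (cases f; cases g) auto
  let ?P = "weil_pw (Suc n)" and ?C = "carrier (weil_alg A)"
  obtain \<pi> where \<pi>: "weil_init n = (?P, weil_pw n, \<pi>)" by (simp add: weil_init_def weil_lin_def)
  obtain \<rho> where \<rho>: "weil_proj (Suc n) (Suc n) = (?P, weil_W, \<rho>)" by (simp add: weil_proj_def weil_lin_def)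
  have \<pi>': "\<pi> a V = (if V = {Suc n} then 0 else a V)" if "a \<in> carrier (weil_alg ?P)" for a V
    using weil_init_apply[OF that] \<pi> by simp
  have \<rho>': "\<rho> a V = (if V = {} then a {} else if V = {1} then a {Suc n} else 0)"
    if "a \<in> carrier (weil_alg ?P)" for a V
    using weil_proj_apply[OF that, of "Suc n"] \<rho> by simp
  have fc: "f' a \<in> carrier (weil_alg (weil_pw n))" "f' a {} = a {}" if "a \<in> ?C" for a
    using weil_hom_closed[of A "weil_pw n" f'] weil_hom_empty[of A "weil_pw n" f'] f that by auto
  have gc: "g' a \<in> carrier (weil_alg weil_W)" "g' a {} = a {}" if "a \<in> ?C" for a
    using weil_hom_closed[of A "weil_W" g'] weil_hom_empty[of A "weil_W" g'] g that by auto
  define h where "h = (\<lambda>a\<in>?C. \<lambda>S. if S = {Suc n} then g' a {1} else f' a S)"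
  have hc: "h a \<in> carrier (weil_alg ?P)" if "a \<in> ?C" for a
    using fc[OF that] that by (auto simp: h_def weil_carrier weil_basis_pw image_iff)
  have f_hom: "f' \<in> ring_hom (weil_alg A) (weil_alg (weil_pw n))" "f' (\<lambda>S. 0) = (\<lambda>S. 0)"
     "f' \<in> extensional ?C" using f by (auto simp: Weil_Arr)
  have g_hom: "g' \<in> ring_hom (weil_alg A) (weil_alg (weil_pw 1))" "g' (\<lambda>S. 0) = (\<lambda>S. 0)"
     "g' \<in> extensional ?C" using g by (auto simp: Weil_Arr weil_W_def)
  have Sn: "{Suc n} \<notin> weil_basis (weil_pw n)" "{1} \<in> weil_basis (weil_pw 1)"
      "{Suc n} \<in> weil_basis (weil_pw (Suc n))"
      "S \<noteq> {Suc n} \<Longrightarrow> S \<in> weil_basis (weil_pw (Suc n)) \<longleftrightarrow> S \<in> weil_basis (weil_pw n)" for S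
    by (auto simp: weil_basis_pw)
  have "h \<in> ring_hom (weil_alg A) (weil_alg ?P)"
  proof (rule ring_hom_memI)
    fix a b assume ab: "a \<in> ?C" "b \<in> ?C"
    show "h (a \<otimes>\<^bsub>weil_alg A\<^esub> b) = h a \<otimes>\<^bsub>weil_alg ?P\<^esub> h b"
      using ab ring_hom_mult[OF f_hom(1) ab] ring_hom_mult[OF g_hom(1) ab] fc gc Sn
      by (auto simp: h_def weil_mult_pw fun_eq_iff)
    show "h (a \<oplus>\<^bsub>weil_alg A\<^esub> b) = h a \<oplus>\<^bsub>weil_alg ?P\<^esub> h b"
      using ab ring_hom_add[OF f_hom(1) ab] ring_hom_add[OF g_hom(1) ab]
      by (auto simp: h_def fun_eq_iff)
  next
    show "h \<one>\<^bsub>weil_alg A\<^esub> = \<one>\<^bsub>weil_alg ?P\<^esub>"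
      using ring_hom_one[OF f_hom(1)] ring_hom_one[OF g_hom(1)]
      by (simp add: h_def fun_eq_iff) (simp add: weil_mon_def)
  qed (rule hc)
  then have hA: "(A, ?P, h) \<in> Arr Weil"
    using A f_hom(2) g_hom(2) by (auto simp: Weil_Arr h_def)
  have "compose ?C \<pi> h = f'"
  proof (rule extensionalityI[of _ ?C])
    fix a assume a: "a \<in> ?C"
    show "compose ?C \<pi> h a = f' a"
    proof
      fix V show "compose ?C \<pi> h a V = f' a V"
        using a \<pi>'[OF hc[OF a], of V] fc(1)[OF a] Sn(1) by (auto simp: compose_def h_def weil_carrier)
    qed
  qed (use f_hom in auto)
  then have \<pi>h: "weil_init n \<cdot>\<^bsub>Weil\<^esub> (A, ?P, h) = f" by (simp add: \<pi> f(1))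
  have "compose ?C \<rho> h = g'"
  proof (rule extensionalityI[of _ ?C])
    fix a assume a: "a \<in> ?C"
    show "compose ?C \<rho> h a = g' a"
    proof
      fix V show "compose ?C \<rho> h a V = g' a V"
        using a \<rho>'[OF hc[OF a], of V] fc[OF a] gc[OF a]
        by (auto simp: compose_def h_def weil_carrier weil_W_def weil_basis_pw)
    qed
  qed (use g_hom in auto)
  then have \<rho>h: "weil_proj (Suc n) (Suc n) \<cdot>\<^bsub>Weil\<^esub> (A, ?P, h) = g" by (simp add: \<rho> g(1))
  have eq: "k = h" if k: "(A, ?P, k) \<in> Arr Weil" and k1: "compose ?C \<pi> k = f'" and k2: "compose ?C \<rho> k = g'" for k
  proof (rule extensionalityI[of _ ?C])
    fix a assume a: "a \<in> ?C"
    have ka: "k a \<in> carrier (weil_alg ?P)" using weil_hom_closed[OF k a] .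
    have 1: "\<pi> (k a) = f' a" using a unfolding k1[symmetric] by (simp add: compose_def)
    have 2: "\<rho> (k a) = g' a" using a unfolding k2[symmetric] by (simp add: compose_def)
    show "k a = h a"
    proof
      fix S
      have "f' a S = (if S = {Suc n} then 0 else k a S)" "g' a {1} = k a {Suc n}"
        using \<pi>'[OF ka, of S] \<rho>'[OF ka, of "{1}"] by (simp_all add: 1 2)
      then show "k a S = h a S" using a by (simp add: h_def)
    qed
  qed (use k in \<open>auto simp: h_def Weil_Arr\<close>)
  show "\<exists>!h. h \<in> Hom Weil A ?P \<and> weil_init n \<cdot>\<^bsub>Weil\<^esub> h = f \<and> weil_proj (Suc n) (Suc n) \<cdot>\<^bsub>Weil\<^esub> h = g"
  proof (rule ex1I[of _ "(A, ?P, h)"])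
    show "(A, ?P, h) \<in> Hom Weil A ?P \<and> weil_init n \<cdot>\<^bsub>Weil\<^esub> (A, ?P, h) = f \<and>
        weil_proj (Suc n) (Suc n) \<cdot>\<^bsub>Weil\<^esub> (A, ?P, h) = g"
      unfolding \<pi>h \<rho>h using hA by simp
    fix m assume m: "m \<in> Hom Weil A ?P \<and> weil_init n \<cdot>\<^bsub>Weil\<^esub> m = f \<and> weil_proj (Suc n) (Suc n) \<cdot>\<^bsub>Weil\<^esub> m = g"
    obtain k where k: "m = (A, ?P, k)" using m by (cases m) auto
    have "k = h"
      by (rule eq) (use m in \<open>simp_all add: k \<pi> \<rho> f(1) g(1)\<close>)
    then show "m = (A, ?P, h)" by (simp add: k)
  qed
qed auto


section \<open>Tensor products\<close>

lemma weil_tensor_N_left: "weil_tensor weil_N A = A"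
  by (cases A) (auto simp: weil_tensor_def weil_N_def)

lemma low_high_part_0:
  assumes "0 \<notin> U"
  shows "low_part 0 U = {}" "high_part 0 U = U"
proof -
  have "1 \<le> i" if "i \<in> U" for i using that assms by (cases i) auto
  then show "low_part 0 U = {}" "high_part 0 U = U"
    by (fastforce simp: low_part_def high_part_def)+
qed

text \<open>A monomial of \<open>A \<otimes> B\<close> is a pair of monomials, its variables up to \<open>fst A\<close> and the shifted
  remaining ones.  Here 0 counts as low, so a set containing 0 is determined by its two parts as well,
  although it is not a monomial.\<close>

lemma low_high_eqI: "low_part n U = low_part n V \<Longrightarrow> high_part n U = high_part n V \<Longrightarrow> U = V"
proof -
  assume l: "low_part n U = low_part n V" and h: "high_part n U = high_part n V"
  have "i \<in> U \<longleftrightarrow> i \<in> V" for i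
  proof (cases "i \<le> n")
    case True
    then show ?thesis using l by (auto simp: low_part_def)
  next
    case False
    then have "i - n \<in> high_part n U \<longleftrightarrow> i - n \<in> high_part n V" using h by simp
    then show ?thesis using False by (auto simp: high_part_def)
  qed
  then show ?thesis by blast
qed

lemma weil_basis_tensor:
  assumes A: "A \<in> Obj Weil" and B: "B \<in> Obj Weil"
  shows "U \<in> weil_basis (weil_tensor A B) \<longleftrightarrow>
    low_part (fst A) U \<in> weil_basis A \<and> high_part (fst A) U \<in> weil_basis B \<and> 0 \<notin> U"
    (is "?L \<longleftrightarrow> ?R")
proof
  have Ar: "\<And>i j. (i, j) \<in> snd A \<Longrightarrow> i \<le> fst A \<and> j \<le> fst A" using A by (auto simp: Weil_Obj equiv_def)
  have Br: "\<And>i j. (i, j) \<in> snd B \<Longrightarrow> 1 \<le> i \<and> 1 \<le> j" using B by (auto simp: Weil_Obj equiv_def)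
  {
    assume L: ?L
    then have 1: "U \<subseteq> {1..fst A + fst B}"
      and 2: "\<And>i j. i \<in> U \<Longrightarrow> j \<in> U \<Longrightarrow> (i, j) \<in> snd A \<Longrightarrow> i = j"
      and 3: "\<And>i j. i + fst A \<in> U \<Longrightarrow> j + fst A \<in> U \<Longrightarrow> (i, j) \<in> snd B \<Longrightarrow> i = j"
      by (fastforce simp: weil_basis_def weil_tensor_def)+
    show ?R
      using 1 2 3 by (fastforce simp: weil_basis_def low_part_def high_part_def)
  }
  assume R: ?R
  have 1: "low_part (fst A) U \<subseteq> {1..fst A}" "high_part (fst A) U \<subseteq> {1..fst B}"
    "\<And>i j. i \<in> U \<Longrightarrow> j \<in> U \<Longrightarrow> i \<le> fst A \<Longrightarrow> j \<le> fst A \<Longrightarrow> (i, j) \<in> snd A \<Longrightarrow> i = j"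
    "\<And>i j. i + fst A \<in> U \<Longrightarrow> j + fst A \<in> U \<Longrightarrow> 1 \<le> i \<Longrightarrow> 1 \<le> j \<Longrightarrow> (i, j) \<in> snd B \<Longrightarrow> i = j"
    using R by (auto simp: weil_basis_def low_part_def high_part_def)
  have "1 \<le> i \<and> i \<le> fst A + fst B" if i: "i \<in> U" for i
  proof (cases "i \<le> fst A")
    case True
    then have "i \<in> low_part (fst A) U" using i by (simp add: low_part_def)
    then show ?thesis using 1(1) by auto
  next
    case False
    then have "i - fst A \<in> high_part (fst A) U" using i by (simp add: high_part_def)
    then show ?thesis using 1(2) by force
  qed
  then show ?L
    using 1(3,4) Ar Br by (fastforce simp: weil_basis_def weil_tensor_def)
qed

lemma weil_tensor_Obj [simp]:
  assumes A: "A \<in> Obj Weil" and B: "B \<in> Obj Weil"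
  shows "weil_tensor A B \<in> Obj Weil"
  unfolding Weil_Obj
proof (rule equivI)
  let ?s = "\<lambda>(i, j). (i + fst A, j + fst A)"
  have Ar: "\<And>i j. (i, j) \<in> snd A \<Longrightarrow> 1 \<le> i \<and> i \<le> fst A \<and> 1 \<le> j \<and> j \<le> fst A" using A by (auto simp: Weil_Obj equiv_def)
  have Br: "\<And>i j. (i, j) \<in> snd B \<Longrightarrow> 1 \<le> i \<and> i \<le> fst B \<and> 1 \<le> j \<and> j \<le> fst B" using B by (auto simp: Weil_Obj equiv_def)
  show "snd (weil_tensor A B) \<subseteq> {1..fst (weil_tensor A B)} \<times> {1..fst (weil_tensor A B)}"
    using Ar Br by (fastforce simp: weil_tensor_def)
  show "refl_on {1..fst (weil_tensor A B)} (snd (weil_tensor A B))"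
  proof (rule refl_onI)
    fix i assume i: "i \<in> {1..fst (weil_tensor A B)}"
    show "(i, i) \<in> snd (weil_tensor A B)"
    proof (cases "i \<le> fst A")
      case True
      then show ?thesis using i A by (auto simp: weil_tensor_def Weil_Obj equiv_def refl_on_def)
    next
      case False
      then have "i - fst A \<in> {1..fst B}" using i by (auto simp: weil_tensor_def)
      then have "(i - fst A, i - fst A) \<in> snd B" using B by (auto simp: Weil_Obj equiv_def refl_on_def)
      then have "?s (i - fst A, i - fst A) \<in> snd (weil_tensor A B)" by (auto simp: weil_tensor_def)
      then show ?thesis using False by simp
    qed
  qed
  show "sym (snd (weil_tensor A B))"
  proof (rule symI)
    fix x y assume "(x, y) \<in> snd (weil_tensor A B)"
    then consider "(x, y) \<in> snd A" | x' y' where "(x', y') \<in> snd B" "x = x' + fst A" "y = y' + fst A"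
      by (auto simp: weil_tensor_def)
    then show "(y, x) \<in> snd (weil_tensor A B)"
    proof cases
      case 1
      then have "(y, x) \<in> snd A" using A by (auto simp: Weil_Obj equiv_def intro: symD)
      then show ?thesis by (simp add: weil_tensor_def)
    next
      case 2
      then have "(y', x') \<in> snd B" using B by (auto simp: Weil_Obj equiv_def intro: symD)
      then show ?thesis using 2 by (force simp: weil_tensor_def)
    qed
  qed
  have tA: "trans (snd A)" and tB: "trans (snd B)" using A B by (auto simp: Weil_Obj equiv_def)
  show "trans (snd (weil_tensor A B))"
  proof (rule transI)
    fix x y z assume xy: "(x, y) \<in> snd (weil_tensor A B)" and yz: "(y, z) \<in> snd (weil_tensor A B)"
    show "(x, z) \<in> snd (weil_tensor A B)"
    proof (cases "y \<le> fst A")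
      case True
      then have "(x, y) \<in> snd A" "(y, z) \<in> snd A"
        using xy yz Br by (fastforce simp: weil_tensor_def)+
      then have "(x, z) \<in> snd A" using transD[OF tA] by blast
      then show ?thesis by (simp add: weil_tensor_def)
    next
      case False
      then obtain x' y' z' where "x = x' + fst A" "y = y' + fst A" "z = z' + fst A" "(x', y') \<in> snd B" "(y', z') \<in> snd B"
        using xy yz Ar by (fastforce simp: weil_tensor_def)
      then have "(x', z') \<in> snd B" "x = x' + fst A" "z = z' + fst A" using transD[OF tB] by blast+
      then show ?thesis by (force simp: weil_tensor_def)
    qed
  qed
qed

lemma weil_dim_N [simp]: "weil_dim weil_N = 1"
  by (simp add: weil_dim_def)

lemma weil_dim_pw [simp]: "weil_dim (weil_pw n) = Suc n"
  unfolding weil_dim_def weil_basis_pw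
  by (subst card_insert_disjoint) (auto simp: card_image)

lemma weil_dim_tensor:
  assumes A: "A \<in> Obj Weil" and B: "B \<in> Obj Weil"
  shows "weil_dim (weil_tensor A B) = weil_dim A * weil_dim B"
proof -
  let ?j = "\<lambda>(P, Q). P \<union> (\<lambda>i. i + fst A) ` Q"
  have lh: "low_part (fst A) (?j (P, Q)) = P" "high_part (fst A) (?j (P, Q)) = Q" "0 \<notin> ?j (P, Q)"
    if "P \<in> weil_basis A" "Q \<in> weil_basis B" for P Q
  proof -
    have "P \<subseteq> {1..fst A}" "Q \<subseteq> {1..fst B}" using that by (auto simp: weil_basis_def)
    then show "low_part (fst A) (?j (P, Q)) = P" "high_part (fst A) (?j (P, Q)) = Q" "0 \<notin> ?j (P, Q)"
      by (fastforce simp: low_part_def high_part_def)+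
  qed
  have "bij_betw (\<lambda>U. (low_part (fst A) U, high_part (fst A) U)) (weil_basis (weil_tensor A B))
      (weil_basis A \<times> weil_basis B)"
  proof (rule bij_betw_byWitness[where f' = ?j])
    show "\<forall>U\<in>weil_basis (weil_tensor A B). ?j (low_part (fst A) U, high_part (fst A) U) = U"
    proof
      fix U assume "U \<in> weil_basis (weil_tensor A B)"
      then have U: "low_part (fst A) U \<in> weil_basis A" "high_part (fst A) U \<in> weil_basis B"
        by (simp_all add: weil_basis_tensor[OF A B])
      show "?j (low_part (fst A) U, high_part (fst A) U) = U"
        by (rule low_high_eqI[OF lh(1)[OF U] lh(2)[OF U]])
    qed
    show "\<forall>p\<in>weil_basis A \<times> weil_basis B. (low_part (fst A) (?j p), high_part (fst A) (?j p)) = p"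
      using lh by auto
    show "(\<lambda>U. (low_part (fst A) U, high_part (fst A) U)) ` weil_basis (weil_tensor A B) \<subseteq> weil_basis A \<times> weil_basis B"
      by (auto simp: weil_basis_tensor[OF A B])
    show "?j ` (weil_basis A \<times> weil_basis B) \<subseteq> weil_basis (weil_tensor A B)"
      using lh by (auto simp: weil_basis_tensor[OF A B])
  qed
  from bij_betw_same_card[OF this] show ?thesis
    by (simp add: weil_dim_def card_cartesian_product)
qed

text \<open>Tensoring with \<open>\<nat>\<close> is strictly the identity, which turns the axiom on products
  \<open>A \<otimes> (B \<times> C)\<close> into a statement about \<open>B \<times> C\<close> for \<open>A = \<nat>\<close>.\<close>

lemma weil_tensor_arr_N:
  assumes "\<theta> \<in> Arr Weil"
  shows "weil_tensor_arr (Id Weil weil_N) \<theta> = \<theta>"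
proof -
  obtain A B h where \<theta>: "\<theta> = (A, B, h)" by (cases \<theta>)
  let ?g = "\<lambda>U V. (\<lambda>a\<in>carrier (weil_alg weil_N). a) (weil_mon (low_part (fst weil_N) U)) (low_part (fst weil_N) V) *
           h (weil_mon (high_part (fst weil_N) U)) (high_part (fst weil_N) V)"
  have "weil_tensor_arr (Id Weil weil_N) \<theta> = weil_lin A B ?g"
    by (simp only: \<theta> weil_tensor_arr_def Weil_sel prod.case weil_tensor_N_left)
  also have "\<dots> = \<theta>"
  proof (rule Weil_Arr_eqI)
    fix U V assume U: "U \<in> weil_basis A"
    then have "0 \<notin> U" by (auto simp: weil_basis_def)
    then have U0: "low_part (fst weil_N) U = {}" "high_part (fst weil_N) U = U"
      by (simp_all add: weil_N_def low_high_part_0)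
    have hU: "h (weil_mon U) \<in> carrier (weil_alg B)"
      using U assms weil_hom_closed[of A B h] by (simp add: \<theta>)
    show "?g U V = snd (snd \<theta>) (weil_mon U) V"
    proof (cases "0 \<in> V")
      case True
      then have "V \<notin> weil_basis B" "low_part (fst weil_N) V \<noteq> {}"
        by (auto simp: weil_basis_def low_part_def)
      then show ?thesis using hU by (simp add: U0 weil_carrier \<theta>, simp add: weil_mon_def)
    next
      case False
      then have "low_part (fst weil_N) V = {}" "high_part (fst weil_N) V = V"
        by (simp_all add: weil_N_def low_high_part_0)
      then show ?thesis by (simp add: U0 \<theta>)
    qed
  qed (use assms in \<open>auto simp: \<theta>\<close>)
  finally show ?thesis .
qed

lemma weil_tensor_arr_Id:
  assumes "A \<in> Obj Weil" "B \<in> Obj Weil"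
  shows "weil_tensor_arr (Id Weil A) (Id Weil B) = Id Weil (weil_tensor A B)"
proof -
  have AB: "A \<in> Obj Weil" "B \<in> Obj Weil" using assms by auto
  have I: "Id Weil (weil_tensor A B) \<in> Arr Weil" using AB by (intro Weil.Id_Arr) simp
  show ?thesis
    unfolding weil_tensor_arr_def Weil_sel prod.case
  proof (rule Weil_Arr_eqI)
    fix U V assume U: "U \<in> weil_basis (weil_tensor A B)"
    then have "low_part (fst A) U \<in> weil_basis A" "high_part (fst A) U \<in> weil_basis B"
      by (simp_all add: weil_basis_tensor[OF AB])
    moreover have "weil_mon (low_part (fst A) U) (low_part (fst A) V) *
        weil_mon (high_part (fst A) U) (high_part (fst A) V) = weil_mon U V"
    proof (cases "U = V")
      case False
      then have "low_part (fst A) U \<noteq> low_part (fst A) V \<or> high_part (fst A) U \<noteq> high_part (fst A) V"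
        using low_high_eqI by blast
      then show ?thesis using False by (auto simp: weil_mon_def)
    qed simp
    ultimately show "(\<lambda>a\<in>carrier (weil_alg A). a) (weil_mon (low_part (fst A) U)) (low_part (fst A) V) *
           (\<lambda>a\<in>carrier (weil_alg B). a) (weil_mon (high_part (fst A) U)) (high_part (fst A) V) =
       snd (snd (weil_tensor A B, weil_tensor A B, \<lambda>a\<in>carrier (weil_alg (weil_tensor A B)). a)) (weil_mon U) V"
      using U by simp
  qed (use I in auto)
qed

lemma weil_tensors_Obj [simp]: "weil_tensors ns \<in> Obj Weil"
  by (induction ns) (auto simp: weil_tensors_def)

lemma weil_tensors_simps [simp]:
  "weil_tensors [] = weil_N" "weil_tensors (n # ns) = weil_tensor (weil_pw n) (weil_tensors ns)"
  by (simp_all add: weil_tensors_def)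

lemma fst_weil_tensors: "fst (weil_tensors (map length bs)) = length (concat bs)"
  by (induction bs) (auto simp: weil_tensor_def weil_N_def weil_pw_def)

text \<open>In \<open>W\<^bsup>k\<^sub>1\<^esup> \<otimes> \<dots> \<otimes> W\<^bsup>k\<^sub>r\<^esup>\<close> variables are related within a tensor factor only.  Positions in a list
  start at 0 and variables at 1, whence the successors.\<close>

lemma weil_tensors_rel:
  assumes "distinct (concat bs)" "i < length (concat bs)" "j < length (concat bs)"
  shows "(Suc i, Suc j) \<in> snd (weil_tensors (map length bs)) \<longleftrightarrow>
    (\<exists>b\<in>set bs. concat bs ! i \<in> set b \<and> concat bs ! j \<in> set b)"
  using assms
proof (induction bs arbitrary: i j)
  case (Cons b bs)
  let ?R = "snd (weil_tensors (map length bs))" and ?l = "length b"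
  have R: "\<And>i j. (i, j) \<in> ?R \<Longrightarrow> 1 \<le> i \<and> 1 \<le> j"
    using weil_tensors_Obj[of "map length bs"] by (auto simp: Weil_Obj equiv_def)
  have rel: "(Suc i, Suc j) \<in> snd (weil_tensors (map length (b # bs))) \<longleftrightarrow>
      (if i < ?l then j < ?l else ?l \<le> j \<and> (Suc (i - ?l), Suc (j - ?l)) \<in> ?R)"
  proof -
    have "(Suc i, Suc j) \<in> (\<lambda>(i, j). (i + ?l, j + ?l)) ` ?R \<longleftrightarrow>
       ?l \<le> i \<and> ?l \<le> j \<and> (Suc (i - ?l), Suc (j - ?l)) \<in> ?R"
    proof
      assume "(Suc i, Suc j) \<in> (\<lambda>(i, j). (i + ?l, j + ?l)) ` ?R"
      then obtain i' j' where "(i', j') \<in> ?R" "Suc i = i' + ?l" "Suc j = j' + ?l" by auto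
      moreover from this(1) have "1 \<le> i'" "1 \<le> j'" using R by auto
      ultimately show "?l \<le> i \<and> ?l \<le> j \<and> (Suc (i - ?l), Suc (j - ?l)) \<in> ?R"
        by (metis Suc_diff_le Suc_leI add_diff_cancel_right' add_leE le_add2 less_Suc_eq_le add_le_mono1 plus_1_eq_Suc Suc_le_mono)
    next
      assume "?l \<le> i \<and> ?l \<le> j \<and> (Suc (i - ?l), Suc (j - ?l)) \<in> ?R"
      then show "(Suc i, Suc j) \<in> (\<lambda>(i, j). (i + ?l, j + ?l)) ` ?R"
        by (intro image_eqI[of _ _ "(Suc (i - ?l), Suc (j - ?l))"]) auto
    qed
    then show ?thesis by (auto simp: weil_tensor_def weil_pw_def)
  qed
  have d: "set b \<inter> set (concat bs) = {}" using Cons.prems(1) by simp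
  have nth: "concat (b # bs) ! k \<in> set b \<longleftrightarrow> k < ?l" if "k < length (concat (b # bs))" for k
  proof (cases "k < ?l")
    case False
    then have "concat (b # bs) ! k \<in> set (concat bs)"
      using that nth_mem[of "k - ?l" "concat bs"] by (simp add: nth_append)
    then show ?thesis using d False by blast
  qed (simp add: nth_append)
  have nth': "c \<in> set bs \<Longrightarrow> concat (b # bs) ! k \<in> set c \<Longrightarrow> \<not> k < ?l"
    if "k < length (concat (b # bs))" for k c
    using d nth[OF that] by auto
  show ?case
  proof (cases "i < ?l \<or> j < ?l")
    case True
    then show ?thesis using rel nth[OF Cons.prems(2)] nth[OF Cons.prems(3)]
        nth'[OF Cons.prems(2)] nth'[OF Cons.prems(3)] by auto
  next
    case False
    have "(Suc (i - ?l), Suc (j - ?l)) \<in> ?R \<longleftrightarrow>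
       (\<exists>c\<in>set bs. concat bs ! (i - ?l) \<in> set c \<and> concat bs ! (j - ?l) \<in> set c)"
      using Cons.prems False by (intro Cons.IH) auto
    then show ?thesis using rel nth[OF Cons.prems(2)] False by (auto simp: nth_append)
  qed
qed simp

text \<open>An injective renaming that preserves and reflects the relation preserves and reflects disjointness
  of monomials and whether their union is a monomial, so it is multiplicative.\<close>

lemma weil_rename_Arr:
  assumes A: "A \<in> Obj Weil" and B: "B \<in> Obj Weil"
    and inj: "inj_on \<sigma> {1..fst A}" and im: "\<sigma> ` {1..fst A} \<subseteq> {1..fst B}"
    and rel: "\<And>i j. i \<in> {1..fst A} \<Longrightarrow> j \<in> {1..fst A} \<Longrightarrow> (i, j) \<in> snd A \<longleftrightarrow> (\<sigma> i, \<sigma> j) \<in> snd B"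
  shows "weil_lin A B (\<lambda>U. weil_mon (\<sigma> ` U)) \<in> Arr Weil"
proof (rule weil_lin_Arr[OF A B])
  have b: "\<sigma> ` U \<in> weil_basis B \<longleftrightarrow> U \<in> weil_basis A" if "U \<subseteq> {1..fst A}" for U
  proof -
    have s: "\<sigma> ` U \<subseteq> {1..fst B}" by (rule order_trans[OF image_mono[OF that] im])
    have e: "\<sigma> i = \<sigma> j \<longleftrightarrow> i = j" "(i, j) \<in> snd A \<longleftrightarrow> (\<sigma> i, \<sigma> j) \<in> snd B" if "i \<in> U" "j \<in> U" for i j
    proof -
      have ij: "i \<in> {1..fst A}" "j \<in> {1..fst A}" using that \<open>U \<subseteq> _\<close> by blast+
      show "\<sigma> i = \<sigma> j \<longleftrightarrow> i = j" by (rule inj_on_eq_iff[OF inj ij])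
      show "(i, j) \<in> snd A \<longleftrightarrow> (\<sigma> i, \<sigma> j) \<in> snd B" by (rule rel[OF ij])
    qed
    have "\<sigma> ` U \<in> weil_basis B \<longleftrightarrow> (\<forall>i\<in>U. \<forall>j\<in>U. (\<sigma> i, \<sigma> j) \<in> snd B \<longrightarrow> \<sigma> i = \<sigma> j)"
      using s unfolding weil_basis_def by blast
    also have "\<dots> \<longleftrightarrow> (\<forall>i\<in>U. \<forall>j\<in>U. (i, j) \<in> snd A \<longrightarrow> i = j)"
      by (simp add: e)
    also have "\<dots> \<longleftrightarrow> U \<in> weil_basis A"
      using that unfolding weil_basis_def by blast
    finally show ?thesis .
  qed
  fix U V assume U: "U \<in> weil_basis A" and V: "V \<in> weil_basis A"
  have UV: "U \<subseteq> {1..fst A}" "V \<subseteq> {1..fst A}" using U V by (auto simp: weil_basis_def)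
  show "weil_mon (\<sigma> ` U) \<in> carrier (weil_alg B)" using b[OF UV(1)] U by simp
  have "\<sigma> ` U \<inter> \<sigma> ` V = {} \<longleftrightarrow> U \<inter> V = {}"
    using inj_on_image_Int[OF inj UV] by (metis image_is_empty)
  moreover have "\<sigma> ` U \<union> \<sigma> ` V \<in> weil_basis B \<longleftrightarrow> U \<union> V \<in> weil_basis A"
    using b[of "U \<union> V"] UV by (simp add: image_Un)
  ultimately show "weil_mon (\<sigma> ` U) \<otimes>\<^bsub>weil_alg B\<^esub> weil_mon (\<sigma> ` V) =
     (if U \<inter> V = {} \<and> U \<union> V \<in> weil_basis A then weil_mon (\<sigma> ` (U \<union> V)) else (\<lambda>S. 0))"
    by (simp add: weil_mon_mult image_Un)
qed simp

text \<open>The blocks are the equivalence classes, each listed once because only the least element of a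
  class gives rise to a block.\<close>

lemma weil_blocks:
  assumes A: "A \<in> Obj Weil"
  shows weil_blocks_class: "b \<in> set (weil_blocks A) \<Longrightarrow> i \<in> set b \<Longrightarrow> set b = snd A `` {i}"
    and distinct_weil_vars: "distinct (weil_vars A)"
    and set_weil_vars: "set (weil_vars A) = {1..fst A}"
proof -
  let ?R = "snd A" and ?n = "fst A"
  define m where "m = filter (\<lambda>i. \<forall>j. (i, j) \<in> ?R \<longrightarrow> i \<le> j) [1..<Suc ?n]"
  have sub: "?R `` {i} \<subseteq> {1..?n}" for i using A by (auto simp: Weil_Obj equiv_def)
  have fin: "finite (?R `` {i})" for i using sub finite_subset by blast
  have sy: "(i, j) \<in> ?R \<Longrightarrow> (j, i) \<in> ?R" for i j using A by (auto simp: Weil_Obj equiv_def sym_def)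
  have tr: "(i, j) \<in> ?R \<Longrightarrow> (j, k) \<in> ?R \<Longrightarrow> (i, k) \<in> ?R" for i j k
    using A by (auto simp: Weil_Obj equiv_def intro: transD)
  have bl: "weil_blocks A = map (\<lambda>i. sorted_list_of_set (?R `` {i})) m"
    by (simp add: weil_blocks_def m_def)
  show "set b = ?R `` {i}" if b: "b \<in> set (weil_blocks A)" and i: "i \<in> set b"
  proof -
    obtain r where "b = sorted_list_of_set (?R `` {r})" using b by (auto simp: bl)
    then have r: "set b = ?R `` {r}" using fin by simp
    then have "(r, i) \<in> ?R" using i by blast
    then show ?thesis using equiv_class_eq[OF A[unfolded Weil_Obj]] r by blast
  qed
  have "distinct (concat (map (\<lambda>i. sorted_list_of_set (?R `` {i})) m'))" if "distinct m'" "set m' \<subseteq> set m" for m'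
    using that
  proof (induction m')
    case (Cons i m')
    have "?R `` {i} \<inter> ?R `` {j} = {}" if "j \<in> set m'" for j
    proof (rule ccontr)
      assume "?R `` {i} \<inter> ?R `` {j} \<noteq> {}"
      then have ij: "(i, j) \<in> ?R" using sy tr by blast
      have "i \<le> j" "j \<le> i" using Cons.prems(2) that ij sy[OF ij] by (auto simp: m_def)
      then show False using that Cons.prems(1) by simp
    qed
    then show ?case using Cons fin by auto
  qed simp
  then show "distinct (weil_vars A)" by (simp add: weil_vars_def bl m_def)
  have "i \<in> set (weil_vars A)" if i: "i \<in> {1..?n}" for i
  proof -
    have ii: "(i, i) \<in> ?R" using i A by (auto simp: Weil_Obj equiv_def refl_on_def)
    define l where "l = (LEAST j. (i, j) \<in> ?R)"
    have l: "(i, l) \<in> ?R" unfolding l_def by (rule LeastI[of _ i]) (rule ii)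
    have "l \<le> j" if "(l, j) \<in> ?R" for j
      unfolding l_def by (rule Least_le) (rule tr[OF l that])
    then have "l \<in> set m" using sub[of i] l by (auto simp: m_def)
    moreover have "i \<in> ?R `` {l}" using sy[OF l] by simp
    ultimately show ?thesis using fin by (auto simp: weil_vars_def bl)
  qed
  then show "set (weil_vars A) = {1..?n}"
    using sub fin by (auto simp: weil_vars_def bl)
qed

lemma weil_from_tensors_sel [simp]: "Dom Weil (weil_from_tensors A) = weil_tensors (weil_sizes A)"
   "Cod Weil (weil_from_tensors A) = A"
  by (simp_all add: weil_from_tensors_def)

lemma weil_from_tensors_Arr [simp]:
  assumes "A \<in> Obj Weil"
  shows "weil_from_tensors A \<in> Arr Weil"
proof -
  have A: "A \<in> Obj Weil" using assms by simp
  note vars = distinct_weil_vars[OF A] set_weil_vars[OF A]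
  let ?v = "weil_vars A" and ?\<sigma> = "\<lambda>i. weil_vars A ! (i - 1)" and ?T = "weil_tensors (weil_sizes A)"
  have T: "fst ?T = length ?v" by (simp add: weil_sizes_def weil_vars_def fst_weil_tensors)
  have lt: "i - 1 < length ?v" if "i \<in> {1..fst ?T}" for i using that T by auto
  show ?thesis
    unfolding weil_from_tensors_def
  proof (rule weil_rename_Arr[OF _ A])
    show "inj_on ?\<sigma> {1..fst ?T}"
    proof (rule inj_onI)
      fix i j assume ij: "i \<in> {1..fst ?T}" "j \<in> {1..fst ?T}" and "?\<sigma> i = ?\<sigma> j"
      then have "i - 1 = j - 1" using vars(1) lt nth_eq_iff_index_eq by blast
      then show "i = j" using ij by auto
    qed
    show "?\<sigma> ` {1..fst ?T} \<subseteq> {1..fst A}" using lt vars(2) nth_mem by blast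
    fix i j assume i: "i \<in> {1..fst ?T}" and j: "j \<in> {1..fst ?T}"
    have "(Suc (i - 1), Suc (j - 1)) \<in> snd ?T \<longleftrightarrow> (\<exists>b\<in>set (weil_blocks A). ?\<sigma> i \<in> set b \<and> ?\<sigma> j \<in> set b)"
      unfolding weil_sizes_def weil_vars_def
      by (rule weil_tensors_rel) (use vars(1) lt i j in \<open>auto simp: weil_vars_def\<close>)
    also have "\<dots> \<longleftrightarrow> (?\<sigma> i, ?\<sigma> j) \<in> snd A"
    proof
      assume "\<exists>b\<in>set (weil_blocks A). ?\<sigma> i \<in> set b \<and> ?\<sigma> j \<in> set b"
      then obtain b where "b \<in> set (weil_blocks A)" "?\<sigma> i \<in> set b" "?\<sigma> j \<in> set b" by blast
      then show "(?\<sigma> i, ?\<sigma> j) \<in> snd A" using weil_blocks_class[OF A] by blast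
    next
      assume r: "(?\<sigma> i, ?\<sigma> j) \<in> snd A"
      have "?\<sigma> i \<in> set (concat (weil_blocks A))"
        using lt[OF i] nth_mem by (simp add: weil_vars_def[symmetric])
      then obtain b where b: "b \<in> set (weil_blocks A)" "?\<sigma> i \<in> set b" by auto
      then have "?\<sigma> j \<in> set b" using weil_blocks_class[OF A b] r by simp
      then show "\<exists>b\<in>set (weil_blocks A). ?\<sigma> i \<in> set b \<and> ?\<sigma> j \<in> set b" using b by blast
    qed
    finally show "(i, j) \<in> snd ?T \<longleftrightarrow> (?\<sigma> i, ?\<sigma> j) \<in> snd A" using i j by simp
  qed simp
qed

(* From here on composites and identities of Weil are treated abstractly. *)
declare Weil_sel(3,4) [simp del]


section \<open>Tangent actegories\<close>

locale actegory = cat_loc X for X :: "('o, 'a, 'z) actegory_scheme" (structure) +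
  assumes tangent_actegory: "tangent_actegory X"
begin

lemma weil_actegory: "weil_actegory X"
  using tangent_actegory by (simp add: tangent_actegory_def)

lemma act_functor: "is_functor (prod_cat Weil X) X (\<lambda>(A, x). act X A x) (\<lambda>(\<theta>, f). actm X \<theta> f)"
  using weil_actegory by (simp add: weil_actegory_def)

lemma act_Obj [simp]: "A \<in> Obj Weil \<Longrightarrow> x \<in> Obj X \<Longrightarrow> act X A x \<in> Obj X"
  using act_functor by (auto simp: is_functor_def prod_cat_def)

lemma actm:
  assumes "\<theta> \<in> Arr Weil" "f \<in> Arr X"
  shows actm_Arr [simp]: "actm X \<theta> f \<in> Arr X"
    and Dom_actm [simp]: "Dom X (actm X \<theta> f) = act X (Dom Weil \<theta>) (Dom X f)"
    and Cod_actm [simp]: "Cod X (actm X \<theta> f) = act X (Cod Weil \<theta>) (Cod X f)"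
proof -
  have "\<forall>f\<in>Arr (prod_cat Weil X). (case f of (\<theta>, f) \<Rightarrow> actm X \<theta> f) \<in>
      Hom X (case Dom (prod_cat Weil X) f of (A, x) \<Rightarrow> act X A x) (case Cod (prod_cat Weil X) f of (A, x) \<Rightarrow> act X A x)"
    using act_functor unfolding is_functor_def by blast
  from this[rule_format, of "(\<theta>, f)"] assms
  show "actm X \<theta> f \<in> Arr X" "Dom X (actm X \<theta> f) = act X (Dom Weil \<theta>) (Dom X f)"
    "Cod X (actm X \<theta> f) = act X (Cod Weil \<theta>) (Cod X f)"
    by (auto simp: prod_cat_def)
qed

lemma actm_Id [simp]:
  assumes "A \<in> Obj Weil" "x \<in> Obj X"
  shows "actm X (Id Weil A) (Id X x) = Id X (act X A x)"
proof -
  have "\<forall>y\<in>Obj (prod_cat Weil X). (case Id (prod_cat Weil X) y of (\<theta>, f) \<Rightarrow> actm X \<theta> f) =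
      Id X (case y of (A, x) \<Rightarrow> act X A x)"
    using act_functor unfolding is_functor_def by blast
  from this[rule_format, of "(A, x)"] assms show ?thesis
    by (auto simp: prod_cat_def)
qed

lemma actm_Cmp:
  assumes "\<theta> \<in> Arr Weil" "f \<in> Arr X" "\<theta>' \<in> Arr Weil" "f' \<in> Arr X"
    "Dom Weil \<theta>' = Cod Weil \<theta>" "Dom X f' = Cod X f"
  shows "actm X (\<theta>' \<cdot>\<^bsub>Weil\<^esub> \<theta>) (f' \<cdot> f) = actm X \<theta>' f' \<cdot> actm X \<theta> f"
proof -
  have "\<forall>f\<in>Arr (prod_cat Weil X). \<forall>g\<in>Arr (prod_cat Weil X). Dom (prod_cat Weil X) g = Cod (prod_cat Weil X) f \<longrightarrow>
      (case g \<cdot>\<^bsub>prod_cat Weil X\<^esub> f of (\<theta>, f) \<Rightarrow> actm X \<theta> f) =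
      (case g of (\<theta>, f) \<Rightarrow> actm X \<theta> f) \<cdot> (case f of (\<theta>, f) \<Rightarrow> actm X \<theta> f)"
    using act_functor unfolding is_functor_def by blast
  from this[rule_format, of "(\<theta>, f)" "(\<theta>', f')"] assms show ?thesis
    by (auto simp: prod_cat_def)
qed

lemma actA:
  assumes "A \<in> Obj Weil" "f \<in> Arr X"
  shows actA_Arr [simp]: "actA X A f \<in> Arr X"
    and Dom_actA [simp]: "Dom X (actA X A f) = act X A (Dom X f)"
    and Cod_actA [simp]: "Cod X (actA X A f) = act X A (Cod X f)"
  using assms by (simp_all add: actA_def)

lemma actA_Id [simp]: "A \<in> Obj Weil \<Longrightarrow> x \<in> Obj X \<Longrightarrow> actA X A (Id X x) = Id X (act X A x)"
  by (simp add: actA_def)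

lemma actA_Cmp:
  assumes "A \<in> Obj Weil" "f \<in> Arr X" "g \<in> Arr X" "Dom X g = Cod X f"
  shows "actA X A (g \<cdot> f) = actA X A g \<cdot> actA X A f"
  using actm_Cmp[of "Id Weil A" f "Id Weil A" g] assms by (simp add: actA_def)

lemma actT:
  assumes "\<theta> \<in> Arr Weil" "x \<in> Obj X"
  shows actT_Arr [simp]: "actT X \<theta> x \<in> Arr X"
    and Dom_actT [simp]: "Dom X (actT X \<theta> x) = act X (Dom Weil \<theta>) x"
    and Cod_actT [simp]: "Cod X (actT X \<theta> x) = act X (Cod Weil \<theta>) x"
  using assms by (simp_all add: actT_def)

lemma actT_Cmp:
  assumes "\<theta> \<in> Arr Weil" "\<theta>' \<in> Arr Weil" "Dom Weil \<theta>' = Cod Weil \<theta>" "x \<in> Obj X"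
  shows "actT X (\<theta>' \<cdot>\<^bsub>Weil\<^esub> \<theta>) x = actT X \<theta>' x \<cdot> actT X \<theta> x"
  using actm_Cmp[of \<theta> "Id X x" \<theta>' "Id X x"] assms by (simp add: actT_def)

lemma actT_natural:
  assumes "\<theta> \<in> Arr Weil" "f \<in> Arr X" "Dom Weil \<theta> = A" "Cod Weil \<theta> = B" "Dom X f = x" "Cod X f = y"
  shows "actA X B f \<cdot> actT X \<theta> x = actT X \<theta> y \<cdot> actA X A f"
  using actm_Cmp[of \<theta> "Id X x" "Id Weil B" f] actm_Cmp[of "Id Weil A" f \<theta> "Id X y"] assms
  by (auto simp: actA_def actT_def)

lemma aunit:
  assumes "x \<in> Obj X"
  shows aunit_Arr [simp]: "aunit X x \<in> Arr X" and Dom_aunit [simp]: "Dom X (aunit X x) = x"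
    and Cod_aunit [simp]: "Cod X (aunit X x) = act X weil_N x" and iso_aunit: "is_iso X (aunit X x)"
  using weil_actegory assms by (auto simp: weil_actegory_def)

lemma aunit_natural: "f \<in> Arr X \<Longrightarrow> aunit X (Cod X f) \<cdot> f = actA X weil_N f \<cdot> aunit X (Dom X f)"
  using weil_actegory by (auto simp: weil_actegory_def)

lemma amult:
  assumes "A \<in> Obj Weil" "B \<in> Obj Weil" "x \<in> Obj X"
  shows amult_Arr [simp]: "amult X A B x \<in> Arr X"
    and Dom_amult [simp]: "Dom X (amult X A B x) = act X A (act X B x)"
    and Cod_amult [simp]: "Cod X (amult X A B x) = act X (weil_tensor A B) x"
  using weil_actegory assms by (auto simp: weil_actegory_def)

lemma amult_natural:
  assumes "A \<in> Obj Weil" "B \<in> Obj Weil" "f \<in> Arr X" "Dom X f = x" "Cod X f = y"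
  shows "amult X A B y \<cdot> actA X A (actA X B f) = actA X (weil_tensor A B) f \<cdot> amult X A B x"
proof -
  have "\<forall>\<theta>\<in>Arr Weil. \<forall>\<theta>'\<in>Arr Weil. \<forall>f\<in>Arr X.
        amult X (Cod Weil \<theta>) (Cod Weil \<theta>') (Cod X f) \<cdot> actm X \<theta> (actm X \<theta>' f) =
        actm X (weil_tensor_arr \<theta> \<theta>') f \<cdot> amult X (Dom Weil \<theta>) (Dom Weil \<theta>') (Dom X f)"
    using weil_actegory unfolding weil_actegory_def by blast
  from this[rule_format, of "Id Weil A" "Id Weil B" f] assms show ?thesis
    by (simp add: actA_def weil_tensor_arr_Id)
qed

lemma inv_aunit:
  assumes "x \<in> Obj X"
  shows inv_aunit_Arr [simp]: "inv_arr X (aunit X x) \<in> Arr X"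
    and Dom_inv_aunit [simp]: "Dom X (inv_arr X (aunit X x)) = act X weil_N x"
    and Cod_inv_aunit [simp]: "Cod X (inv_arr X (aunit X x)) = x"
    and inv_aunit_left [simp]: "inv_arr X (aunit X x) \<cdot> aunit X x = Id X x"
    and inv_aunit_right [simp]: "aunit X x \<cdot> inv_arr X (aunit X x) = Id X (act X weil_N x)"
  using inv_arr[OF iso_aunit[OF assms]] assms by auto

lemmas inv_aunit_reassoc [simp] = Cmp_reassoc[OF inv_aunit_left] Cmp_reassoc[OF inv_aunit_right]

lemma inv_aunit_natural:
  assumes [simp]: "f \<in> Arr X"
  shows "f \<cdot> inv_arr X (aunit X (Dom X f)) = inv_arr X (aunit X (Cod X f)) \<cdot> actA X weil_N f"
proof -
  have "f \<cdot> inv_arr X (aunit X (Dom X f)) =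
      inv_arr X (aunit X (Cod X f)) \<cdot> ((aunit X (Cod X f) \<cdot> f) \<cdot> inv_arr X (aunit X (Dom X f)))"
    by simp
  also have "\<dots> = inv_arr X (aunit X (Cod X f)) \<cdot> actA X weil_N f"
    by (subst aunit_natural) simp_all
  finally show ?thesis .
qed

text \<open>The augmentation of \<open>W\<^sup>k\<close> only gives a map to \<open>T\<^sub>\<nat> x\<close>, which is isomorphic to \<open>x\<close>.\<close>

definition pow_p :: "nat \<Rightarrow> 'o \<Rightarrow> 'a" where
  "pow_p k x = inv_arr X (aunit X x) \<cdot> actT X (weil_aug (weil_pw k)) x"

lemma pow_p [simp]:
  assumes "x \<in> Obj X"
  shows pow_p_Arr: "pow_p k x \<in> Arr X" and Dom_pow_p: "Dom X (pow_p k x) = act X (weil_pw k) x"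
    and Cod_pow_p: "Cod X (pow_p k x) = x"
  using assms by (simp_all add: pow_p_def)

lemma aunit_pow_p: "x \<in> Obj X \<Longrightarrow> aunit X x \<cdot> pow_p k x = actT X (weil_aug (weil_pw k)) x"
  by (simp add: pow_p_def)

lemma pow_p_natural:
  assumes [simp]: "f \<in> Arr X" and d: "Dom X f = x" "Cod X f = y"
  shows "pow_p k y \<cdot> actA X (weil_pw k) f = f \<cdot> pow_p k x"
proof -
  have "f \<cdot> pow_p k (Dom X f) = (f \<cdot> inv_arr X (aunit X (Dom X f))) \<cdot> actT X (weil_aug (weil_pw k)) (Dom X f)"
    by (simp add: pow_p_def)
  also have "\<dots> = inv_arr X (aunit X (Cod X f)) \<cdot> (actA X weil_N f \<cdot> actT X (weil_aug (weil_pw k)) (Dom X f))"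
    by (simp add: inv_aunit_natural)
  also have "\<dots> = pow_p k (Cod X f) \<cdot> actA X (weil_pw k) f"
    by (subst actT_natural[where A="weil_pw k" and y="Cod X f"]) (simp_all add: pow_p_def)
  finally show ?thesis by (simp add: d)
qed

lemma pow_p_actT:
  assumes \<theta>: "\<theta> \<in> Arr Weil" "Dom Weil \<theta> = weil_pw m" "Cod Weil \<theta> = weil_pw k" and x: "x \<in> Obj X"
  shows "pow_p k x \<cdot> actT X \<theta> x = pow_p m x"
proof -
  have "actT X (weil_aug (weil_pw k)) x \<cdot> actT X \<theta> x = actT X (weil_aug (weil_pw m)) x"
    using weil_aug_Cmp[OF \<theta>(1)] \<theta> x by (subst actT_Cmp[symmetric]) auto
  then show ?thesis using \<theta> x by (simp add: pow_p_def)
qed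

lemma pow_p_0: "x \<in> Obj X \<Longrightarrow> pow_p 0 x = inv_arr X (aunit X x)"
  by (simp add: pow_p_def weil_pw_0 weil_aug_N actT_def)

lemma tan_p_pow_p: "tan_p X x = pow_p 1 x"
  by (simp add: tan_p_def pow_p_def weil_W_def)

declare tan_obj_def [simp]

lemma tan_p [simp]:
  assumes "x \<in> Obj X"
  shows tan_p_Arr: "tan_p X x \<in> Arr X" and Dom_tan_p: "Dom X (tan_p X x) = act X weil_W x"
    and Cod_tan_p: "Cod X (tan_p X x) = x"
  using assms by (simp_all add: tan_p_def)

lemma tan_p_proj:
  assumes "x \<in> Obj X"
  shows "tan_p X x \<cdot> actT X (weil_proj k i) x = pow_p k x"
  unfolding tan_p_pow_p by (rule pow_p_actT) (use assms in \<open>auto simp: weil_W_def\<close>)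

lemma weil_pullback:
  assumes "x \<in> Obj X" "is_product Weil P A B \<pi> \<rho>" "A \<in> Obj Weil" "B \<in> Obj Weil" "P \<in> Obj Weil"
  shows "is_pullback X (actT X \<pi> x) (actT X \<rho> x) (actT X (weil_aug A) x) (actT X (weil_aug B) x)"
proof -
  have a: "\<pi> \<in> Arr Weil" "\<rho> \<in> Arr Weil" using assms by (auto simp: is_product_def)
  have "is_pullback X
             (actT X (weil_tensor_arr (Id Weil weil_N) \<pi>) x)
             (actT X (weil_tensor_arr (Id Weil weil_N) \<rho>) x)
             (actT X (weil_tensor_arr (Id Weil weil_N) (weil_aug A)) x)
             (actT X (weil_tensor_arr (Id Weil weil_N) (weil_aug B)) x)"
    using tangent_actegory assms weil_N_Obj unfolding tangent_actegory_def by blast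
  then show ?thesis using a assms by (simp add: weil_tensor_arr_N)
qed

text \<open>By induction on \<open>k\<close>: the action sends the product \<open>W\<^bsup>k+1\<^esup> = W\<^sup>k \<times> W\<close> to a pullback over \<open>T\<^sub>\<nat> x\<close>,
  and pulling back once more along \<open>p\<close> raises the pullback power by one.\<close>

lemma fibre_power_T:
  assumes [simp]: "x \<in> Obj X"
  shows "fibre_power X (tan_p X x) k (act X (weil_pw k) x) (pow_p k x) (\<lambda>j. actT X (weil_proj k (Suc j)) x)"
proof (induction k)
  case 0
  show ?case
  proof (rule fibre_powerI)
    fix g assume g: "g \<in> Arr X" "Cod X g = Cod X (tan_p X x)"
    show "\<exists>h. h \<in> Hom X (Dom X g) (act X (weil_pw 0) x) \<and> pow_p 0 x \<cdot> h = g \<and>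
         (\<forall>j<0. actT X (weil_proj 0 (Suc j)) x \<cdot> h = f j)" for f
      by (rule exI[of _ "aunit X x \<cdot> g"]) (use g in \<open>simp add: pow_p_0 weil_pw_0\<close>)
  next
    fix Z h k assume h: "h \<in> Hom X Z (act X (weil_pw 0) x)" and k: "k \<in> Hom X Z (act X (weil_pw 0) x)"
      and e: "pow_p 0 x \<cdot> h = pow_p 0 x \<cdot> k"
    have "aunit X x \<cdot> (pow_p 0 x \<cdot> h) = aunit X x \<cdot> (pow_p 0 x \<cdot> k)" by (simp add: e)
    then show "h = k" using h k by (simp add: pow_p_0 weil_pw_0)
  qed simp_all
next
  case (Suc k)
  let ?pr = "\<lambda>k j. actT X (weil_proj k (Suc j)) x"
  note pb = weil_pullback[OF assms is_product_pw[of k], simplified]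
  have init: "?pr k j \<cdot> actT X (weil_init k) x = ?pr (Suc k) j" if "j < k" for j
    using that by (simp add: actT_Cmp[symmetric] weil_init_proj)
  have wpi: "pow_p k x \<cdot> actT X (weil_init k) x = pow_p (Suc k) x"
    by (rule pow_p_actT) simp_all
  show ?case
  proof (rule fibre_powerI)
    fix g f assume g: "g \<in> Arr X" "Cod X g = Cod X (tan_p X x)"
      and f: "\<And>j. j < Suc k \<Longrightarrow> f j \<in> Hom X (Dom X g) (Dom X (tan_p X x))" "\<And>j. j < Suc k \<Longrightarrow> tan_p X x \<cdot> f j = g"
    have "\<exists>h. h \<in> Hom X (Dom X g) (act X (weil_pw k) x) \<and> pow_p k x \<cdot> h = g \<and> (\<forall>j<k. ?pr k j \<cdot> h = f j)"
      by (rule fibre_power_lift[OF Suc g]) (rule f, simp)+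
    then obtain h where h: "h \<in> Hom X (Dom X g) (act X (weil_pw k) x)" "pow_p k x \<cdot> h = g"
        "\<And>j. j < k \<Longrightarrow> ?pr k j \<cdot> h = f j"
      by blast
    have "actT X (weil_aug (weil_pw k)) x \<cdot> h = aunit X x \<cdot> g"
      using h by (subst aunit_pow_p[symmetric]) auto
    moreover have "actT X (weil_aug weil_W) x \<cdot> f k = aunit X x \<cdot> g"
      using f[of k] unfolding weil_W_def
      by (subst aunit_pow_p[symmetric]) (auto simp: tan_p_pow_p weil_W_def[symmetric] simp del: One_nat_def)
    ultimately obtain m where m: "m \<in> Hom X (Dom X g) (act X (weil_pw (Suc k)) x)"
        "actT X (weil_init k) x \<cdot> m = h" "?pr (Suc k) k \<cdot> m = f k"
      using pullback_ex[OF pb, of h "Dom X g" "f k"] h f[of k] by auto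
    have wm: "pow_p (Suc k) x \<cdot> m = g"
      using m h unfolding wpi[symmetric] by simp
    have pm: "?pr (Suc k) j \<cdot> m = f j" if "j < Suc k" for j
    proof (cases "j = k")
      case False
      then have "?pr (Suc k) j \<cdot> m = ?pr k j \<cdot> (actT X (weil_init k) x \<cdot> m)"
        using that m(1) by (subst init[symmetric]) auto
      then show ?thesis using h False that m by simp
    qed (use m in simp)
    show "\<exists>h. h \<in> Hom X (Dom X g) (act X (weil_pw (Suc k)) x) \<and> pow_p (Suc k) x \<cdot> h = g \<and>
         (\<forall>j<Suc k. ?pr (Suc k) j \<cdot> h = f j)"
      by (rule exI[of _ m], intro conjI allI impI wm pm m(1))
  next
    fix Z h m assume h: "h \<in> Hom X Z (act X (weil_pw (Suc k)) x)" and m: "m \<in> Hom X Z (act X (weil_pw (Suc k)) x)"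
      and w: "pow_p (Suc k) x \<cdot> h = pow_p (Suc k) x \<cdot> m"
      and p: "\<And>j. j < Suc k \<Longrightarrow> ?pr (Suc k) j \<cdot> h = ?pr (Suc k) j \<cdot> m"
    have "actT X (weil_init k) x \<cdot> h = actT X (weil_init k) x \<cdot> m"
    proof (rule fibre_power_eqI[OF Suc, of _ Z])
      show "pow_p k x \<cdot> (actT X (weil_init k) x \<cdot> h) = pow_p k x \<cdot> (actT X (weil_init k) x \<cdot> m)"
        using h m w by (simp add: Cmp_reassoc[OF wpi])
      show "?pr k j \<cdot> (actT X (weil_init k) x \<cdot> h) = ?pr k j \<cdot> (actT X (weil_init k) x \<cdot> m)" if "j < k" for j
        using h m p[of j] that by (simp add: Cmp_reassoc[OF init])
    qed (use h m in auto)
    then show "h = m"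
      by (rule pullback_eqI[OF pb, of h Z m, rotated 2]) (use h m p[of k] in auto)
  qed (simp_all add: tan_p_proj)
qed

text \<open>Limits commute with limits: \<open>T\<^bsub>W\<^sup>k\<^esub>\<close> is a pullback of copies of \<open>T\<close> over the identity functor,
  so it preserves each pullback power that \<open>T\<close> preserves.\<close>

lemma actA_fibre_power:
  assumes P: "fibre_power X q n P s \<pi>"
    and TP: "fibre_power X (tan_arr X q) n (tan_obj X P) (tan_arr X s) (\<lambda>j. tan_arr X (\<pi> j))"
  shows "fibre_power X (actA X (weil_pw k) q) n (act X (weil_pw k) P) (actA X (weil_pw k) s)
           (\<lambda>j. actA X (weil_pw k) (\<pi> j))"
proof -
  have q [simp]: "q \<in> Arr X" "s \<in> Arr X" "Dom X s = P" "Cod X s = Cod X q"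
    and \<pi> [simp]: "\<And>j. j < n \<Longrightarrow> \<pi> j \<in> Arr X" "\<And>j. j < n \<Longrightarrow> Dom X (\<pi> j) = P"
      "\<And>j. j < n \<Longrightarrow> Cod X (\<pi> j) = Dom X q" "\<And>j. j < n \<Longrightarrow> q \<cdot> \<pi> j = s"
    using P by (auto simp: fibre_power_def)
  have P_Obj [simp]: "P \<in> Obj X" using Dom_Obj[OF q(2)] by simp
  let ?T = "actA X (weil_pw k)" and ?pr = "\<lambda>j. actT X (weil_proj k (Suc j))"
  have T [simp]: "f \<in> Arr X \<Longrightarrow> tan_arr X f \<in> Arr X"
    "f \<in> Arr X \<Longrightarrow> Dom X (tan_arr X f) = tan_obj X (Dom X f)"
    "f \<in> Arr X \<Longrightarrow> Cod X (tan_arr X f) = tan_obj X (Cod X f)" for f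
    by (simp_all add: tan_arr_def)
  have pr: "tan_arr X f \<cdot> ?pr j (Dom X f) = ?pr j (Cod X f) \<cdot> ?T f" if "f \<in> Arr X" for f j
    unfolding tan_arr_def by (rule actT_natural) (use that in auto)
  have pr_re: "tan_arr X f \<cdot> (?pr j (Dom X f) \<cdot> h) = ?pr j (Cod X f) \<cdot> (?T f \<cdot> h)"
    if "f \<in> Arr X" "h \<in> Arr X" "Cod X h = act X (weil_pw k) (Dom X f)" for f j h
    using that by (subst Cmp_reassoc[OF pr]) auto
  have pow_p_re: "f \<cdot> (pow_p k (Dom X f) \<cdot> h) = pow_p k (Cod X f) \<cdot> (?T f \<cdot> h)"
    if "f \<in> Arr X" "h \<in> Arr X" "Cod X h = act X (weil_pw k) (Dom X f)" for f h
    using that by (subst Cmp_reassoc[OF pow_p_natural[symmetric]]) auto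
  have cone: "tan_p X y \<cdot> (?pr j y \<cdot> h) = pow_p k y \<cdot> h"
    if "y \<in> Obj X" "h \<in> Arr X" "Cod X h = act X (weil_pw k) y" for y h j
    using that by (subst Cmp_reassoc[OF tan_p_proj]) auto
  have tp: "tan_p X (Cod X f) \<cdot> (tan_arr X f \<cdot> h) = f \<cdot> (tan_p X (Dom X f) \<cdot> h)"
    if "f \<in> Arr X" "h \<in> Arr X" "Cod X h = tan_obj X (Dom X f)" for f h
  proof -
    have "tan_p X (Cod X f) \<cdot> tan_arr X f = f \<cdot> tan_p X (Dom X f)"
      unfolding tan_p_pow_p tan_arr_def weil_W_def by (rule pow_p_natural) (use that in auto)
    from Cmp_reassoc[OF this] that show ?thesis by simp
  qed
  show ?thesis
  proof (rule fibre_powerI)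
    show "?T q \<cdot> ?T (\<pi> j) = ?T s" if "j < n" for j
      using that by (subst actA_Cmp[symmetric]) auto
    fix g f assume g: "g \<in> Arr X" "Cod X g = Cod X (?T q)"
      and f: "\<And>j. j < n \<Longrightarrow> f j \<in> Hom X (Dom X g) (Dom X (?T q))" "\<And>j. j < n \<Longrightarrow> ?T q \<cdot> f j = g"
    note [simp] = f(1)[unfolded Hom_iff] g
    (* u is the image of the required map in P, and v i is its image in the i-th copy of T P. *)
    have "\<exists>u. u \<in> Hom X (Dom X (pow_p k (Cod X q) \<cdot> g)) P \<and> s \<cdot> u = pow_p k (Cod X q) \<cdot> g \<and>
       (\<forall>j<n. \<pi> j \<cdot> u = pow_p k (Dom X q) \<cdot> f j)"
      by (rule fibre_power_lift[OF P]) (simp_all add: pow_p_re f(2))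
    then obtain u where u [simp]: "u \<in> Arr X" "Dom X u = Dom X g" "Cod X u = P" 
      and su: "s \<cdot> u = pow_p k (Cod X q) \<cdot> g" and \<pi>u: "\<And>j. j < n \<Longrightarrow> \<pi> j \<cdot> u = pow_p k (Dom X q) \<cdot> f j"
      by auto
    have "\<exists>v. v \<in> Hom X (Dom X (?pr i (Cod X q) \<cdot> g)) (tan_obj X P) \<and> tan_arr X s \<cdot> v = ?pr i (Cod X q) \<cdot> g \<and>
       (\<forall>j<n. tan_arr X (\<pi> j) \<cdot> v = ?pr i (Dom X q) \<cdot> f j)" for i
      by (rule fibre_power_lift[OF TP]) (simp_all add: pr_re f(2))
    then obtain v where v [simp]: "\<And>i. v i \<in> Arr X" "\<And>i. Dom X (v i) = Dom X g" "\<And>i. Cod X (v i) = tan_obj X P" 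
      and sv: "\<And>i. tan_arr X s \<cdot> v i = ?pr i (Cod X q) \<cdot> g"
      and \<pi>v: "\<And>i j. j < n \<Longrightarrow> tan_arr X (\<pi> j) \<cdot> v i = ?pr i (Dom X q) \<cdot> f j"
      by simp metis
    have uv: "tan_p X P \<cdot> v i = u" for i
    proof (rule fibre_power_eqI[OF P, of _ "Dom X g"])
      show "s \<cdot> (tan_p X P \<cdot> v i) = s \<cdot> u"
        using tp[of s "v i"] by (simp add: sv su cone)
      show "\<pi> j \<cdot> (tan_p X P \<cdot> v i) = \<pi> j \<cdot> u" if "j < n" for j
        using tp[of "\<pi> j" "v i"] that by (simp add: \<pi>v \<pi>u cone)
    qed simp_all
    have "\<exists>h. h \<in> Hom X (Dom X u) (act X (weil_pw k) P) \<and> pow_p k P \<cdot> h = u \<and> (\<forall>i<k. ?pr i P \<cdot> h = v i)"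
      by (rule fibre_power_lift[OF fibre_power_T[OF P_Obj]]) (simp_all add: uv)
    then obtain h where h [simp]: "h \<in> Arr X" "Dom X h = Dom X g" "Cod X h = act X (weil_pw k) P"
      and wh: "pow_p k P \<cdot> h = u" and ph: "\<And>i. i < k \<Longrightarrow> ?pr i P \<cdot> h = v i"
      by auto
    have "?T s \<cdot> h = g"
    proof (rule fibre_power_eqI[OF fibre_power_T[of "Cod X q"], of _ "Dom X g"])
      show "pow_p k (Cod X q) \<cdot> (?T s \<cdot> h) = pow_p k (Cod X q) \<cdot> g"
        using pow_p_re[of s h] by (simp add: wh su)
      show "?pr i (Cod X q) \<cdot> (?T s \<cdot> h) = ?pr i (Cod X q) \<cdot> g" if "i < k" for i
        using pr_re[of s h i] that by (simp add: ph sv)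
    qed simp_all
    moreover have "?T (\<pi> j) \<cdot> h = f j" if "j < n" for j
    proof (rule fibre_power_eqI[OF fibre_power_T[of "Dom X q"], of _ "Dom X g"])
      show "pow_p k (Dom X q) \<cdot> (?T (\<pi> j) \<cdot> h) = pow_p k (Dom X q) \<cdot> f j"
        using pow_p_re[of "\<pi> j" h] that by (simp add: wh \<pi>u)
      show "?pr i (Dom X q) \<cdot> (?T (\<pi> j) \<cdot> h) = ?pr i (Dom X q) \<cdot> f j" if "i < k" for i
        using pr_re[of "\<pi> j" h i] that \<open>j < n\<close> by (simp add: ph \<pi>v)
    qed (use that in simp_all)
    ultimately show "\<exists>h. h \<in> Hom X (Dom X g) (act X (weil_pw k) P) \<and> ?T s \<cdot> h = g \<and> (\<forall>j<n. ?T (\<pi> j) \<cdot> h = f j)"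
      by (intro exI[of _ h]) simp
  next
    fix Z h m assume h: "h \<in> Hom X Z (act X (weil_pw k) P)" and m: "m \<in> Hom X Z (act X (weil_pw k) P)"
      and s: "?T s \<cdot> h = ?T s \<cdot> m" and p: "\<And>j. j < n \<Longrightarrow> ?T (\<pi> j) \<cdot> h = ?T (\<pi> j) \<cdot> m"
    note [simp] = h[unfolded Hom_iff] m[unfolded Hom_iff]
    show "h = m"
    proof (rule fibre_power_eqI[OF fibre_power_T[OF P_Obj], of _ Z])
      show "pow_p k P \<cdot> h = pow_p k P \<cdot> m"
      proof (rule fibre_power_eqI[OF P, of _ Z])
        show "s \<cdot> (pow_p k P \<cdot> h) = s \<cdot> (pow_p k P \<cdot> m)"
          using pow_p_re[of s h] pow_p_re[of s m] by (simp add: s)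
        show "\<pi> j \<cdot> (pow_p k P \<cdot> h) = \<pi> j \<cdot> (pow_p k P \<cdot> m)" if "j < n" for j
          using pow_p_re[of "\<pi> j" h] pow_p_re[of "\<pi> j" m] that by (simp add: p)
      qed simp_all
      show "?pr i P \<cdot> h = ?pr i P \<cdot> m" if "i < k" for i
      proof (rule fibre_power_eqI[OF TP, of _ Z])
        show "tan_arr X s \<cdot> (?pr i P \<cdot> h) = tan_arr X s \<cdot> (?pr i P \<cdot> m)"
          using pr_re[of s h i] pr_re[of s m i] by (simp add: s)
        show "tan_arr X (\<pi> j) \<cdot> (?pr i P \<cdot> h) = tan_arr X (\<pi> j) \<cdot> (?pr i P \<cdot> m)" if "j < n" for j
          using pr_re[of "\<pi> j" h i] pr_re[of "\<pi> j" m i] that by (simp add: p)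
      qed simp_all
    qed simp_all
  qed simp_all
qed

end


section \<open>The tangent bundle \<open>T x \<rightarrow> x\<close>\<close>

context actegory
begin

lemma tan_arr [simp]:
  assumes "f \<in> Arr X"
  shows tan_arr_Arr: "tan_arr X f \<in> Arr X" and Dom_tan_arr: "Dom X (tan_arr X f) = act X weil_W (Dom X f)"
    and Cod_tan_arr: "Cod X (tan_arr X f) = act X weil_W (Cod X f)"
  using assms by (simp_all add: tan_arr_def)

lemma tan_arr_Id [simp]: "x \<in> Obj X \<Longrightarrow> tan_arr X (Id X x) = Id X (act X weil_W x)"
  by (simp add: tan_arr_def)

lemma tan_arr_Cmp: "f \<in> Arr X \<Longrightarrow> g \<in> Arr X \<Longrightarrow> Dom X g = Cod X f \<Longrightarrow>
    tan_arr X (g \<cdot> f) = tan_arr X g \<cdot> tan_arr X f"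
  unfolding tan_arr_def by (rule actA_Cmp) simp_all

lemma tan_zero [simp]:
  assumes "x \<in> Obj X"
  shows tan_zero_Arr: "tan_zero X x \<in> Arr X" and Dom_tan_zero: "Dom X (tan_zero X x) = x"
    and Cod_tan_zero: "Cod X (tan_zero X x) = act X weil_W x"
  using assms by (simp_all add: tan_zero_def)

lemma tan_plus [simp]:
  assumes "x \<in> Obj X"
  shows tan_plus_Arr: "tan_plus X x \<in> Arr X" and Dom_tan_plus: "Dom X (tan_plus X x) = act X (weil_pw 2) x"
    and Cod_tan_plus: "Cod X (tan_plus X x) = act X weil_W x"
  using assms by (simp_all add: tan_plus_def)

definition pow_zero :: "nat \<Rightarrow> 'o \<Rightarrow> 'a" where
  "pow_zero k x = actT X (weil_unit (weil_pw k)) x \<cdot> aunit X x"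

lemma pow_zero [simp]:
  assumes "x \<in> Obj X"
  shows pow_zero_Arr: "pow_zero k x \<in> Arr X" and Dom_pow_zero: "Dom X (pow_zero k x) = x"
    and Cod_pow_zero: "Cod X (pow_zero k x) = act X (weil_pw k) x"
  using assms by (simp_all add: pow_zero_def)

lemma tan_zero_pow_zero: "tan_zero X x = pow_zero 1 x"
  by (simp add: tan_zero_def pow_zero_def weil_W_def)

lemma actT_pow_zero:
  assumes \<theta>: "\<theta> \<in> Arr Weil" "Dom Weil \<theta> = weil_pw m" "Cod Weil \<theta> = weil_pw k" and x: "x \<in> Obj X"
  shows "actT X \<theta> x \<cdot> pow_zero m x = pow_zero k x"
proof -
  have e: "actT X \<theta> x \<cdot> actT X (weil_unit (weil_pw m)) x = actT X (weil_unit (weil_pw k)) x"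
    using weil_Cmp_unit[OF \<theta>(1)] \<theta> x by (subst actT_Cmp[symmetric]) auto
  show ?thesis using \<theta> x by (simp add: pow_zero_def Cmp_reassoc[OF e])
qed

lemma proj_pow_zero: "x \<in> Obj X \<Longrightarrow> actT X (weil_proj k i) x \<cdot> pow_zero k x = tan_zero X x"
  unfolding tan_zero_pow_zero by (rule actT_pow_zero) (auto simp: weil_W_def)

lemma pow_p_pow_zero: "x \<in> Obj X \<Longrightarrow> pow_p k x \<cdot> pow_zero k x = Id X x"
proof -
  assume x [simp]: "x \<in> Obj X"
  have e: "actT X (weil_aug (weil_pw k)) x \<cdot> actT X (weil_unit (weil_pw k)) x = Id X (act X weil_N x)"
    using weil_aug_Cmp[of "weil_unit (weil_pw k)"]
    by (subst actT_Cmp[symmetric]) (auto simp: weil_aug_N actT_def)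
  show ?thesis by (simp add: pow_p_def pow_zero_def Cmp_reassoc[OF e])
qed

lemma pow_zero_natural:
  assumes [simp]: "f \<in> Arr X" and d: "Dom X f = x" "Cod X f = y"
  shows "actA X (weil_pw k) f \<cdot> pow_zero k x = pow_zero k y \<cdot> f"
proof -
  have "actA X (weil_pw k) f \<cdot> pow_zero k (Dom X f) =
     (actA X (weil_pw k) f \<cdot> actT X (weil_unit (weil_pw k)) (Dom X f)) \<cdot> aunit X (Dom X f)"
    by (simp add: pow_zero_def)
  also have "\<dots> = actT X (weil_unit (weil_pw k)) (Cod X f) \<cdot> (actA X weil_N f \<cdot> aunit X (Dom X f))"
    by (subst actT_natural[where A=weil_N and y="Cod X f"]) simp_all
  also have "\<dots> = pow_zero k (Cod X f) \<cdot> f"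
    by (simp add: aunit_natural[symmetric] pow_zero_def)
  finally show ?thesis by (simp add: d)
qed

lemma tan_zero_natural: "f \<in> Arr X \<Longrightarrow> Dom X f = x \<Longrightarrow> Cod X f = y \<Longrightarrow>
    tan_arr X f \<cdot> tan_zero X x = tan_zero X y \<cdot> f"
  unfolding tan_zero_pow_zero tan_arr_def weil_W_def by (rule pow_zero_natural)

lemma tan_p_natural: "f \<in> Arr X \<Longrightarrow> Dom X f = x \<Longrightarrow> Cod X f = y \<Longrightarrow>
    tan_p X y \<cdot> tan_arr X f = f \<cdot> tan_p X x"
  unfolding tan_p_pow_p tan_arr_def weil_W_def by (rule pow_p_natural)

lemma tan_p_zero: "x \<in> Obj X \<Longrightarrow> tan_p X x \<cdot> tan_zero X x = Id X x"
  unfolding tan_p_pow_p tan_zero_pow_zero by (rule pow_p_pow_zero)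

lemma tan_bundle_sel [simp]: "tot (tan_bundle X x) = act X weil_W x" "bas (tan_bundle X x) = x"
  "prj (tan_bundle X x) = tan_p X x" "pls (tan_bundle X x) = tan_plus X x" "zer (tan_bundle X x) = tan_zero X x"
  "pj (tan_bundle X x) n j = actT X (weil_proj n (Suc j)) x"
  by (simp_all add: tan_bundle_def)

lemma tan_bundle_pw: "n \<noteq> 0 \<Longrightarrow> pw (tan_bundle X x) n = act X (weil_pw n) x"
  by (simp add: tan_bundle_def)

lemma st_tan_bundle: "x \<in> Obj X \<Longrightarrow> n \<noteq> 0 \<Longrightarrow> st X (tan_bundle X x) n = pow_p n x"
  by (simp add: st_def tan_p_proj)

lemma power_bundle_tan_bundle:
  assumes [simp]: "x \<in> Obj X"
  shows "power_bundle X (tan_bundle X x)"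
proof
  show "prj (tan_bundle X x) \<in> Hom X (tot (tan_bundle X x)) (bas (tan_bundle X x))" by simp
  fix n
  show "fibre_power X (prj (tan_bundle X x)) n (pw (tan_bundle X x) n) (st X (tan_bundle X x) n) (pj (tan_bundle X x) n)"
  proof (cases "n = 0")
    case True
    then show ?thesis
      by (intro fibre_powerI) (auto simp: st_def tan_bundle_def)
  next
    case False
    have "pj (tan_bundle X x) n = (\<lambda>j. actT X (weil_proj n (Suc j)) x)" by (rule ext) simp
    then show ?thesis using fibre_power_T[of x n] False by (simp add: st_tan_bundle tan_bundle_pw)
  qed
qed

lemma tan_of_bundle_sel [simp]: "tot (tan_of_bundle X B) = act X weil_W (tot B)"
  "bas (tan_of_bundle X B) = act X weil_W (bas B)"
  "prj (tan_of_bundle X B) = tan_arr X (prj B)" "pw (tan_of_bundle X B) n = act X weil_W (pw B n)"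
  "pj (tan_of_bundle X B) n j = tan_arr X (pj B n j)"
  "pls (tan_of_bundle X B) = tan_arr X (pls B)" "zer (tan_of_bundle X B) = tan_arr X (zer B)"
  by (simp_all add: tan_of_bundle_def)

end

section \<open>Differential bundles\<close>

locale dbundle = actegory X + abundle X B
  for X :: "('o, 'a, 'z) actegory_scheme" (structure) and B :: "('o, 'a) diff_bundle" +
  assumes differential_bundle: "differential_bundle X B"
begin

lemma st_tan_of_bundle [simp]: "st X (tan_of_bundle X B) n = tan_arr X (st X B n)"
  by (cases "n = 0") (simp_all add: st_def[of X "tan_of_bundle X B"] tan_arr_Cmp[symmetric])

lemma tan_fibre_power: "fibre_power X (tan_arr X (prj B)) n (act X weil_W (pw B n)) (tan_arr X (st X B n))
     (\<lambda>j. tan_arr X (pj B n j))"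
proof -
  have "\<forall>n k. fibre_power X ((tan_arr X ^^ k) (prj B)) n ((tan_obj X ^^ k) (pw B n))
        ((tan_arr X ^^ k) (st X B n)) (\<lambda>j. (tan_arr X ^^ k) (pj B n j))"
    using differential_bundle unfolding differential_bundle_def by blast
  from this[rule_format, of 1 n] show ?thesis by simp
qed

lemma power_bundle_tan_of_bundle: "power_bundle X (tan_of_bundle X B)"
proof
  show "prj (tan_of_bundle X B) \<in> Hom X (tot (tan_of_bundle X B)) (bas (tan_of_bundle X B))" by simp
  fix n
  have "pj (tan_of_bundle X B) n = (\<lambda>j. tan_arr X (pj B n j))" by (rule ext) simp
  then show "fibre_power X (prj (tan_of_bundle X B)) n (pw (tan_of_bundle X B) n) (st X (tan_of_bundle X B) n)
      (pj (tan_of_bundle X B) n)"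
    using tan_fibre_power[of n] by simp
qed

end

sublocale dbundle \<subseteq> TB: power_bundle X "tan_of_bundle X B"
  by (rule power_bundle_tan_of_bundle)

context dbundle
begin

lemma over_tan:
  assumes "over s f"
  shows "TB.over (tan_arr X s) (tan_arr X f)"
  using overD[OF assms] by (simp add: TB.over_def tan_arr_Cmp[symmetric])

lemma tan_fpair:
  assumes "over s f" "over s g"
  shows "fpair X (tan_of_bundle X B) (tan_arr X f) (tan_arr X g) = tan_arr X (fpair X B f g)"
  by (rule TB.fpair_eqI[OF over_tan over_tan, OF assms])
    (use fpair[OF assms] overD[OF assms(1)] in \<open>simp_all add: tan_arr_Cmp[symmetric] del: One_nat_def\<close>)

lemma tan_fsum:
  assumes "over s f" "over s g"
  shows "fsum X (tan_of_bundle X B) (tan_arr X f) (tan_arr X g) = tan_arr X (fsum X B f g)"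
  unfolding fsum_def tan_fpair[OF assms]
  using fpair[OF assms] by (simp add: tan_arr_Cmp)

text \<open>\<open>T\<close> preserves the pullback powers and hence the fibrewise sum, so it carries over each law of
  an additive bundle.\<close>

lemma additive_tan_of_bundle: "additive_bundle X (tan_of_bundle X B)"
proof -
  have p: "over (st X B 3) (pj B 3 0)" "over (st X B 3) (pj B 3 1)" "over (st X B 3) (pj B 3 2)"
    "over (st X B 2) (pj B 2 0)" "over (st X B 2) (pj B 2 1)"
    by simp_all
  have "fsum X (tan_of_bundle X B) (fsum X (tan_of_bundle X B) (tan_arr X (pj B 3 0)) (tan_arr X (pj B 3 1))) (tan_arr X (pj B 3 2)) =
        tan_arr X (fsum X B (fsum X B (pj B 3 0) (pj B 3 1)) (pj B 3 2))"
    using tan_fsum[OF p(1,2)] tan_fsum[OF over_fsum[OF p(1,2)] p(3)] by simp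
  also have "\<dots> = fsum X (tan_of_bundle X B) (tan_arr X (pj B 3 0)) (fsum X (tan_of_bundle X B) (tan_arr X (pj B 3 1)) (tan_arr X (pj B 3 2)))"
    unfolding pls_assoc
    using tan_fsum[OF p(2,3)] tan_fsum[OF p(1) over_fsum[OF p(2,3)]] by simp
  finally have assoc: "fsum X (tan_of_bundle X B) (fsum X (tan_of_bundle X B) (tan_arr X (pj B 3 0)) (tan_arr X (pj B 3 1))) (tan_arr X (pj B 3 2)) =
      fsum X (tan_of_bundle X B) (tan_arr X (pj B 3 0)) (fsum X (tan_of_bundle X B) (tan_arr X (pj B 3 1)) (tan_arr X (pj B 3 2)))" .
  have comm: "fsum X (tan_of_bundle X B) (tan_arr X (pj B 2 1)) (tan_arr X (pj B 2 0)) = tan_arr X (pls B)"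
    using tan_fsum[OF p(5,4)] by (simp add: pls_comm[simplified])
  have o: "over (prj B) (Id X (tot B))" "over (prj B) (zer B \<cdot> prj B)"
    by (simp_all add: over_def)
  have unit: "fsum X (tan_of_bundle X B) (Id X (act X weil_W (tot B))) (tan_arr X (zer B) \<cdot> tan_arr X (prj B)) = Id X (act X weil_W (tot B))"
    using tan_fsum[OF o] by (simp add: pls_unit tan_arr_Cmp)
  show ?thesis
    unfolding additive_bundle_def tan_of_bundle_sel
    using assoc comm unit tan_fibre_power
    by (auto simp: tan_arr_Cmp[symmetric])
qed

lemma abundle_tan_of_bundle: "abundle X (tan_of_bundle X B)"
  by (rule abundleI[OF category additive_tan_of_bundle])

end

sublocale dbundle \<subseteq> TB: abundle X "tan_of_bundle X B"
  by (rule abundle_tan_of_bundle)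

sublocale dbundle \<subseteq> PB: power_bundle X "tan_bundle X (tot B)"
  by (rule power_bundle_tan_bundle) simp

context dbundle
begin

lemma lft [unfolded Hom_iff tan_obj_def, simp]: "lft B \<in> Hom X (tot B) (tan_obj X (tot B))"
  and lft_add_T: "additive_morphism X B (tan_of_bundle X B) (lft B) (tan_zero X (bas B))"
  and lft_add_p: "additive_morphism X B (tan_bundle X (tot B)) (lft B) (zer B)"
  and lft_pullback: "is_pullback X
       (tan_arr X (pls B) \<cdot> fpair X (tan_of_bundle X B)
          (lft B \<cdot> pj B 2 0) (tan_zero X (tot B) \<cdot> pj B 2 1))
       (prj B \<cdot> pj B 2 0) (tan_arr X (prj B)) (tan_zero X (bas B))"
  using differential_bundle unfolding differential_bundle_def by blast+

lemma prj_lft: "tan_arr X (prj B) \<cdot> lft B = tan_zero X (bas B) \<cdot> prj B"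
  using lft_add_T by (simp add: additive_morphism_def bundle_morphism_def)

lemma p_lft: "tan_p X (tot B) \<cdot> lft B = zer B \<cdot> prj B"
  using lft_add_p by (simp add: additive_morphism_def bundle_morphism_def)

lemma over_lft:
  assumes "over s h"
  shows "TB.over (tan_zero X (bas B) \<cdot> s) (lft B \<cdot> h)"
  using overD[OF assms] by (simp add: TB.over_def Cmp_reassoc[OF prj_lft])

lemma over_tan_zero:
  assumes "over s h"
  shows "TB.over (tan_zero X (bas B) \<cdot> s) (tan_zero X (tot B) \<cdot> h)"
  using overD[OF assms] by (simp add: TB.over_def Cmp_reassoc[OF tan_zero_natural[of "prj B" "tot B" "bas B"]])

text \<open>The lift is the composite of the universal map \<open>\<mu> : E\<^sub>2 \<rightarrow> T E\<close>, \<open>(a, b) \<mapsto> \<lambda> a + 0 b\<close>, with the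
  split monomorphism \<open>e \<mapsto> (e, 0)\<close>.  The map \<open>\<mu>\<close> is the top of a pullback square, and the lift
  \<open>\<lambda> e\<close> also determines the other leg \<open>q e = p (T q (\<lambda> e))\<close>.\<close>

lemma lft_monic:
  assumes h: "h \<in> Hom X Z (tot B)" and k: "k \<in> Hom X Z (tot B)" and e: "lft B \<cdot> h = lft B \<cdot> k"
  shows "h = k"
proof -
  let ?\<mu> = "tan_arr X (pls B) \<cdot> fpair X (tan_of_bundle X B) (lft B \<cdot> pj B 2 0) (tan_zero X (tot B) \<cdot> pj B 2 1)"
  let ?i = "\<lambda>h. fpair X B h (zer B \<cdot> (prj B \<cdot> h))"
  have p: "over (st X B 2) (pj B 2 0)" "over (st X B 2) (pj B 2 1)" by simp_all
  have *: "?i h \<in> Hom X Z (pw B 2) \<and> ?\<mu> \<cdot> ?i h = lft B \<cdot> h \<and> pj B 2 0 \<cdot> ?i h = h \<and> (prj B \<cdot> pj B 2 0) \<cdot> ?i h = prj B \<cdot> h"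
    if h: "h \<in> Hom X Z (tot B)" for h
  proof -
    note [simp] = h[unfolded Hom_iff]
    have o: "over (prj B \<cdot> h) h" "over (prj B \<cdot> h) (zer B \<cdot> (prj B \<cdot> h))"
      by (simp_all add: over_def)
    note i = fpair[OF o]
    have "?\<mu> \<cdot> ?i h = fsum X (tan_of_bundle X B) (lft B \<cdot> pj B 2 0) (tan_zero X (tot B) \<cdot> pj B 2 1) \<cdot> ?i h"
      by (simp add: fsum_def)
    also have "\<dots> = fsum X (tan_of_bundle X B) ((lft B \<cdot> pj B 2 0) \<cdot> ?i h) ((tan_zero X (tot B) \<cdot> pj B 2 1) \<cdot> ?i h)"
      by (rule TB.fsum_Cmp[OF over_lft over_tan_zero, OF p]) (simp_all add: i)
    also have "(lft B \<cdot> pj B 2 0) \<cdot> ?i h = lft B \<cdot> h"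
      using i by simp
    also have "(tan_zero X (tot B) \<cdot> pj B 2 1) \<cdot> ?i h = tan_zero X (tot B) \<cdot> (zer B \<cdot> (prj B \<cdot> h))"
      using i by (simp del: One_nat_def)
    also have "\<dots> = tan_arr X (zer B) \<cdot> (tan_zero X (bas B) \<cdot> (prj B \<cdot> h))"
      using Cmp_reassoc[OF tan_zero_natural[of "zer B" "bas B" "tot B"], of "prj B \<cdot> h"] by simp
    also have "fsum X (tan_of_bundle X B) (lft B \<cdot> h) \<dots> = lft B \<cdot> h"
      using TB.fsum_zer_right[OF over_lft[OF o(1)]] by simp
    finally show ?thesis using i by simp
  qed
  note [simp] = h[unfolded Hom_iff] k[unfolded Hom_iff]
  have q: "prj B \<cdot> h = tan_p X (bas B) \<cdot> (tan_arr X (prj B) \<cdot> (lft B \<cdot> h))" if "h \<in> Hom X Z (tot B)" for h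
    using that by (simp add: Cmp_reassoc[OF prj_lft] Cmp_reassoc[OF tan_p_zero])
  have qe: "prj B \<cdot> h = prj B \<cdot> k"
    using q[OF h] q[OF k] e by simp
  have \<mu>_Dom: "Dom X ?\<mu> = pw B 2"
    using TB.fpair[OF over_lft[OF p(1)] over_tan_zero[OF p(2)]] by simp
  have "?i h = ?i k"
    by (rule pullback_eqI[OF lft_pullback, of _ Z]) (use *[OF h] *[OF k] qe e \<mu>_Dom in simp_all)
  then show ?thesis using *[OF h] *[OF k] by metis
qed

text \<open>As a sum in the additive bundle \<open>T E \<rightarrow> T M\<close>, the map \<open>\<alpha>\<^sub>W\<close> can be handled by the monoid laws.\<close>

lemma Ind_al_W_fsum: "Ind_al_W X B = fsum X (tan_of_bundle X B) (tan_zero X (tot B) \<cdot> pj B 2 0) (lft B \<cdot> pj B 2 1)"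
  by (simp add: Ind_al_W_def fsum_def)

lemma over_Ind_al_W: "TB.over (tan_zero X (bas B) \<cdot> st X B 2) (Ind_al_W X B)"
  unfolding Ind_al_W_fsum by (rule TB.over_fsum[OF over_tan_zero over_lft]) simp_all

lemma Ind_al_W [simp]:
  shows Ind_al_W_Arr: "Ind_al_W X B \<in> Arr X" and Dom_Ind_al_W: "Dom X (Ind_al_W X B) = pw B 2"
    and Cod_Ind_al_W: "Cod X (Ind_al_W X B) = act X weil_W (tot B)"
    and prj_Ind_al_W: "tan_arr X (prj B) \<cdot> Ind_al_W X B = tan_zero X (bas B) \<cdot> st X B 2"
  using TB.overD[OF over_Ind_al_W] by simp_all

end

locale dbundle_map = actegory X + B: dbundle X B + B': dbundle X B' + bundle_map X B B' f g
  for X :: "('o, 'a, 'z) actegory_scheme" (structure)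
    and B B' :: "('o, 'a) diff_bundle" and f g :: 'a
begin

lemma pow_map_tan:
  "pow_map X (tan_of_bundle X B) (tan_of_bundle X B') (tan_arr X f) (tan_arr X g) n = tan_arr X (pow_map X B B' f g n)"
proof -
  interpret T: bundle_map X "tan_of_bundle X B" "tan_of_bundle X B'" "tan_arr X f" "tan_arr X g"
    by unfold_locales (simp add: bundle_morphism_def tan_arr_Cmp[symmetric] prj_f)
  show ?thesis
  proof (rule B'.TB.pw_eqI[of _ "act X weil_W (pw B n)" n])
    show "st X (tan_of_bundle X B') n \<cdot> pow_map X (tan_of_bundle X B) (tan_of_bundle X B') (tan_arr X f) (tan_arr X g) n =
        st X (tan_of_bundle X B') n \<cdot> tan_arr X (pow_map X B B' f g n)"
      unfolding T.st_pow_map by (simp add: tan_arr_Cmp[symmetric])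
    show "pj (tan_of_bundle X B') n j \<cdot> pow_map X (tan_of_bundle X B) (tan_of_bundle X B') (tan_arr X f) (tan_arr X g) n =
        pj (tan_of_bundle X B') n j \<cdot> tan_arr X (pow_map X B B' f g n)" if "j < n" for j
      unfolding T.pj_pow_map[OF that] using that by (simp add: tan_arr_Cmp[symmetric])
  qed (use T.pow_map[of n] in simp_all)
qed

end

locale additive_dbundle_map = dbundle_map X B B' f g + additive_map X B B' f g
  for X :: "('o, 'a, 'z) actegory_scheme" (structure)
    and B B' :: "('o, 'a) diff_bundle" and f g :: 'a
begin

lemma additive_map_tan: "additive_map X (tan_of_bundle X B) (tan_of_bundle X B') (tan_arr X f) (tan_arr X g)"
proof unfold_locales
  show b: "bundle_morphism X (tan_of_bundle X B) (tan_of_bundle X B') (tan_arr X f) (tan_arr X g)"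
    by (simp add: bundle_morphism_def tan_arr_Cmp[symmetric] prj_f)
  show "additive_morphism X (tan_of_bundle X B) (tan_of_bundle X B') (tan_arr X f) (tan_arr X g)"
    using b f_pls f_zer by (simp add: additive_morphism_def pow_map_tan tan_arr_Cmp[symmetric])
qed

end


section \<open>The components of \<open>Ind\<close>\<close>

lemma act_Nmat [simp]: "act Nmat A l = weil_dim A * l"
  by (simp add: Nmat_def)

lemma dim_actA_Nmat [simp]: "dim_row (actA Nmat A M) = weil_dim A * dim_row M"
  "dim_col (actA Nmat A M) = weil_dim A * dim_col M"
  by (simp_all add: actA_def Nmat_def Nmat_act_def Weil_sel)

lemma dim_actT_Nmat [simp]: "dim_row (actT Nmat \<theta> l) = weil_dim (Cod Weil \<theta>) * l"
  "dim_col (actT Nmat \<theta> l) = weil_dim (Dom Weil \<theta>) * l"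
  by (cases \<theta>; simp add: actT_def Nmat_def Nmat_act_def)+

lemma weil_to_tensors_sel [simp]: "Dom Weil (weil_to_tensors A) = A"
   "Cod Weil (weil_to_tensors A) = weil_tensors (weil_sizes A)"
  by (simp_all add: weil_to_tensors_def)

context actegory
begin

lemma T_eqI:
  assumes h: "h \<in> Hom X Z (act X (weil_pw k) x)" "m \<in> Hom X Z (act X (weil_pw k) x)" and x: "x \<in> Obj X"
    and pow_p: "pow_p k x \<cdot> h = pow_p k x \<cdot> m"
    and proj: "\<And>i. i \<in> {1..k} \<Longrightarrow> actT X (weil_proj k i) x \<cdot> h = actT X (weil_proj k i) x \<cdot> m"
  shows "h = m"
  by (rule fibre_power_eqI[OF fibre_power_T[OF x] h]) (use pow_p proj in auto)

lemma aunit_cancel: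
  assumes "x \<in> Obj X" "h \<in> Arr X" "Cod X h = act X (weil_pw k) x" "m \<in> Arr X" "Cod X m = x"
  shows "actT X (weil_aug (weil_pw k)) x \<cdot> h = aunit X x \<cdot> m \<longleftrightarrow> pow_p k x \<cdot> h = m"
proof
  assume "actT X (weil_aug (weil_pw k)) x \<cdot> h = aunit X x \<cdot> m"
  then have "inv_arr X (aunit X x) \<cdot> (actT X (weil_aug (weil_pw k)) x \<cdot> h) = inv_arr X (aunit X x) \<cdot> (aunit X x \<cdot> m)"
    by simp
  then show "pow_p k x \<cdot> h = m" using assms by (simp add: pow_p_def)
next
  assume "pow_p k x \<cdot> h = m"
  then show "actT X (weil_aug (weil_pw k)) x \<cdot> h = aunit X x \<cdot> m"
    using assms by (auto simp: aunit_pow_p[symmetric])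
qed

end

context dbundle
begin

lemma Ind_al_pw0 [simp]: "Ind_al_pw0 X B k = pow_zero k (bas B)"
  by (simp add: Ind_al_pw0_def pow_zero_def)

text \<open>Naturality of \<open>p\<close> at \<open>\<sigma>\<close>, \<open>\<zeta>\<close> and the projections says that \<open>p\<close> is additive from \<open>T E \<rightarrow> T M\<close>
  to \<open>E \<rightarrow> M\<close>.\<close>

lemma additive_map_p: "additive_map X (tan_of_bundle X B) B (tan_p X (tot B)) (tan_p X (bas B))"
proof unfold_locales
  have n: "tan_p X (tot B) \<cdot> tan_arr X (pj B k j) = pj B k j \<cdot> tan_p X (pw B k)" if "j < k" for j k
    by (rule tan_p_natural) (use that in simp_all)
  have s: "tan_p X (bas B) \<cdot> tan_arr X (st X B k) = st X B k \<cdot> tan_p X (pw B k)" for k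
    by (rule tan_p_natural) simp_all
  show b: "bundle_morphism X (tan_of_bundle X B) B (tan_p X (tot B)) (tan_p X (bas B))"
    by (simp add: bundle_morphism_def tan_p_natural[of "prj B"])
  interpret p: bundle_map X "tan_of_bundle X B" B "tan_p X (tot B)" "tan_p X (bas B)"
    by unfold_locales (rule b)
  have "pow_map X (tan_of_bundle X B) B (tan_p X (tot B)) (tan_p X (bas B)) 2 = tan_p X (pw B 2)"
  proof (rule pw_eqI[of _ "act X weil_W (pw B 2)" 2])
    show "st X B 2 \<cdot> pow_map X (tan_of_bundle X B) B (tan_p X (tot B)) (tan_p X (bas B)) 2 = st X B 2 \<cdot> tan_p X (pw B 2)"
      unfolding p.st_pow_map by (simp add: s)
    show "pj B 2 j \<cdot> pow_map X (tan_of_bundle X B) B (tan_p X (tot B)) (tan_p X (bas B)) 2 = pj B 2 j \<cdot> tan_p X (pw B 2)"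
      if "j < 2" for j
      unfolding p.pj_pow_map[OF that] using that by (simp add: n)
  qed (use p.pow_map[of 2] in simp_all)
  then show "additive_morphism X (tan_of_bundle X B) B (tan_p X (tot B)) (tan_p X (bas B))"
    using b tan_p_natural[of "pls B" "pw B 2" "tot B"] tan_p_natural[of "zer B" "bas B" "tot B"]
    by (simp add: additive_morphism_def)
qed

text \<open>Being additive, \<open>p\<close> sends \<open>0\<pi>\<^sub>0 + \<lambda>\<pi>\<^sub>1\<close> to \<open>\<pi>\<^sub>0 + 0\<close>.  So \<open>\<alpha>\<^sub>W\<close> is a map over \<open>E\<close> and has fibre powers.\<close>

lemma p_Ind_al_W: "tan_p X (tot B) \<cdot> Ind_al_W X B = pj B 2 0"
proof -
  interpret p: additive_map X "tan_of_bundle X B" B "tan_p X (tot B)" "tan_p X (bas B)"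
    by (rule additive_map_p)
  have o: "TB.over (tan_zero X (bas B) \<cdot> st X B 2) (tan_zero X (tot B) \<cdot> pj B 2 0)"
    "TB.over (tan_zero X (bas B) \<cdot> st X B 2) (lft B \<cdot> pj B 2 1)"
    by (rule over_tan_zero over_lft; simp)+
  have "tan_p X (tot B) \<cdot> Ind_al_W X B =
     fsum X B (tan_p X (tot B) \<cdot> (tan_zero X (tot B) \<cdot> pj B 2 0)) (tan_p X (tot B) \<cdot> (lft B \<cdot> pj B 2 1))"
    unfolding Ind_al_W_fsum by (rule p.f_fsum[OF o])
  also have "tan_p X (tot B) \<cdot> (tan_zero X (tot B) \<cdot> pj B 2 0) = pj B 2 0"
    by (simp add: Cmp_reassoc[OF tan_p_zero])
  also have "tan_p X (tot B) \<cdot> (lft B \<cdot> pj B 2 1) = zer B \<cdot> st X B 2"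
    by (simp add: Cmp_reassoc[OF p_lft] del: One_nat_def)
  also have "fsum X B (pj B 2 0) (zer B \<cdot> st X B 2) = pj B 2 0"
    by (rule fsum_zer_right) simp
  finally show ?thesis .
qed

lemma Ind_al_pw1:
  shows Ind_al_pw1_Arr [simp]: "Ind_al_pw1 X B k \<in> Arr X"
    and Dom_Ind_al_pw1 [simp]: "Dom X (Ind_al_pw1 X B k) = pw B (Suc k)"
    and Cod_Ind_al_pw1 [simp]: "Cod X (Ind_al_pw1 X B k) = act X (weil_pw k) (tot B)"
    and pow_p_Ind_al_pw1: "pow_p k (tot B) \<cdot> Ind_al_pw1 X B k = pj B (Suc k) 0"
    and proj_Ind_al_pw1: "i \<in> {1..k} \<Longrightarrow> actT X (weil_proj k i) (tot B) \<cdot> Ind_al_pw1 X B k =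
        Ind_al_W X B \<cdot> fpair X B (pj B (Suc k) 0) (pj B (Suc k) i)"
proof -
  let ?P = "\<lambda>h. h \<in> Hom X (pw B (Suc k)) (act X (weil_pw k) (tot B)) \<and>
     actT X (weil_aug (weil_pw k)) (tot B) \<cdot> h = aunit X (tot B) \<cdot> pj B (Suc k) 0 \<and>
     (\<forall>i\<in>{1..k}. actT X (weil_proj k i) (tot B) \<cdot> h =
        Ind_al_W X B \<cdot> fpair X B (pj B (Suc k) 0) (pj B (Suc k) i))"
  let ?Q = "\<lambda>h. h \<in> Hom X (pw B (Suc k)) (act X (weil_pw k) (tot B)) \<and>
     pow_p k (tot B) \<cdot> h = pj B (Suc k) 0 \<and>
     (\<forall>i\<in>{1..k}. actT X (weil_proj k i) (tot B) \<cdot> h =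
        Ind_al_W X B \<cdot> fpair X B (pj B (Suc k) 0) (pj B (Suc k) i))"
  have PQ: "?P h \<longleftrightarrow> ?Q h" for h
    using aunit_cancel[of "tot B" h k "pj B (Suc k) 0"] by auto
  have fp: "over (st X B (Suc k)) (pj B (Suc k) 0)" "i < Suc k \<Longrightarrow> over (st X B (Suc k)) (pj B (Suc k) i)" for i
    by simp_all
  have "\<exists>h. h \<in> Hom X (Dom X (pj B (Suc k) 0)) (act X (weil_pw k) (tot B)) \<and>
     pow_p k (tot B) \<cdot> h = pj B (Suc k) 0 \<and>
     (\<forall>j<k. actT X (weil_proj k (Suc j)) (tot B) \<cdot> h =
        Ind_al_W X B \<cdot> fpair X B (pj B (Suc k) 0) (pj B (Suc k) (Suc j)))"
  proof (rule fibre_power_lift[OF fibre_power_T])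
    fix j assume "j < k"
    then have "Suc j < Suc k" by simp
    note i = fpair[OF fp(1) fp(2)[OF this]]
    show "Ind_al_W X B \<cdot> fpair X B (pj B (Suc k) 0) (pj B (Suc k) (Suc j)) \<in>
       Hom X (Dom X (pj B (Suc k) 0)) (Dom X (tan_p X (tot B)))"
      using i by simp
    show "tan_p X (tot B) \<cdot> (Ind_al_W X B \<cdot> fpair X B (pj B (Suc k) 0) (pj B (Suc k) (Suc j))) = pj B (Suc k) 0"
      using i by (simp add: Cmp_reassoc[OF p_Ind_al_W])
  qed simp_all
  then obtain h where h: "h \<in> Hom X (Dom X (pj B (Suc k) 0)) (act X (weil_pw k) (tot B))"
     "pow_p k (tot B) \<cdot> h = pj B (Suc k) 0"
     "\<And>j. j < k \<Longrightarrow> actT X (weil_proj k (Suc j)) (tot B) \<cdot> h =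
        Ind_al_W X B \<cdot> fpair X B (pj B (Suc k) 0) (pj B (Suc k) (Suc j))" by blast
  have "actT X (weil_proj k i) (tot B) \<cdot> h = Ind_al_W X B \<cdot> fpair X B (pj B (Suc k) 0) (pj B (Suc k) i)"
    if "i \<in> {1..k}" for i
  proof -
    have "i - 1 < k" "Suc (i - 1) = i" using that by auto
    then show ?thesis using h(3)[of "i - 1"] by simp
  qed
  then have hQ: "?Q h" using h by simp
  have "?P (Ind_al_pw1 X B k)"
    unfolding Ind_al_pw1_def
  proof (rule theI[of ?P h])
    show "?P h" unfolding PQ by (rule hQ)
    fix m assume "?P m"
    then have "?Q m" unfolding PQ .
    then show "m = h" using hQ by (intro T_eqI[of m "pw B (Suc k)" k "tot B" h]) simp_all
  qed
  then have "?Q (Ind_al_pw1 X B k)" unfolding PQ .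
  then show "Ind_al_pw1 X B k \<in> Arr X" "Dom X (Ind_al_pw1 X B k) = pw B (Suc k)"
    "Cod X (Ind_al_pw1 X B k) = act X (weil_pw k) (tot B)" "pow_p k (tot B) \<cdot> Ind_al_pw1 X B k = pj B (Suc k) 0"
    "i \<in> {1..k} \<Longrightarrow> actT X (weil_proj k i) (tot B) \<cdot> Ind_al_pw1 X B k =
        Ind_al_W X B \<cdot> fpair X B (pj B (Suc k) 0) (pj B (Suc k) i)"
    by simp_all
qed

text \<open>This is what makes the cone defining \<open>\<alpha>\<close> at \<open>W\<^sup>k\<close> and \<open>\<nat>\<^sup>l\<close> a cone over \<open>T\<^bsub>W\<^sup>k\<^esub> M\<close>.\<close>

lemma prj_Ind_al_pw1: "actA X (weil_pw k) (prj B) \<cdot> Ind_al_pw1 X B k = pow_zero k (bas B) \<cdot> st X B (Suc k)"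
proof (rule T_eqI[of _ "pw B (Suc k)" k "bas B"])
  show "pow_p k (bas B) \<cdot> (actA X (weil_pw k) (prj B) \<cdot> Ind_al_pw1 X B k) =
      pow_p k (bas B) \<cdot> (pow_zero k (bas B) \<cdot> st X B (Suc k))"
    by (simp add: Cmp_reassoc[OF pow_p_natural[of "prj B" "tot B" "bas B"]] pow_p_Ind_al_pw1 Cmp_reassoc[OF pow_p_pow_zero])
  fix i assume i: "i \<in> {1..k}"
  then have o: "over (st X B (Suc k)) (pj B (Suc k) 0)" "over (st X B (Suc k)) (pj B (Suc k) i)"
    by simp_all
  note pr = fpair[OF o]
  have "actT X (weil_proj k i) (bas B) \<cdot> (actA X (weil_pw k) (prj B) \<cdot> Ind_al_pw1 X B k) =
     tan_arr X (prj B) \<cdot> (actT X (weil_proj k i) (tot B) \<cdot> Ind_al_pw1 X B k)"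
    using Cmp_reassoc[OF actT_natural[of "weil_proj k i" "prj B" "weil_pw k" weil_W "tot B" "bas B"]]
      Cmp_reassoc[OF actT_natural[of "weil_proj k i" "prj B" "weil_pw k" weil_W "tot B" "bas B", symmetric]]
    by (simp add: tan_arr_def)
  also have "\<dots> = tan_zero X (bas B) \<cdot> st X B (Suc k)"
    using pr by (simp add: proj_Ind_al_pw1[OF i] Cmp_reassoc[OF prj_Ind_al_W])
  also have "\<dots> = actT X (weil_proj k i) (bas B) \<cdot> (pow_zero k (bas B) \<cdot> st X B (Suc k))"
    by (simp add: Cmp_reassoc[OF proj_pow_zero])
  finally show "actT X (weil_proj k i) (bas B) \<cdot> (actA X (weil_pw k) (prj B) \<cdot> Ind_al_pw1 X B k) =
     actT X (weil_proj k i) (bas B) \<cdot> (pow_zero k (bas B) \<cdot> st X B (Suc k))" .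
qed simp_all

lemma pw_fibre_power: "fibre_power X (actA X (weil_pw k) (prj B)) n (act X (weil_pw k) (pw B n))
    (actA X (weil_pw k) (st X B n)) (\<lambda>j. actA X (weil_pw k) (pj B n j))"
  using tan_fibre_power[of n] by (intro actA_fibre_power[OF fibre_power]) simp

text \<open>Existence needs that \<open>T\<^bsub>W\<^sup>k\<^esub>\<close> preserves \<open>E\<^sub>l\<close>.  The components form a
  cone because every matrix acts by a map over the base.\<close>

lemma Ind_al_pw:
  shows Ind_al_pw_Arr [simp]: "Ind_al_pw X B k l \<in> Arr X"
    and Dom_Ind_al_pw [simp]: "Dom X (Ind_al_pw X B k l) = pw B (Suc k * l)"
    and Cod_Ind_al_pw [simp]: "Cod X (Ind_al_pw X B k l) = act X (weil_pw k) (pw B l)"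
    and st_Ind_al_pw: "actA X (weil_pw k) (st X B l) \<cdot> Ind_al_pw X B k l = pow_zero k (bas B) \<cdot> st X B (Suc k * l)"
    and pj_Ind_al_pw: "j < l \<Longrightarrow> actA X (weil_pw k) (pj B l j) \<cdot> Ind_al_pw X B k l =
         Ind_al_pw1 X B k \<cdot> Ind_fm X B (actA Nmat (weil_pw k) (mat 1 l (\<lambda>(_, i). if i = j then 1 else 0)))"
proof -
  let ?M = "\<lambda>j. actA Nmat (weil_pw k) (mat 1 l (\<lambda>(_, i). if i = j then 1 else 0))"
  let ?O = "actA Nmat (weil_pw k) (0\<^sub>m 0 l)"
  have O: "Ind_fm X B ?O = st X B (Suc k * l)"
    using st_Ind_fm[of ?O] Cod_Ind_fm[of ?O] by (simp del: st_Ind_fm)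
  have M: "Dom X (Ind_fm X B (?M j)) = pw B (Suc k * l)" "Cod X (Ind_fm X B (?M j)) = pw B (Suc k)"
    "st X B (Suc k) \<cdot> Ind_fm X B (?M j) = st X B (Suc k * l)" for j
    using st_Ind_fm[of "?M j"] by (simp_all del: st_Ind_fm)
  let ?P = "\<lambda>h. h \<in> Hom X (pw B (act Nmat (weil_pw k) l)) (act X (weil_pw k) (pw B l)) \<and>
       actA X (weil_pw k) (st X B l) \<cdot> h = Ind_al_pw0 X B k \<cdot> Ind_fm X B ?O \<and>
       (\<forall>j<l. actA X (weil_pw k) (pj B l j) \<cdot> h = Ind_al_pw1 X B k \<cdot> Ind_fm X B (?M j))"
  have "\<exists>h. h \<in> Hom X (Dom X (pow_zero k (bas B) \<cdot> st X B (Suc k * l))) (act X (weil_pw k) (pw B l)) \<and>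
       actA X (weil_pw k) (st X B l) \<cdot> h = pow_zero k (bas B) \<cdot> st X B (Suc k * l) \<and>
       (\<forall>j<l. actA X (weil_pw k) (pj B l j) \<cdot> h = Ind_al_pw1 X B k \<cdot> Ind_fm X B (?M j))"
  proof (rule fibre_power_lift[OF pw_fibre_power])
    fix j
    show "actA X (weil_pw k) (prj B) \<cdot> (Ind_al_pw1 X B k \<cdot> Ind_fm X B (?M j)) = pow_zero k (bas B) \<cdot> st X B (Suc k * l)"
      using M[of j] Cmp_reassoc[OF prj_Ind_al_pw1, of k "Ind_fm X B (?M j)"] by (simp del: mult_Suc)
  qed (simp_all add: M del: mult_Suc)
  then obtain h where h: "?P h" by (auto simp: O simp del: mult_Suc)
  have "?P (Ind_al_pw X B k l)"
    unfolding Ind_al_pw_def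
  proof (rule theI[of ?P, OF h])
    fix m assume m: "?P m"
    have H: "m \<in> Hom X (pw B (act Nmat (weil_pw k) l)) (act X (weil_pw k) (pw B l))"
      "h \<in> Hom X (pw B (act Nmat (weil_pw k) l)) (act X (weil_pw k) (pw B l))"
      using m h by blast+
    have s: "actA X (weil_pw k) (st X B l) \<cdot> m = actA X (weil_pw k) (st X B l) \<cdot> h"
      using m h by metis
    have p: "actA X (weil_pw k) (pj B l j) \<cdot> m = actA X (weil_pw k) (pj B l j) \<cdot> h" if "j < l" for j
      using m h that by metis
    show "m = h"
      by (rule fibre_power_eqI[OF pw_fibre_power H s p])
  qed
  then show "Ind_al_pw X B k l \<in> Arr X" "Dom X (Ind_al_pw X B k l) = pw B (Suc k * l)"
    "Cod X (Ind_al_pw X B k l) = act X (weil_pw k) (pw B l)"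
    "actA X (weil_pw k) (st X B l) \<cdot> Ind_al_pw X B k l = pow_zero k (bas B) \<cdot> st X B (Suc k * l)"
    "j < l \<Longrightarrow> actA X (weil_pw k) (pj B l j) \<cdot> Ind_al_pw X B k l = Ind_al_pw1 X B k \<cdot> Ind_fm X B (?M j)"
    by (simp_all add: O del: mult_Suc)
qed

lemma Ind_al_tensors [simp]:
  shows Ind_al_tensors_Arr: "Ind_al_tensors X B ks l \<in> Arr X"
    and Dom_Ind_al_tensors: "Dom X (Ind_al_tensors X B ks l) = pw B (weil_dim (weil_tensors ks) * l)"
    and Cod_Ind_al_tensors: "Cod X (Ind_al_tensors X B ks l) = act X (weil_tensors ks) (pw B l)"
proof (induction ks)
  case (Cons k ks)
  case 1 show ?case using Cons by simp
  case 2 show ?case using Cons by (simp add: weil_dim_tensor mult.assoc del: mult_Suc)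
  case 3 show ?case using Cons by simp
qed simp_all

end


section \<open>Linear morphisms\<close>

locale linear_dbundle_map = dbundle_map X B B' f g
  for X :: "('o, 'a, 'z) actegory_scheme" (structure)
    and B B' :: "('o, 'a) diff_bundle" and f g :: 'a +
  assumes linear: "lft B' \<cdot> f = tan_arr X f \<cdot> lft B"
begin

text \<open>From \<open>p \<lambda> = \<zeta> q\<close> on both bundles, linearity and naturality of \<open>p\<close> one gets
  \<open>\<zeta>' g q = f \<zeta> q\<close>, and \<open>q\<close> is split by \<open>\<zeta>\<close>.\<close>

lemma f_zer: "f \<cdot> zer B = zer B' \<cdot> g"
proof -
  have "zer B' \<cdot> (g \<cdot> prj B) = (zer B' \<cdot> prj B') \<cdot> f"
    by (simp add: prj_f)
  also have "\<dots> = tan_p X (tot B') \<cdot> (lft B' \<cdot> f)"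
    using Cmp_reassoc[OF B'.p_lft, of f] by simp
  also have "\<dots> = f \<cdot> (tan_p X (tot B) \<cdot> lft B)"
    using Cmp_reassoc[OF tan_p_natural[of f "tot B" "tot B'"], of "lft B"] by (simp add: linear)
  finally have "zer B' \<cdot> (g \<cdot> prj B) = f \<cdot> (zer B \<cdot> prj B)" by (simp add: B.p_lft)
  then have "(zer B' \<cdot> (g \<cdot> prj B)) \<cdot> zer B = (f \<cdot> (zer B \<cdot> prj B)) \<cdot> zer B" by simp
  then show ?thesis by simp
qed

text \<open>As \<open>\<lambda>'\<close> is monic, both sides may be composed with it.  By linearity the equation then involves
  only the lifts of the summands and the sum of tangent vectors, which is natural in \<open>f\<close>.\<close>

lemma f_pls: "f \<cdot> pls B = pls B' \<cdot> pow_map X B B' f g 2"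
proof (rule B'.lft_monic[of _ "pw B 2"])
  interpret L: bundle_map X B "tan_bundle X (tot B)" "lft B" "zer B"
    by unfold_locales (use B.lft_add_p in \<open>simp add: additive_morphism_def\<close>)
  interpret L': bundle_map X B' "tan_bundle X (tot B')" "lft B'" "zer B'"
    by unfold_locales (use B'.lft_add_p in \<open>simp add: additive_morphism_def\<close>)
  note [simp] = tan_bundle_pw
  let ?u = "pow_map X B (tan_bundle X (tot B)) (lft B) (zer B) 2"
  let ?u' = "pow_map X B' (tan_bundle X (tot B')) (lft B') (zer B') 2"
  have u [simp]: "?u \<in> Arr X" "Dom X ?u = pw B 2" "Cod X ?u = act X (weil_pw 2) (tot B)"
    "j < 2 \<Longrightarrow> actT X (weil_proj 2 (Suc j)) (tot B) \<cdot> ?u = lft B \<cdot> pj B 2 j" for j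
    using L.pow_map[of 2] L.pj_pow_map[of j 2] by (simp_all add: tan_bundle_pw)
  have u' [simp]: "?u' \<in> Arr X" "Dom X ?u' = pw B' 2" "Cod X ?u' = act X (weil_pw 2) (tot B')"
    "j < 2 \<Longrightarrow> actT X (weil_proj 2 (Suc j)) (tot B') \<cdot> ?u' = lft B' \<cdot> pj B' 2 j" for j
    using L'.pow_map[of 2] L'.pj_pow_map[of j 2] by (simp_all add: tan_bundle_pw)
  have l: "lft B \<cdot> pls B = tan_plus X (tot B) \<cdot> ?u" "lft B' \<cdot> pls B' = tan_plus X (tot B') \<cdot> ?u'"
    using B.lft_add_p B'.lft_add_p by (simp_all add: additive_morphism_def)
  have e: "actA X (weil_pw 2) f \<cdot> ?u = ?u' \<cdot> pow_map X B B' f g 2"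
  proof (rule B'.PB.pw_eqI_pos[of _ "pw B 2" 2])
    fix j :: nat assume j: "j < 2"
    have "actT X (weil_proj 2 (Suc j)) (tot B') \<cdot> (actA X (weil_pw 2) f \<cdot> ?u) =
       tan_arr X f \<cdot> (actT X (weil_proj 2 (Suc j)) (tot B) \<cdot> ?u)"
      unfolding tan_arr_def
      by (subst (1 2) Cmp_assoc[symmetric])
        (simp_all add: actT_natural[of "weil_proj 2 (Suc j)" f "weil_pw 2" weil_W "tot B" "tot B'"] tan_bundle_pw del: u(4) Cmp_assoc)
    also have "\<dots> = (tan_arr X f \<cdot> lft B) \<cdot> pj B 2 j"
      using j by simp
    also have "\<dots> = lft B' \<cdot> (pj B' 2 j \<cdot> pow_map X B B' f g 2)"
      unfolding linear[symmetric] using j by simp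
    also have "\<dots> = actT X (weil_proj 2 (Suc j)) (tot B') \<cdot> (?u' \<cdot> pow_map X B B' f g 2)"
      using j Cmp_reassoc[OF u'(4), of j "pow_map X B B' f g 2"] by simp
    finally show "pj (tan_bundle X (tot B')) 2 j \<cdot> (actA X (weil_pw 2) f \<cdot> ?u) =
       pj (tan_bundle X (tot B')) 2 j \<cdot> (?u' \<cdot> pow_map X B B' f g 2)" by simp
  qed (simp_all add: tan_bundle_pw)
  have "lft B' \<cdot> (f \<cdot> pls B) = tan_arr X f \<cdot> (tan_plus X (tot B) \<cdot> ?u)"
    using Cmp_reassoc[OF linear, of "pls B"] by (simp add: l)
  also have "\<dots> = tan_plus X (tot B') \<cdot> (actA X (weil_pw 2) f \<cdot> ?u)"
    unfolding tan_plus_def tan_arr_def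
    using Cmp_reassoc[OF actT_natural[of weil_plus f "weil_pw 2" weil_W "tot B" "tot B'"], of ?u] by simp
  also have "\<dots> = lft B' \<cdot> (pls B' \<cdot> pow_map X B B' f g 2)"
    unfolding e using Cmp_reassoc[OF l(2), of "pow_map X B B' f g 2"] by simp
  finally show "lft B' \<cdot> (f \<cdot> pls B) = lft B' \<cdot> (pls B' \<cdot> pow_map X B B' f g 2)" .
qed simp_all

lemma additive: "additive_morphism X B B' f g"
  using bundle_morphism f_pls f_zer by (simp add: additive_morphism_def)

end

sublocale linear_dbundle_map \<subseteq> additive_dbundle_map X B B' f g
  by unfold_locales (rule additive)

context linear_dbundle_map
begin

lemma Ind_al_W_natural: "tan_arr X f \<cdot> Ind_al_W X B = Ind_al_W X B' \<cdot> pow_map X B B' f g 2"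
proof -
  interpret T: additive_map X "tan_of_bundle X B" "tan_of_bundle X B'" "tan_arr X f" "tan_arr X g"
    by (rule additive_map_tan)
  have o: "B.TB.over (tan_zero X (bas B) \<cdot> st X B 2) (tan_zero X (tot B) \<cdot> pj B 2 0)"
    "B.TB.over (tan_zero X (bas B) \<cdot> st X B 2) (lft B \<cdot> pj B 2 1)"
    by (rule B.over_tan_zero B.over_lft; simp)+
  have o': "B'.TB.over (tan_zero X (bas B') \<cdot> st X B' 2) (tan_zero X (tot B') \<cdot> pj B' 2 0)"
    "B'.TB.over (tan_zero X (bas B') \<cdot> st X B' 2) (lft B' \<cdot> pj B' 2 1)"
    by (rule B'.over_tan_zero B'.over_lft; simp)+
  have "tan_arr X f \<cdot> Ind_al_W X B = fsum X (tan_of_bundle X B') (tan_arr X f \<cdot> (tan_zero X (tot B) \<cdot> pj B 2 0))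
      (tan_arr X f \<cdot> (lft B \<cdot> pj B 2 1))"
    unfolding B.Ind_al_W_fsum by (rule T.f_fsum[OF o])
  also have "tan_arr X f \<cdot> (tan_zero X (tot B) \<cdot> pj B 2 0) = (tan_zero X (tot B') \<cdot> pj B' 2 0) \<cdot> pow_map X B B' f g 2"
    using Cmp_reassoc[OF tan_zero_natural[of f "tot B" "tot B'"], of "pj B 2 0"] by simp
  also have "tan_arr X f \<cdot> (lft B \<cdot> pj B 2 1) = (lft B' \<cdot> pj B' 2 1) \<cdot> pow_map X B B' f g 2"
    using Cmp_reassoc[OF linear[symmetric], of "pj B 2 1"] by simp
  also have "fsum X (tan_of_bundle X B') ((tan_zero X (tot B') \<cdot> pj B' 2 0) \<cdot> pow_map X B B' f g 2)
       ((lft B' \<cdot> pj B' 2 1) \<cdot> pow_map X B B' f g 2) = Ind_al_W X B' \<cdot> pow_map X B B' f g 2"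
    unfolding B'.Ind_al_W_fsum by (rule B'.TB.fsum_Cmp[OF o', symmetric]) simp_all
  finally show ?thesis .
qed

lemma Ind_al_pw1_natural:
  "actA X (weil_pw k) f \<cdot> Ind_al_pw1 X B k = Ind_al_pw1 X B' k \<cdot> pow_map X B B' f g (Suc k)"
proof (rule T_eqI[of _ "pw B (Suc k)" k "tot B'"])
  show "pow_p k (tot B') \<cdot> (actA X (weil_pw k) f \<cdot> Ind_al_pw1 X B k) =
      pow_p k (tot B') \<cdot> (Ind_al_pw1 X B' k \<cdot> pow_map X B B' f g (Suc k))"
    by (simp add: Cmp_reassoc[OF pow_p_natural[of f "tot B" "tot B'"]] B.pow_p_Ind_al_pw1 Cmp_reassoc[OF B'.pow_p_Ind_al_pw1])
  fix i assume i: "i \<in> {1..k}"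
  then have o: "B.over (st X B (Suc k)) (pj B (Suc k) 0)" "B.over (st X B (Suc k)) (pj B (Suc k) i)"
    and o': "B'.over (st X B' (Suc k)) (pj B' (Suc k) 0)" "B'.over (st X B' (Suc k)) (pj B' (Suc k) i)"
    by simp_all
  note pr = B.fpair[OF o] and pr' = B'.fpair[OF o']
  have "fpair X B' (pj B' (Suc k) 0) (pj B' (Suc k) i) \<cdot> pow_map X B B' f g (Suc k) =
      fpair X B' (pj B' (Suc k) 0 \<cdot> pow_map X B B' f g (Suc k)) (pj B' (Suc k) i \<cdot> pow_map X B B' f g (Suc k))"
    by (rule B'.fpair_Cmp[OF o']) simp_all
  also have "\<dots> = pow_map X B B' f g 2 \<cdot> fpair X B (pj B (Suc k) 0) (pj B (Suc k) i)"
    using i by (simp add: pow_map_fpair[OF o])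
  finally have e: "fpair X B' (pj B' (Suc k) 0) (pj B' (Suc k) i) \<cdot> pow_map X B B' f g (Suc k) =
     pow_map X B B' f g 2 \<cdot> fpair X B (pj B (Suc k) 0) (pj B (Suc k) i)" .
  have "actT X (weil_proj k i) (tot B') \<cdot> (actA X (weil_pw k) f \<cdot> Ind_al_pw1 X B k) =
     tan_arr X f \<cdot> (actT X (weil_proj k i) (tot B) \<cdot> Ind_al_pw1 X B k)"
    using Cmp_reassoc[OF actT_natural[of "weil_proj k i" f "weil_pw k" weil_W "tot B" "tot B'", symmetric], of "Ind_al_pw1 X B k"]
    by (simp add: tan_arr_def)
  also have "\<dots> = Ind_al_W X B' \<cdot> (fpair X B' (pj B' (Suc k) 0) (pj B' (Suc k) i) \<cdot> pow_map X B B' f g (Suc k))"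
    unfolding e using pr Cmp_reassoc[OF Ind_al_W_natural, of "fpair X B (pj B (Suc k) 0) (pj B (Suc k) i)"]
    by (simp add: B.proj_Ind_al_pw1[OF i])
  also have "\<dots> = actT X (weil_proj k i) (tot B') \<cdot> (Ind_al_pw1 X B' k \<cdot> pow_map X B B' f g (Suc k))"
    using pr' Cmp_reassoc[OF B'.proj_Ind_al_pw1[OF i], of "pow_map X B B' f g (Suc k)"] by simp
  finally show "actT X (weil_proj k i) (tot B') \<cdot> (actA X (weil_pw k) f \<cdot> Ind_al_pw1 X B k) =
      actT X (weil_proj k i) (tot B') \<cdot> (Ind_al_pw1 X B' k \<cdot> pow_map X B B' f g (Suc k))" .
qed simp_all

lemma Ind_al_pw_natural:
  "actA X (weil_pw k) (pow_map X B B' f g l) \<cdot> Ind_al_pw X B k l = Ind_al_pw X B' k l \<cdot> pow_map X B B' f g (Suc k * l)"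
proof (rule fibre_power_eqI[OF B'.pw_fibre_power, of _ "pw B (Suc k * l)"])
  let ?\<phi> = "pow_map X B B' f g"
  have "actA X (weil_pw k) (st X B' l) \<cdot> (actA X (weil_pw k) (?\<phi> l) \<cdot> Ind_al_pw X B k l) =
     actA X (weil_pw k) (g \<cdot> st X B l) \<cdot> Ind_al_pw X B k l"
    by (subst Cmp_reassoc[OF actA_Cmp[symmetric]]) (simp_all del: mult_Suc)
  also have "\<dots> = (actA X (weil_pw k) g \<cdot> pow_zero k (bas B)) \<cdot> st X B (Suc k * l)"
    by (simp add: actA_Cmp B.st_Ind_al_pw del: mult_Suc)
  also have "\<dots> = pow_zero k (bas B') \<cdot> (g \<cdot> st X B (Suc k * l))"
    by (subst pow_zero_natural[of g "bas B" "bas B'"]) (simp_all del: mult_Suc)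
  also have "\<dots> = actA X (weil_pw k) (st X B' l) \<cdot> (Ind_al_pw X B' k l \<cdot> ?\<phi> (Suc k * l))"
    using Cmp_reassoc[OF B'.st_Ind_al_pw, of k l "?\<phi> (Suc k * l)"] by (simp del: mult_Suc)
  finally show "actA X (weil_pw k) (st X B' l) \<cdot> (actA X (weil_pw k) (?\<phi> l) \<cdot> Ind_al_pw X B k l) =
     actA X (weil_pw k) (st X B' l) \<cdot> (Ind_al_pw X B' k l \<cdot> ?\<phi> (Suc k * l))" .
  fix j assume j: "j < l"
  let ?M = "actA Nmat (weil_pw k) (mat 1 l (\<lambda>(_, i). if i = j then 1 else 0))"
  have M: "Ind_fm X B' ?M \<cdot> ?\<phi> (Suc k * l) = ?\<phi> (Suc k) \<cdot> Ind_fm X B ?M"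
    using pow_map_natural[of ?M] by (simp del: mult_Suc)
  have "actA X (weil_pw k) (pj B' l j) \<cdot> (actA X (weil_pw k) (?\<phi> l) \<cdot> Ind_al_pw X B k l) =
     actA X (weil_pw k) (f \<cdot> pj B l j) \<cdot> Ind_al_pw X B k l"
    using j by (subst Cmp_reassoc[OF actA_Cmp[symmetric]]) (simp_all del: mult_Suc)
  also have "\<dots> = (actA X (weil_pw k) f \<cdot> Ind_al_pw1 X B k) \<cdot> Ind_fm X B ?M"
    using j by (simp add: actA_Cmp B.pj_Ind_al_pw del: mult_Suc)
  also have "\<dots> = Ind_al_pw1 X B' k \<cdot> (?\<phi> (Suc k) \<cdot> Ind_fm X B ?M)"
    unfolding Ind_al_pw1_natural by (simp del: mult_Suc)
  also have "\<dots> = (Ind_al_pw1 X B' k \<cdot> Ind_fm X B' ?M) \<cdot> ?\<phi> (Suc k * l)"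
    unfolding M[symmetric] by (simp del: mult_Suc)
  also have "\<dots> = actA X (weil_pw k) (pj B' l j) \<cdot> (Ind_al_pw X B' k l \<cdot> ?\<phi> (Suc k * l))"
    unfolding B'.pj_Ind_al_pw[OF j, symmetric] using j by (simp del: mult_Suc)
  finally show "actA X (weil_pw k) (pj B' l j) \<cdot> (actA X (weil_pw k) (?\<phi> l) \<cdot> Ind_al_pw X B k l) =
     actA X (weil_pw k) (pj B' l j) \<cdot> (Ind_al_pw X B' k l \<cdot> ?\<phi> (Suc k * l))" .
qed (simp_all del: mult_Suc)

lemma Ind_al_tensors_natural:
  "actA X (weil_tensors ks) (pow_map X B B' f g l) \<cdot> Ind_al_tensors X B ks l =
   Ind_al_tensors X B' ks l \<cdot> pow_map X B B' f g (weil_dim (weil_tensors ks) * l)"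
proof (induction ks)
  case Nil
  show ?case using aunit_natural[of "pow_map X B B' f g l"] by simp
next
  case (Cons k ks)
  let ?\<phi> = "pow_map X B B' f g" and ?W = "weil_pw k" and ?T = "weil_tensors ks"
  let ?m = "weil_dim ?T * l" and ?a = "Ind_al_tensors X B ks l" and ?a' = "Ind_al_tensors X B' ks l"
  have d: "weil_dim (weil_tensor ?W ?T) * l = Suc k * ?m"
    by (simp add: weil_dim_tensor mult.assoc del: mult_Suc)
  have "actA X (weil_tensor ?W ?T) (?\<phi> l) \<cdot> Ind_al_tensors X B (k # ks) l =
     (actA X (weil_tensor ?W ?T) (?\<phi> l) \<cdot> amult X ?W ?T (pw B l)) \<cdot> (actA X ?W ?a \<cdot> Ind_al_pw X B k ?m)"
    by (simp del: mult_Suc)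
  also have "\<dots> = amult X ?W ?T (pw B' l) \<cdot> (actA X ?W (actA X ?T (?\<phi> l) \<cdot> ?a) \<cdot> Ind_al_pw X B k ?m)"
    by (subst amult_natural[symmetric, of _ _ _ "pw B l" "pw B' l"]) (simp_all add: actA_Cmp del: mult_Suc)
  also have "\<dots> = amult X ?W ?T (pw B' l) \<cdot> (actA X ?W ?a' \<cdot> (actA X ?W (?\<phi> ?m) \<cdot> Ind_al_pw X B k ?m))"
    unfolding Cons.IH by (simp add: actA_Cmp del: mult_Suc)
  also have "\<dots> = Ind_al_tensors X B' (k # ks) l \<cdot> ?\<phi> (Suc k * ?m)"
    unfolding Ind_al_pw_natural by (simp del: mult_Suc)
  finally show ?case by (simp only: weil_tensors_simps d)
qed

text \<open>The outer factor is the action of a morphism of Weil algebras, natural in \<open>f\<^sub>l\<close>; the inner one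
  is the functor applied to a matrix, where the additive case applies.\<close>

lemma Ind_al_natural:
  assumes A: "A \<in> Obj Weil"
  shows "Ind_al X B' A l \<cdot> pow_map X B B' f g (weil_dim A * l) = actA X A (pow_map X B B' f g l) \<cdot> Ind_al X B A l"
proof -
  let ?\<phi> = "pow_map X B B' f g" and ?T = "weil_tensors (weil_sizes A)" and ?M = "actT Nmat (weil_to_tensors A) l"
  have M: "Ind_fm X B' ?M \<cdot> ?\<phi> (weil_dim A * l) = ?\<phi> (weil_dim ?T * l) \<cdot> Ind_fm X B ?M"
    using pow_map_natural[of ?M] by simp
  have "actA X A (?\<phi> l) \<cdot> Ind_al X B A l =
     (actA X A (?\<phi> l) \<cdot> actT X (weil_from_tensors A) (pw B l)) \<cdot> (Ind_al_tensors X B (weil_sizes A) l \<cdot> Ind_fm X B ?M)"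
    using A by (simp add: Ind_al_def)
  also have "\<dots> = actT X (weil_from_tensors A) (pw B' l) \<cdot>
     ((actA X ?T (?\<phi> l) \<cdot> Ind_al_tensors X B (weil_sizes A) l) \<cdot> Ind_fm X B ?M)"
    using A by (subst actT_natural[where A="?T" and y="pw B' l"]) simp_all
  also have "\<dots> = actT X (weil_from_tensors A) (pw B' l) \<cdot>
     (Ind_al_tensors X B' (weil_sizes A) l \<cdot> (?\<phi> (weil_dim ?T * l) \<cdot> Ind_fm X B ?M))"
    unfolding Ind_al_tensors_natural by simp
  also have "\<dots> = Ind_al X B' A l \<cdot> ?\<phi> (weil_dim A * l)"
    unfolding M[symmetric] Ind_al_def using A by simp
  finally show ?thesis by simp
qed

end


section \<open>Functoriality of \<open>Ind\<close>\<close>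

lemma (in power_bundle) pow_map_Id: "pow_map C B B (Id C (tot B)) (Id C (bas B)) n = Id C (pw B n)"
proof -
  interpret bundle_map C B B "Id C (tot B)" "Id C (bas B)"
    by unfold_locales (simp add: bundle_morphism_def)
  show ?thesis by (rule pw_eqI[of _ "pw B n" n]) simp_all
qed

lemma pow_map_Cmp:
  assumes "bundle_map C B B' f g" "bundle_map C B' B'' f' g'"
  shows "pow_map C B B'' (f' \<cdot>\<^bsub>C\<^esub> f) (g' \<cdot>\<^bsub>C\<^esub> g) n = pow_map C B' B'' f' g' n \<cdot>\<^bsub>C\<^esub> pow_map C B B' f g n"
    and bundle_morphism_Cmp: "bundle_morphism C B B'' (f' \<cdot>\<^bsub>C\<^esub> f) (g' \<cdot>\<^bsub>C\<^esub> g)"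
proof -
  interpret F: bundle_map C B B' f g by fact
  interpret F': bundle_map C B' B'' f' g' by fact
  show b: "bundle_morphism C B B'' (f' \<cdot>\<^bsub>C\<^esub> f) (g' \<cdot>\<^bsub>C\<^esub> g)"
    by (simp add: bundle_morphism_def F.Cmp_reassoc[OF F'.prj_f] F.prj_f)
  interpret G: bundle_map C B B'' "f' \<cdot>\<^bsub>C\<^esub> f" "g' \<cdot>\<^bsub>C\<^esub> g"
    by unfold_locales (rule b)
  show "pow_map C B B'' (f' \<cdot>\<^bsub>C\<^esub> f) (g' \<cdot>\<^bsub>C\<^esub> g) n = pow_map C B' B'' f' g' n \<cdot>\<^bsub>C\<^esub> pow_map C B B' f g n"
    by (rule F'.B'.pw_eqI[of _ "pw B n" n]) simp_all
qed

lemma (in abundle) additive_morphism_Id: "additive_morphism C B B (Id C (tot B)) (Id C (bas B))"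
  by (simp add: additive_morphism_def bundle_morphism_def pow_map_Id)

lemma additive_morphism_Cmp:
  assumes "additive_map C B B' f g" "additive_map C B' B'' f' g'"
  shows "additive_morphism C B B'' (f' \<cdot>\<^bsub>C\<^esub> f) (g' \<cdot>\<^bsub>C\<^esub> g)"
proof -
  interpret F: additive_map C B B' f g by fact
  interpret F': additive_map C B' B'' f' g' by fact
  show ?thesis
    using bundle_morphism_Cmp[OF F.bundle_map_axioms F'.bundle_map_axioms]
    by (simp add: additive_morphism_def pow_map_Cmp[OF F.bundle_map_axioms F'.bundle_map_axioms]
        F.f_pls F.f_zer F.Cmp_reassoc[OF F'.f_pls] F.Cmp_reassoc[OF F'.f_zer])
qed

context actegory
begin

lemma dbundleI: "differential_bundle X B \<Longrightarrow> dbundle X B"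
  by (intro dbundle.intro dbundle_axioms.intro abundleI actegory_axioms category)
    (simp_all add: differential_bundle_def)

lemma dbundle_mapI: "differential_bundle X B \<Longrightarrow> differential_bundle X B' \<Longrightarrow> bundle_morphism X B B' f g \<Longrightarrow>
    dbundle_map X B B' f g"
  by (intro dbundle_map.intro bundle_map.intro bundle_map_axioms.intro dbundleI actegory_axioms cat_loc_axioms
      abundle.axioms(1)[OF dbundle.axioms(2)])

lemma additive_mapI: "differential_bundle X B \<Longrightarrow> differential_bundle X B' \<Longrightarrow>
    additive_morphism X B B' f g \<Longrightarrow> additive_map X B B' f g"
  by (intro additive_map.intro additive_map_axioms.intro dbundle_map.axioms(4)[OF dbundle_mapI] dbundle.axioms(2) dbundleI)
    (simp_all add: additive_morphism_def)

lemma linear_dbundle_mapI: "differential_bundle X B \<Longrightarrow> differential_bundle X B' \<Longrightarrow> linear_morphism X B B' f g \<Longrightarrow>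
    linear_dbundle_map X B B' f g"
  by (intro linear_dbundle_map.intro linear_dbundle_map_axioms.intro dbundle_mapI) (simp_all add: linear_morphism_def)

lemma Ind_sel [simp]: "fo (Ind X B) = pw B" "fm (Ind X B) = Ind_fm X B" "al (Ind X B) = Ind_al X B"
  by (simp_all add: Ind_def)

lemma nat_trans_pow_map:
  assumes "differential_bundle X B" "differential_bundle X B'" "additive_morphism X B B' f g"
  shows "nat_trans Nmat X (Ind X B) (Ind X B') (pow_map X B B' f g)"
  using additive_map.natural_pow_map[OF additive_mapI[OF assms]] by (simp add: nat_trans_def)

lemma linear_nat_trans_pow_map:
  assumes "differential_bundle X B" "differential_bundle X B'" "linear_morphism X B B' f g"
  shows "linear_nat_trans Nmat X (Ind X B) (Ind X B') (pow_map X B B' f g)"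
proof -
  interpret linear_dbundle_map X B B' f g by (rule linear_dbundle_mapI[OF assms])
  show ?thesis
    using nat_trans_pow_map[OF assms(1,2) additive] Ind_al_natural by (simp add: linear_nat_trans_def)
qed

lemma linear_morphism_Id: "differential_bundle X B \<Longrightarrow> linear_morphism X B B (Id X (tot B)) (Id X (bas B))"
proof -
  assume "differential_bundle X B"
  then interpret dbundle X B by (rule dbundleI)
  show ?thesis by (simp add: linear_morphism_def bundle_morphism_def)
qed

lemma linear_morphism_Cmp:
  assumes "differential_bundle X B" "differential_bundle X B'" "differential_bundle X B''"
    and "linear_morphism X B B' f g" "linear_morphism X B' B'' f' g'"
  shows "linear_morphism X B B'' (f' \<cdot> f) (g' \<cdot> g)"
proof -
  interpret F: linear_dbundle_map X B B' f g by (rule linear_dbundle_mapI) fact+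
  interpret F': linear_dbundle_map X B' B'' f' g' by (rule linear_dbundle_mapI) fact+
  show ?thesis
    using bundle_morphism_Cmp[OF F.bundle_map_axioms F'.bundle_map_axioms]
    by (simp add: linear_morphism_def tan_arr_Cmp F.linear Cmp_reassoc[OF F'.linear])
qed

text \<open>Stated for any class of morphisms closed under identities and composition, so as to serve the
  additive and the linear case.\<close>

lemma category_DBun:
  assumes Id: "\<And>B. differential_bundle X B \<Longrightarrow> mor B B (Id X (tot B)) (Id X (bas B))"
    and Cmp: "\<And>B B' B'' f g f' g'. differential_bundle X B \<Longrightarrow> differential_bundle X B' \<Longrightarrow>
        differential_bundle X B'' \<Longrightarrow> mor B B' f g \<Longrightarrow> mor B' B'' f' g' \<Longrightarrow> mor B B'' (f' \<cdot> f) (g' \<cdot> g)"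
    and bm: "\<And>B B' f g. mor B B' f g \<Longrightarrow> bundle_morphism X B B' f g"
  shows "category (DBun X mor)"
  using Id Cmp bm
  unfolding category_def DBun_def
  by (auto simp: bundle_morphism_def)

lemma category_DBun_add: "category (DBun_add X)"
  unfolding DBun_add_def
proof (rule category_DBun)
  fix B B' B'' f g f' g'
  show "differential_bundle X B \<Longrightarrow> additive_morphism X B B (Id X (tot B)) (Id X (bas B))"
    by (rule abundle.additive_morphism_Id[OF dbundle.axioms(2)[OF dbundleI]])
  show "differential_bundle X B \<Longrightarrow> differential_bundle X B' \<Longrightarrow> differential_bundle X B'' \<Longrightarrow>
     additive_morphism X B B' f g \<Longrightarrow> additive_morphism X B' B'' f' g' \<Longrightarrow>
     additive_morphism X B B'' (f' \<cdot> f) (g' \<cdot> g)"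
    by (rule additive_morphism_Cmp[OF additive_mapI additive_mapI])
qed (simp add: additive_morphism_def)

lemma category_DBun_lin: "category (DBun_lin X)"
  unfolding DBun_lin_def
proof (rule category_DBun)
  fix B B' B'' f g f' g'
  show "differential_bundle X B \<Longrightarrow> linear_morphism X B B (Id X (tot B)) (Id X (bas B))"
    by (rule linear_morphism_Id)
  show "differential_bundle X B \<Longrightarrow> differential_bundle X B' \<Longrightarrow> differential_bundle X B'' \<Longrightarrow>
     linear_morphism X B B' f g \<Longrightarrow> linear_morphism X B' B'' f' g' \<Longrightarrow>
     linear_morphism X B B'' (f' \<cdot> f) (g' \<cdot> g)"
    by (rule linear_morphism_Cmp)
qed (simp add: linear_morphism_def)

end

lemma category_DiffFun_of:
  assumes X': "category X'"
    and nat: "\<And>F G \<phi>. tr F G \<phi> \<Longrightarrow> nat_trans X X' F G \<phi>"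
    and Id: "\<And>F. lax_differential_functor X X' F \<Longrightarrow> tr F F (\<lambda>x\<in>Obj X. Id X' (fo F x))"
    and Cmp: "\<And>F G H \<phi> \<psi>. lax_differential_functor X X' F \<Longrightarrow> lax_differential_functor X X' G \<Longrightarrow>
        lax_differential_functor X X' H \<Longrightarrow> tr F G \<phi> \<Longrightarrow> tr G H \<psi> \<Longrightarrow> tr F H (\<lambda>x\<in>Obj X. \<psi> x \<cdot>\<^bsub>X'\<^esub> \<phi> x)"
  shows "category (DiffFun_of X X' tr)"
proof -
  interpret X': cat_loc X' by unfold_locales fact
  have tr: "\<phi> x \<in> Arr X'" "Dom X' (\<phi> x) = fo F x" "Cod X' (\<phi> x) = fo G x"
    if "tr F G \<phi>" "x \<in> Obj X" for F G \<phi> x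
    using nat[OF that(1)] that(2) by (auto simp: nat_trans_def natural_transformation_def)
  show ?thesis
    unfolding category_def
  proof (intro conjI ballI impI)
    fix u assume u: "u \<in> Arr (DiffFun_of X X' tr)"
    then obtain F G \<phi> where u': "u = (F, G, \<phi>)" "lax_differential_functor X X' F" "lax_differential_functor X X' G"
       "tr F G \<phi>" "\<phi> \<in> extensional (Obj X)"
      by (auto simp: DiffFun_of_def)
    show "Dom (DiffFun_of X X' tr) u \<in> Obj (DiffFun_of X X' tr)" "Cod (DiffFun_of X X' tr) u \<in> Obj (DiffFun_of X X' tr)"
      using u' by (simp_all add: DiffFun_of_def)
    show "u \<cdot>\<^bsub>DiffFun_of X X' tr\<^esub> Id (DiffFun_of X X' tr) (Dom (DiffFun_of X X' tr) u) = u"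
       "Id (DiffFun_of X X' tr) (Cod (DiffFun_of X X' tr) u) \<cdot>\<^bsub>DiffFun_of X X' tr\<^esub> u = u"
      using u' tr[OF u'(4)] by (auto simp: DiffFun_of_def fun_eq_iff extensional_def)
    fix v assume v: "v \<in> Arr (DiffFun_of X X' tr)" "Dom (DiffFun_of X X' tr) v = Cod (DiffFun_of X X' tr) u"
    then obtain H \<psi> where v': "v = (G, H, \<psi>)" "lax_differential_functor X X' H"
       "tr G H \<psi>"
      using u' by (auto simp: DiffFun_of_def)
    show "v \<cdot>\<^bsub>DiffFun_of X X' tr\<^esub> u \<in> Hom (DiffFun_of X X' tr) (Dom (DiffFun_of X X' tr) u) (Cod (DiffFun_of X X' tr) v)"
      using u' v' Cmp[OF u'(2,3) v'(2) u'(4) v'(3)] by (simp add: DiffFun_of_def)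
    fix w assume w: "w \<in> Arr (DiffFun_of X X' tr)" "Dom (DiffFun_of X X' tr) w = Cod (DiffFun_of X X' tr) v"
    then obtain K \<chi> where w': "w = (H, K, \<chi>)" "tr H K \<chi>"
      using v' by (auto simp: DiffFun_of_def)
    show "w \<cdot>\<^bsub>DiffFun_of X X' tr\<^esub> (v \<cdot>\<^bsub>DiffFun_of X X' tr\<^esub> u) =
        w \<cdot>\<^bsub>DiffFun_of X X' tr\<^esub> v \<cdot>\<^bsub>DiffFun_of X X' tr\<^esub> u"
      using u'(1) v'(1) w'(1) tr[OF u'(4)] tr[OF v'(3)] tr[OF w'(2)]
      by (auto simp: DiffFun_of_def fun_eq_iff)
  next
    fix F assume "F \<in> Obj (DiffFun_of X X' tr)"
    then show "Id (DiffFun_of X X' tr) F \<in> Hom (DiffFun_of X X' tr) F F"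
      using Id by (simp add: DiffFun_of_def)
  qed
qed

lemma nat_trans_Id:
  assumes "lax_differential_functor X X' F"
  shows "nat_trans X X' F F (\<lambda>x\<in>Obj X. Id X' (fo F x))"
proof -
  have F: "is_functor X X' (fo F) (fm F)"
    using assms by (simp add: lax_differential_functor_def oplax_weil_linear_def)
  interpret X: cat_loc X using F by unfold_locales (simp add: is_functor_def)
  interpret X': cat_loc X' using F by unfold_locales (simp add: is_functor_def)
  show ?thesis using F by (simp add: nat_trans_def natural_transformation_def) (simp add: is_functor_def)
qed

lemma nat_trans_Cmp:
  assumes "nat_trans X X' F G \<phi>" "nat_trans X X' G H \<psi>"
  shows "nat_trans X X' F H (\<lambda>x\<in>Obj X. \<psi> x \<cdot>\<^bsub>X'\<^esub> \<phi> x)"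
proof -
  have F: "is_functor X X' (fo F) (fm F)" "is_functor X X' (fo G) (fm G)" "is_functor X X' (fo H) (fm H)"
    and \<phi>: "\<And>x. x \<in> Obj X \<Longrightarrow> \<phi> x \<in> Hom X' (fo F x) (fo G x)"
      "\<And>f. f \<in> Arr X \<Longrightarrow> fm G f \<cdot>\<^bsub>X'\<^esub> \<phi> (Dom X f) = \<phi> (Cod X f) \<cdot>\<^bsub>X'\<^esub> fm F f"
    and \<psi>: "\<And>x. x \<in> Obj X \<Longrightarrow> \<psi> x \<in> Hom X' (fo G x) (fo H x)"
      "\<And>f. f \<in> Arr X \<Longrightarrow> fm H f \<cdot>\<^bsub>X'\<^esub> \<psi> (Dom X f) = \<psi> (Cod X f) \<cdot>\<^bsub>X'\<^esub> fm G f"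
    using assms by (auto simp: nat_trans_def natural_transformation_def)
  interpret X: cat_loc X using F by unfold_locales (simp add: is_functor_def)
  interpret X': cat_loc X' using F by unfold_locales (simp add: is_functor_def)
  have Fm: "fm K f \<in> Arr X'" "Dom X' (fm K f) = fo K (Dom X f)" "Cod X' (fm K f) = fo K (Cod X f)"
    if "is_functor X X' (fo K) (fm K)" "f \<in> Arr X" for K f
    using that by (auto simp: is_functor_def)
  note a = \<phi>(1)[unfolded Hom_iff] \<psi>(1)[unfolded Hom_iff] Fm[OF F(1)] Fm[OF F(2)] Fm[OF F(3)]
  have "fm H f \<cdot>\<^bsub>X'\<^esub> (\<psi> (Dom X f) \<cdot>\<^bsub>X'\<^esub> \<phi> (Dom X f)) = \<psi> (Cod X f) \<cdot>\<^bsub>X'\<^esub> \<phi> (Cod X f) \<cdot>\<^bsub>X'\<^esub> fm F f"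
    if f: "f \<in> Arr X" for f
  proof -
    have "fm H f \<cdot>\<^bsub>X'\<^esub> (\<psi> (Dom X f) \<cdot>\<^bsub>X'\<^esub> \<phi> (Dom X f)) = (\<psi> (Cod X f) \<cdot>\<^bsub>X'\<^esub> fm G f) \<cdot>\<^bsub>X'\<^esub> \<phi> (Dom X f)"
      by (rule X'.Cmp_reassoc[OF \<psi>(2)[OF f]]) (use f a in simp_all)
    also have "\<dots> = \<psi> (Cod X f) \<cdot>\<^bsub>X'\<^esub> (fm G f \<cdot>\<^bsub>X'\<^esub> \<phi> (Dom X f))"
      using f a by simp
    finally show ?thesis using f a by (simp add: \<phi>(2))
  qed
  then show ?thesis
    using F a by (simp add: nat_trans_def natural_transformation_def)
qed

lemma category_DiffFun: "category X' \<Longrightarrow> category (DiffFun X X')"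
  unfolding DiffFun_def by (rule category_DiffFun_of) (auto intro: nat_trans_Id nat_trans_Cmp)

context actegory
begin

lemma al_Hom:
  assumes F: "lax_differential_functor Nmat X F" and A: "A \<in> Obj Weil"
  shows "al F A l \<in> Hom X (fo F (weil_dim A * l)) (act X A (fo F l))"
proof -
  have nt: "natural_transformation (prod_cat Weil Nmat) X
       (\<lambda>(A, x). fo F (act Nmat A x)) (\<lambda>(\<theta>, f). fm F (actm Nmat \<theta> f))
       (\<lambda>(A, x). act X A (fo F x)) (\<lambda>(\<theta>, f). actm X \<theta> (fm F f))
       (\<lambda>(A, x). al F A x)"
    using F by (simp add: lax_differential_functor_def oplax_weil_linear_def)
  have "\<forall>y\<in>Obj (prod_cat Weil Nmat). (case y of (A, x) \<Rightarrow> al F A x) \<in> Hom X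
      (case y of (A, x) \<Rightarrow> fo F (act Nmat A x)) (case y of (A, x) \<Rightarrow> act X A (fo F x))"
    using nt unfolding natural_transformation_def by blast
  then show ?thesis using A by (auto simp: prod_cat_def Nmat_def)
qed

lemma category_DiffFun_lin: "category (DiffFun_lin Nmat X)"
  unfolding DiffFun_lin_def
proof (rule category_DiffFun_of[OF category])
  fix F :: "(nat, nat mat, 'o, 'a) wfun"
  assume F: "lax_differential_functor Nmat X F"
  have f: "is_functor Nmat X (fo F) (fm F)"
    using F by (simp add: lax_differential_functor_def oplax_weil_linear_def)
  have fo: "fo F l \<in> Obj X" for l
    using f by (simp add: is_functor_def Nmat_def)
  show "linear_nat_trans Nmat X F F (\<lambda>x\<in>Obj Nmat. Id X (fo F x))"
    using nat_trans_Id[OF F] al_Hom[OF F] fo by (simp add: linear_nat_trans_def) (simp add: Nmat_def)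
next
  fix F G H :: "(nat, nat mat, 'o, 'a) wfun" and \<phi> \<psi>
  assume F: "lax_differential_functor Nmat X F" and G: "lax_differential_functor Nmat X G"
    and H: "lax_differential_functor Nmat X H"
    and t: "linear_nat_trans Nmat X F G \<phi>" "linear_nat_trans Nmat X G H \<psi>"
  have U: "Obj Nmat = UNIV" by (simp add: Nmat_def)
  have n: "nat_trans Nmat X F G \<phi>" "nat_trans Nmat X G H \<psi>"
    and l: "\<And>A x. A \<in> Obj Weil \<Longrightarrow> al G A x \<cdot> \<phi> (weil_dim A * x) = actA X A (\<phi> x) \<cdot> al F A x"
      "\<And>A x. A \<in> Obj Weil \<Longrightarrow> al H A x \<cdot> \<psi> (weil_dim A * x) = actA X A (\<psi> x) \<cdot> al G A x"
    using t by (auto simp: linear_nat_trans_def U)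
  have \<phi>: "\<phi> x \<in> Hom X (fo F x) (fo G x)" and \<psi>: "\<psi> x \<in> Hom X (fo G x) (fo H x)" for x
    using n by (auto simp: nat_trans_def natural_transformation_def U)
  note [simp] = \<phi>[unfolded Hom_iff] \<psi>[unfolded Hom_iff]
  have "al H A x \<cdot> (\<psi> (weil_dim A * x) \<cdot> \<phi> (weil_dim A * x)) = actA X A (\<psi> x \<cdot> \<phi> x) \<cdot> al F A x"
    if A: "A \<in> Obj Weil" for A x
  proof -
    note [simp] = al_Hom[OF F A, of x, unfolded Hom_iff] al_Hom[OF G A, of x, unfolded Hom_iff]
      al_Hom[OF H A, of x, unfolded Hom_iff] A
    have "al H A x \<cdot> (\<psi> (weil_dim A * x) \<cdot> \<phi> (weil_dim A * x)) = (actA X A (\<psi> x) \<cdot> al G A x) \<cdot> \<phi> (weil_dim A * x)"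
      by (rule Cmp_reassoc[OF l(2)]) simp_all
    also have "\<dots> = actA X A (\<psi> x) \<cdot> (actA X A (\<phi> x) \<cdot> al F A x)"
      by (simp add: l(1))
    finally show ?thesis by (simp add: actA_Cmp)
  qed
  then show "linear_nat_trans Nmat X F H (\<lambda>x\<in>Obj Nmat. \<psi> x \<cdot> \<phi> x)"
    using nat_trans_Cmp[OF n] by (simp add: linear_nat_trans_def U)
qed (simp add: linear_nat_trans_def)

lemma Ind_arr_Id:
  assumes "differential_bundle X B"
  shows "pow_map X B B (Id X (tot B)) (Id X (bas B)) = (\<lambda>x\<in>Obj Nmat. Id X (fo (Ind X B) x))"
proof -
  interpret dbundle X B by (rule dbundleI) fact
  show ?thesis by (auto simp: fun_eq_iff pow_map_Id Nmat_def)
qed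

lemma Ind_arr_Cmp:
  assumes "differential_bundle X B" "differential_bundle X B'" "differential_bundle X B''"
    and "bundle_morphism X B B' f g" "bundle_morphism X B' B'' f' g'"
  shows "pow_map X B B'' (f' \<cdot> f) (g' \<cdot> g) = (\<lambda>x\<in>Obj Nmat. pow_map X B' B'' f' g' x \<cdot> pow_map X B B' f g x)"
  using pow_map_Cmp[OF dbundle_map.axioms(4)[OF dbundle_mapI] dbundle_map.axioms(4)[OF dbundle_mapI]] assms
  by (auto simp: fun_eq_iff Nmat_def)

lemma is_functor_Ind:
  assumes lax: "\<And>B. differential_bundle X B \<Longrightarrow> lax_differential_functor Nmat X (Ind X B)"
    and C: "category (DBun X mor)" "category (DiffFun_of Nmat X tr)"
    and tr: "\<And>B B' f g. differential_bundle X B \<Longrightarrow> differential_bundle X B' \<Longrightarrow> mor B B' f g \<Longrightarrow>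
        tr (Ind X B) (Ind X B') (pow_map X B B' f g)"
    and bm: "\<And>B B' f g. mor B B' f g \<Longrightarrow> bundle_morphism X B B' f g"
  shows "is_functor (DBun X mor) (DiffFun_of Nmat X tr) (Ind X) (Ind_arr X)"
  unfolding is_functor_def
proof (intro conjI C ballI impI)
  fix B assume "B \<in> Obj (DBun X mor)"
  then have B: "differential_bundle X B" by (simp add: DBun_def)
  show "Ind X B \<in> Obj (DiffFun_of Nmat X tr)" using lax[OF B] by (simp add: DiffFun_of_def)
  show "Ind_arr X (Id (DBun X mor) B) = Id (DiffFun_of Nmat X tr) (Ind X B)"
    using Ind_arr_Id[OF B] by (simp add: DBun_def DiffFun_of_def Ind_arr_def)
next
  fix u assume u: "u \<in> Arr (DBun X mor)"
  then obtain B B' f g where u': "u = (B, B', f, g)" "differential_bundle X B" "differential_bundle X B'" "mor B B' f g"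
    by (auto simp: DBun_def)
  show "Ind_arr X u \<in> Hom (DiffFun_of Nmat X tr) (Ind X (Dom (DBun X mor) u)) (Ind X (Cod (DBun X mor) u))"
    using u' tr lax by (simp add: DBun_def DiffFun_of_def Ind_arr_def) (simp add: Nmat_def)
  fix v assume v: "v \<in> Arr (DBun X mor)" "Dom (DBun X mor) v = Cod (DBun X mor) u"
  then obtain B'' f' g' where v': "v = (B', B'', f', g')" "differential_bundle X B''" "mor B' B'' f' g'"
    using u' by (auto simp: DBun_def)
  show "Ind_arr X (v \<cdot>\<^bsub>DBun X mor\<^esub> u) = Ind_arr X v \<cdot>\<^bsub>DiffFun_of Nmat X tr\<^esub> Ind_arr X u"
    using Ind_arr_Cmp[OF u'(2,3) v'(2) bm[OF u'(4)] bm[OF v'(3)]] u'(1) v'(1)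
    by (simp add: DBun_def DiffFun_of_def Ind_arr_def)
qed

end

theorem theorem5p9:
  fixes X :: "('o, 'a) actegory"
  assumes "tangent_actegory X"
  shows
    "(\<forall>B B' f g. differential_bundle X B \<and> differential_bundle X B' \<and>
        additive_morphism X B B' f g \<longrightarrow>
        nat_trans Nmat X (Ind X B) (Ind X B') (pow_map X B B' f g)) \<and>
     (\<forall>B B' f g. differential_bundle X B \<and> differential_bundle X B' \<and>
        linear_morphism X B B' f g \<longrightarrow>
        linear_nat_trans Nmat X (Ind X B) (Ind X B') (pow_map X B B' f g)) \<and>
     ((\<forall>B. differential_bundle X B \<longrightarrow> lax_differential_functor Nmat X (Ind X B)) \<longrightarrow>
        is_functor (DBun_add X) (DiffFun Nmat X) (Ind X) (Ind_arr X) \<and>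
        is_functor (DBun_lin X) (DiffFun_lin Nmat X) (Ind X) (Ind_arr X))"
proof -
  interpret actegory X
  proof
    have "is_functor (prod_cat Weil X) X (\<lambda>(A, x). act X A x) (\<lambda>(\<theta>, f). actm X \<theta> f)"
      using assms by (simp add: tangent_actegory_def weil_actegory_def)
    then show "category X" by (simp add: is_functor_def)
  qed fact
  show ?thesis
  proof (intro conjI allI impI)
    fix B B' f g
    show "nat_trans Nmat X (Ind X B) (Ind X B') (pow_map X B B' f g)"
      if "differential_bundle X B \<and> differential_bundle X B' \<and> additive_morphism X B B' f g"
      using that nat_trans_pow_map by blast
    show "linear_nat_trans Nmat X (Ind X B) (Ind X B') (pow_map X B B' f g)"
      if "differential_bundle X B \<and> differential_bundle X B' \<and> linear_morphism X B B' f g"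
      using that linear_nat_trans_pow_map by blast
  next
    assume lax: "\<forall>B. differential_bundle X B \<longrightarrow> lax_differential_functor Nmat X (Ind X B)"
    show "is_functor (DBun_add X) (DiffFun Nmat X) (Ind X) (Ind_arr X)"
      unfolding DBun_add_def DiffFun_def
      by (rule is_functor_Ind[OF _ category_DBun_add[unfolded DBun_add_def]
            category_DiffFun[OF category, unfolded DiffFun_def] nat_trans_pow_map])
        (use lax in \<open>simp_all add: additive_morphism_def\<close>)
    show "is_functor (DBun_lin X) (DiffFun_lin Nmat X) (Ind X) (Ind_arr X)"
      unfolding DBun_lin_def DiffFun_lin_def
      by (rule is_functor_Ind[OF _ category_DBun_lin[unfolded DBun_lin_def]
            category_DiffFun_lin[unfolded DiffFun_lin_def] linear_nat_trans_pow_map])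
        (use lax in \<open>simp_all add: linear_morphism_def\<close>)
  qed
qed

end
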